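(* Let $R$ be a commutative complete Noetherian Cohen--Macaulay local ring with algebraically closed residue field, and let $\mathcal{C}(R)$ be the category of maximal Cohen--Macaulay $R$-modules. Then the assignment $\mathcal{X} \mapsto \gamma\circ\Sigma(\mathcal{X}) = \gamma(\Sigma(\mathcal{X}))$ on subsets $\mathcal{X}$ of $\mathsf{Sp}\,\mathcal{C}(R)$ is a Kuratowski closure operator on $\mathsf{Sp}\,\mathcal{C}(R)$. In particular, it induces a topology on $\mathsf{Sp}\,\mathcal{C}(R)$.
   Context: All modules are finitely generated. $\mathcal{C}(R)$ is the full subcategory of $\mathrm{mod}\,R$ (finitely generated $R$-modules) of modules $M$ with $\mathrm{Ext}^i_R(k,M)=0$ for all $i<\dim R$, where $k$ is the residue field. The stable category $\underline{\mathcal{C}}(R)$ has the same objects as $\mathcal{C}(R)$, with morphisms $\underline{\mathrm{Hom}}_R(M,N)=\mathrm{Hom}_R(M,N)/\{\text{morphisms factoring through a free } R\text{-module}\}$. $\mathrm{mod}\,\underline{\mathcal{C}}(R)$ is the category of finitely presented contravariant additive functors $F:\underline{\mathcal{C}}(R)\to Ab$, i.e. those admitting an exact sequence $\underline{\mathrm{Hom}}_R(-,N)\to\underline{\mathrm{Hom}}_R(-,M)\to F\to 0$ with $M,N\in\mathcal{C}(R)$; morphisms are natural transformations. It is known to be an abelian category. $\mathsf{Sp}\,\mathcal{C}(R)$ is the set of isomorphism classes of indecomposable modules in $\mathcal{C}(R)$ except $R$ and $0$. For a subset $\mathcal{X}\subseteq\mathsf{Sp}\,\mathcal{C}(R)$,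 $\Sigma(\mathcal{X})$ is the full subcategory of those $F\in\mathrm{mod}\,\underline{\mathcal{C}}(R)$ with $F(X)=0$ for all $X\in\mathcal{X}$. For a subcategory $\mathcal{F}$ of $\mathrm{mod}\,\underline{\mathcal{C}}(R)$, $\gamma(\mathcal{F})=\{M\in\mathsf{Sp}\,\mathcal{C}(R)\mid F(M)=0 \text{ for all } F\in\mathcal{F}\}$. An operator $c$ on subsets is a Kuratowski closure operator if $c(\emptyset)=\emptyset$, $\mathcal{X}\subseteq c(\mathcal{X})$, $c(\mathcal{X}\cup\mathcal{Y})=c(\mathcal{X})\cup c(\mathcal{Y})$ and $c(c(\mathcal{X}))=c(\mathcal{X})$ for all subsets $\mathcal X,\mathcal Y$; the induced topology has as closed sets exactly the $\mathcal{X}$ with $c(\mathcal{X})=\mathcal{X}$. *)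

theory Defs
  imports
    "HOL-Algebra.Algebra"
    "HOL-Library.Extended_Nat"
    "HOL-Analysis.Abstract_Topology"
begin

section \<open>Local rings, completeness, dimension, depth\<close>

definition local_ring :: "'a ring \<Rightarrow> bool" where
  "local_ring R \<longleftrightarrow> cring R \<and> (\<exists>!I. maximalideal I R)"

definition max_ideal :: "'a ring \<Rightarrow> 'a set" where
  "max_ideal R = (THE I. maximalideal I R)"

text \<open>Completeness in the \<open>I\<close>-adic topology: the canonical map from \<open>R\<close> to the inverse limit of
  the rings \<open>R/I^n\<close> is bijective. The elements of \<open>R/I^n\<close> are the cosets of \<open>I^n\<close>, and a family of
  cosets is compatible with the transition maps iff it is decreasing for inclusion.\<close>

definition adic_complete :: "'a ring \<Rightarrow> 'a set \<Rightarrow> bool" where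
  "adic_complete R I \<longleftrightarrow>
    (\<forall>Z :: nat \<Rightarrow> 'a set.
      (\<forall>n. Z n \<in> carrier (R Quot (I [^]\<^bsub>ideals_set R\<^esub> n)) \<and> Z (Suc n) \<subseteq> Z n) \<longrightarrow>
      (\<exists>!r. r \<in> carrier R \<and> (\<forall>n. Z n = (I [^]\<^bsub>ideals_set R\<^esub> n) +>\<^bsub>R\<^esub> r)))"

definition krull_dim :: "'a ring \<Rightarrow> enat" where
  "krull_dim R = Sup {enat n | n. \<exists>P :: nat \<Rightarrow> 'a set.
     (\<forall>i\<le>n. primeideal (P i) R) \<and> (\<forall>i<n. P i \<subset> P (Suc i))}"

definition regular_sequence :: "'a ring \<Rightarrow> 'a list \<Rightarrow> bool" where
  "regular_sequence R xs \<longleftrightarrow>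
     set xs \<subseteq> carrier R \<and> Idl\<^bsub>R\<^esub> (set xs) \<noteq> carrier R \<and>
     (\<forall>i<length xs. \<forall>r\<in>carrier R.
        xs ! i \<otimes>\<^bsub>R\<^esub> r \<in> Idl\<^bsub>R\<^esub> (set (take i xs)) \<longrightarrow> r \<in> Idl\<^bsub>R\<^esub> (set (take i xs)))"

definition ring_depth :: "'a ring \<Rightarrow> enat" where
  "ring_depth R =
     Sup {enat (length xs) | xs. regular_sequence R xs \<and> set xs \<subseteq> max_ideal R}"

definition cohen_macaulay :: "'a ring \<Rightarrow> bool" where
  "cohen_macaulay R \<longleftrightarrow> ring_depth R = krull_dim R"

section \<open>Modules and homomorphisms\<close>

text \<open>Homomorphisms are extensional functions, so that two homomorphisms are equal as soon as
  they agree on the carrier. The fields \<open>mult\<close> and \<open>one\<close> of a module record play no role.\<close>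

definition mod_hom :: "'a ring \<Rightarrow> ('a, 'm) module \<Rightarrow> ('a, 'n) module \<Rightarrow> ('m \<Rightarrow> 'n) set" where
  "mod_hom R M N = {f \<in> carrier M \<rightarrow>\<^sub>E carrier N.
     (\<forall>x\<in>carrier M. \<forall>y\<in>carrier M. f (x \<oplus>\<^bsub>M\<^esub> y) = f x \<oplus>\<^bsub>N\<^esub> f y) \<and>
     (\<forall>a\<in>carrier R. \<forall>x\<in>carrier M. f (a \<odot>\<^bsub>M\<^esub> x) = a \<odot>\<^bsub>N\<^esub> f x)}"

definition mod_isomorphic :: "'a ring \<Rightarrow> ('a, 'm) module \<Rightarrow> ('a, 'n) module \<Rightarrow> bool" where
  "mod_isomorphic R M N \<longleftrightarrow> (\<exists>f\<in>mod_hom R M N. bij_betw f (carrier M) (carrier N))"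

definition fin_gen :: "'a ring \<Rightarrow> ('a, 'm) module \<Rightarrow> bool" where
  "fin_gen R M \<longleftrightarrow>
     (\<exists>S. finite S \<and> S \<subseteq> carrier M \<and> (\<forall>H. submodule H R M \<and> S \<subseteq> H \<longrightarrow> H = carrier M))"

definition indecomposable :: "'a ring \<Rightarrow> ('a, 'm) module \<Rightarrow> bool" where
  "indecomposable R M \<longleftrightarrow> carrier M \<noteq> {\<zero>\<^bsub>M\<^esub>} \<and>
     (\<forall>A B. submodule A R M \<and> submodule B R M \<and> A <+>\<^bsub>M\<^esub> B = carrier M \<and> A \<inter> B = {\<zero>\<^bsub>M\<^esub>} \<longrightarrow>
        A = {\<zero>\<^bsub>M\<^esub>} \<or> B = {\<zero>\<^bsub>M\<^esub>})"

definition regular_module :: "'a ring \<Rightarrow> ('a, 'a) module" where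
  "regular_module R =
     \<lparr>carrier = carrier R, monoid.mult = monoid.mult R, one = \<one>\<^bsub>R\<^esub>, ring.zero = \<zero>\<^bsub>R\<^esub>,
      add = add R, smult = monoid.mult R\<rparr>"

definition residue_module :: "'a ring \<Rightarrow> ('a, 'a set) module" where
  "residue_module R = (let k = R Quot max_ideal R in
     \<lparr>carrier = carrier k, monoid.mult = monoid.mult k, one = \<one>\<^bsub>k\<^esub>, ring.zero = \<zero>\<^bsub>k\<^esub>, add = add k,
      smult = (\<lambda>a x. (max_ideal R +>\<^bsub>R\<^esub> a) \<otimes>\<^bsub>k\<^esub> x)\<rparr>)"

definition free_module :: "'a ring \<Rightarrow> nat \<Rightarrow> ('a, nat \<Rightarrow> 'a) module" where
  "free_module R n =
     \<lparr>carrier = {..<n} \<rightarrow>\<^sub>E carrier R, monoid.mult = undefined, one = undefined,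
      ring.zero = (\<lambda>i\<in>{..<n}. \<zero>\<^bsub>R\<^esub>), add = (\<lambda>x y. \<lambda>i\<in>{..<n}. x i \<oplus>\<^bsub>R\<^esub> y i),
      smult = (\<lambda>a x. \<lambda>i\<in>{..<n}. a \<otimes>\<^bsub>R\<^esub> x i)\<rparr>"

definition hom_group :: "'a ring \<Rightarrow> ('a, 'm) module \<Rightarrow> ('a, 'n) module \<Rightarrow> ('m \<Rightarrow> 'n) monoid" where
  "hom_group R M N =
     \<lparr>carrier = mod_hom R M N, monoid.mult = (\<lambda>f g. \<lambda>x\<in>carrier M. f x \<oplus>\<^bsub>N\<^esub> g x),
      one = (\<lambda>x\<in>carrier M. \<zero>\<^bsub>N\<^esub>)\<rparr>"

section \<open>Ext\<close>

text \<open>\<open>\<dots> \<rightarrow> R^(r 2) \<rightarrow> R^(r 1) \<rightarrow> R^(r 0) \<rightarrow> K \<rightarrow> 0\<close> is exact, with differentials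
  \<open>d i : R^(r (i + 1)) \<rightarrow> R^(r i)\<close> and augmentation \<open>e\<close>. Over a Noetherian ring every finitely
  generated module has such a resolution.\<close>

definition free_resolution ::
    "'a ring \<Rightarrow> ('a, 'k) module \<Rightarrow> (nat \<Rightarrow> nat) \<Rightarrow>
     (nat \<Rightarrow> (nat \<Rightarrow> 'a) \<Rightarrow> (nat \<Rightarrow> 'a)) \<Rightarrow> ((nat \<Rightarrow> 'a) \<Rightarrow> 'k) \<Rightarrow> bool" where
  "free_resolution R K r d e \<longleftrightarrow>
     e \<in> mod_hom R (free_module R (r 0)) K \<and>
     (\<forall>i. d i \<in> mod_hom R (free_module R (r (Suc i))) (free_module R (r i))) \<and>
     e ` carrier (free_module R (r 0)) = carrier K \<and>
     {x \<in> carrier (free_module R (r 0)). e x = \<zero>\<^bsub>K\<^esub>} = d 0 ` carrier (free_module R (r 1)) \<and>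
     (\<forall>i. {x \<in> carrier (free_module R (r (Suc i))). d i x = \<zero>\<^bsub>free_module R (r i)\<^esub>}
        = d (Suc i) ` carrier (free_module R (r (Suc (Suc i)))))"

definition cocycles ::
    "'a ring \<Rightarrow> (nat \<Rightarrow> nat) \<Rightarrow> (nat \<Rightarrow> (nat \<Rightarrow> 'a) \<Rightarrow> (nat \<Rightarrow> 'a)) \<Rightarrow> ('a, 'm) module \<Rightarrow> nat \<Rightarrow>
     ((nat \<Rightarrow> 'a) \<Rightarrow> 'm) set" where
  "cocycles R r d M i =
     {f \<in> mod_hom R (free_module R (r i)) M.
        compose (carrier (free_module R (r (Suc i)))) f (d i)
          = \<one>\<^bsub>hom_group R (free_module R (r (Suc i))) M\<^esub>}"

definition coboundaries ::
    "'a ring \<Rightarrow> (nat \<Rightarrow> nat) \<Rightarrow> (nat \<Rightarrow> (nat \<Rightarrow> 'a) \<Rightarrow> (nat \<Rightarrow> 'a)) \<Rightarrow> ('a, 'm) module \<Rightarrow> nat \<Rightarrow>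
     ((nat \<Rightarrow> 'a) \<Rightarrow> 'm) set" where
  "coboundaries R r d M i =
     (case i of 0 \<Rightarrow> {\<one>\<^bsub>hom_group R (free_module R (r 0)) M\<^esub>}
      | Suc j \<Rightarrow> (\<lambda>g. compose (carrier (free_module R (r (Suc j)))) g (d j))
                   ` mod_hom R (free_module R (r j)) M)"

text \<open>\<open>Ext^i(K, M)\<close> is the \<open>i\<close>-th cohomology of \<open>Hom(P, M)\<close> for a chosen free resolution \<open>P\<close> of \<open>K\<close>
  by modules of finite rank; up to isomorphism it does not depend on the choice. The definition is
  meaningful for \<open>R\<close> Noetherian and \<open>K\<close> finitely generated.\<close>

definition Ext ::
    "'a ring \<Rightarrow> ('a, 'k) module \<Rightarrow> ('a, 'm) module \<Rightarrow> nat \<Rightarrow> ((nat \<Rightarrow> 'a) \<Rightarrow> 'm) set monoid" where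
  "Ext R K M i =
     (let (r, d, e) = (SOME (r, d, e). free_resolution R K r d e)
      in (hom_group R (free_module R (r i)) M)\<lparr>carrier := cocycles R r d M i\<rparr>
           Mod coboundaries R r d M i)"

section \<open>Maximal Cohen--Macaulay modules and the stable category\<close>

text \<open>Every finitely generated \<open>R\<close>-module is a quotient of some \<open>R^n\<close>, so up to isomorphism its
  elements are sets of coefficient tuples; see \<open>fin_gen_module_representable\<close> below. The
  type \<open>'a rmod\<close> therefore contains a representative of every finitely generated module.\<close>

type_synonym 'a elt = "(nat \<Rightarrow> 'a) set"
type_synonym 'a rmod = "('a, 'a elt) module"

definition MCM :: "'a ring \<Rightarrow> 'a rmod set" where
  "MCM R = {M. module R M \<and> fin_gen R M \<and>
     (\<forall>i. enat i < krull_dim R \<longrightarrow> trivial_group (Ext R (residue_module R) M i))}"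

definition factors_through_free ::
    "'a ring \<Rightarrow> ('a, 'm) module \<Rightarrow> ('a, 'n) module \<Rightarrow> ('m \<Rightarrow> 'n) set" where
  "factors_through_free R M N =
     {compose (carrier M) h g | g h n.
        g \<in> mod_hom R M (free_module R n) \<and> h \<in> mod_hom R (free_module R n) N}"

type_synonym 'a shom = "('a elt \<Rightarrow> 'a elt) set"

definition stable_hom :: "'a ring \<Rightarrow> 'a rmod \<Rightarrow> 'a rmod \<Rightarrow> 'a shom monoid" where
  "stable_hom R M N = hom_group R M N Mod factors_through_free R M N"

definition stable_class :: "'a ring \<Rightarrow> 'a rmod \<Rightarrow> 'a rmod \<Rightarrow> ('a elt \<Rightarrow> 'a elt) \<Rightarrow> 'a shom" where
  "stable_class R M N f = factors_through_free R M N #>\<^bsub>hom_group R M N\<^esub> f"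

definition stable_id :: "'a ring \<Rightarrow> 'a rmod \<Rightarrow> 'a shom" where
  "stable_id R M = stable_class R M M (\<lambda>x\<in>carrier M. x)"

text \<open>\<open>stable_comp R L M N v u\<close> composes \<open>u : L \<rightarrow> M\<close> and \<open>v : M \<rightarrow> N\<close>; as for
  \<^const>\<open>rcoset_mult\<close>, the union is over representatives and all its members coincide.\<close>

definition stable_comp ::
    "'a ring \<Rightarrow> 'a rmod \<Rightarrow> 'a rmod \<Rightarrow> 'a rmod \<Rightarrow> 'a shom \<Rightarrow> 'a shom \<Rightarrow> 'a shom" where
  "stable_comp R L M N v u = (\<Union>g\<in>v. \<Union>f\<in>u. stable_class R L N (compose (carrier L) g f))"

section \<open>Finitely presented functors\<close>

record ('a, 'g) contrafunctor =
  ob :: "'a rmod \<Rightarrow> 'g monoid"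
  ar :: "'a rmod \<Rightarrow> 'a rmod \<Rightarrow> 'a shom \<Rightarrow> 'g \<Rightarrow> 'g"

text \<open>Contravariant additive functors from the stable category to abelian groups (written
  multiplicatively as in \<^theory>\<open>HOL-Algebra.Group\<close>): \<open>ar F M N u\<close> maps \<open>ob F N\<close> to \<open>ob F M\<close> for
  \<open>u : M \<rightarrow> N\<close>. Nothing is required outside \<^term>\<open>MCM R\<close>.\<close>

definition additive_functor :: "'a ring \<Rightarrow> ('a, 'g) contrafunctor \<Rightarrow> bool" where
  "additive_functor R F \<longleftrightarrow>
     (\<forall>M\<in>MCM R. comm_group (ob F M)) \<and>
     (\<forall>M\<in>MCM R. \<forall>N\<in>MCM R. \<forall>u\<in>carrier (stable_hom R M N). ar F M N u \<in> hom (ob F N) (ob F M)) \<and>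
     (\<forall>M\<in>MCM R. \<forall>x\<in>carrier (ob F M). ar F M M (stable_id R M) x = x) \<and>
     (\<forall>L\<in>MCM R. \<forall>M\<in>MCM R. \<forall>N\<in>MCM R.
        \<forall>u\<in>carrier (stable_hom R L M). \<forall>v\<in>carrier (stable_hom R M N). \<forall>x\<in>carrier (ob F N).
          ar F L N (stable_comp R L M N v u) x = ar F L M u (ar F M N v x)) \<and>
     (\<forall>M\<in>MCM R. \<forall>N\<in>MCM R.
        \<forall>u\<in>carrier (stable_hom R M N). \<forall>v\<in>carrier (stable_hom R M N). \<forall>x\<in>carrier (ob F N).
          ar F M N (u \<otimes>\<^bsub>stable_hom R M N\<^esub> v) x = ar F M N u x \<otimes>\<^bsub>ob F M\<^esub> ar F M N v x)"

definition nat_trans ::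
    "'a ring \<Rightarrow> ('a, 'g) contrafunctor \<Rightarrow> ('a, 'h) contrafunctor \<Rightarrow> ('a rmod \<Rightarrow> 'g \<Rightarrow> 'h) \<Rightarrow> bool" where
  "nat_trans R F G t \<longleftrightarrow>
     (\<forall>M\<in>MCM R. t M \<in> hom (ob F M) (ob G M)) \<and>
     (\<forall>M\<in>MCM R. \<forall>N\<in>MCM R. \<forall>u\<in>carrier (stable_hom R M N). \<forall>x\<in>carrier (ob F N).
        t M (ar F M N u x) = ar G M N u (t N x))"

definition representable :: "'a ring \<Rightarrow> 'a rmod \<Rightarrow> ('a, 'a shom) contrafunctor" where
  "representable R M =
     \<lparr>ob = (\<lambda>Z. stable_hom R Z M), ar = (\<lambda>Z Y u v. stable_comp R Z Y M v u)\<rparr>"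

definition finitely_presented :: "'a ring \<Rightarrow> ('a, 'g) contrafunctor \<Rightarrow> bool" where
  "finitely_presented R F \<longleftrightarrow>
     additive_functor R F \<and>
     (\<exists>M\<in>MCM R. \<exists>N\<in>MCM R. \<exists>s t.
        nat_trans R (representable R N) (representable R M) s \<and>
        nat_trans R (representable R M) F t \<and>
        (\<forall>Z\<in>MCM R.
           kernel (stable_hom R Z M) (ob F Z) (t Z) = s Z ` carrier (stable_hom R Z N) \<and>
           t Z ` carrier (stable_hom R Z M) = carrier (ob F Z)))"

text \<open>The values of a finitely presented functor are quotients of stable Hom groups, so up to natural
  isomorphism their elements are sets of elements of stable Hom groups; see
  \<open>finitely_presented_representable\<close> below.\<close>

definition mod_MCM :: "'a ring \<Rightarrow> ('a, 'a shom set) contrafunctor set" where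
  "mod_MCM R = {F. finitely_presented R F}"

section \<open>The spectrum and the two vanishing operators\<close>

definition iso_class :: "'a ring \<Rightarrow> 'a rmod \<Rightarrow> 'a rmod set" where
  "iso_class R M = {N \<in> MCM R. mod_isomorphic R M N}"

text \<open>The zero module is excluded because it is not \<^const>\<open>indecomposable\<close>.\<close>

definition Sp :: "'a ring \<Rightarrow> 'a rmod set set" where
  "Sp R = {iso_class R M | M.
     M \<in> MCM R \<and> indecomposable R M \<and> \<not> mod_isomorphic R M (regular_module R)}"

definition vanishes_at :: "('a, 'g) contrafunctor \<Rightarrow> 'a rmod set \<Rightarrow> bool" where
  "vanishes_at F Z \<longleftrightarrow> (\<forall>M\<in>Z. trivial_group (ob F M))"

definition Sigma_functors :: "'a ring \<Rightarrow> 'a rmod set set \<Rightarrow> ('a, 'a shom set) contrafunctor set" where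
  "Sigma_functors R A = {F \<in> mod_MCM R. \<forall>Z\<in>A. vanishes_at F Z}"

definition gamma_points :: "'a ring \<Rightarrow> ('a, 'a shom set) contrafunctor set \<Rightarrow> 'a rmod set set" where
  "gamma_points R \<F> = {Z \<in> Sp R. \<forall>F\<in>\<F>. vanishes_at F Z}"

definition kuratowski_closure_operator :: "'b set \<Rightarrow> ('b set \<Rightarrow> 'b set) \<Rightarrow> bool" where
  "kuratowski_closure_operator S c \<longleftrightarrow>
     (\<forall>Z. Z \<subseteq> S \<longrightarrow> c Z \<subseteq> S) \<and>
     c {} = {} \<and>
     (\<forall>Z. Z \<subseteq> S \<longrightarrow> Z \<subseteq> c Z) \<and>
     (\<forall>Z Y. Z \<subseteq> S \<and> Y \<subseteq> S \<longrightarrow> c (Z \<union> Y) = c Z \<union> c Y) \<and>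
     (\<forall>Z. Z \<subseteq> S \<longrightarrow> c (c Z) = c Z)"

section \<open>Adequacy of the chosen types\<close>

lemma fin_gen_surj:
  fixes R :: "'a ring" (structure) and M :: "('a, 'm) module"
  assumes M: "module R M" and fg: "fin_gen R M"
  shows "\<exists>p :: (nat \<Rightarrow> 'a) \<Rightarrow> 'm. carrier M \<subseteq> range p"
proof -
  interpret module R M by fact
  obtain S where S: "finite S" "S \<subseteq> carrier M"
    and gen: "\<And>H. submodule H R M \<Longrightarrow> S \<subseteq> H \<Longrightarrow> H = carrier M"
    using fg unfolding fin_gen_def by blast
  obtain ix :: "'m \<Rightarrow> nat" where ix: "inj_on ix S"
    using S(1) by (meson finite_imp_inj_to_nat_seg)
  let ?p = "\<lambda>c. finsum M (\<lambda>s. c (ix s) \<odot>\<^bsub>M\<^esub> s) S"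
  let ?C = "{c :: nat \<Rightarrow> 'a. range c \<subseteq> carrier R}"
  have clos: "(\<lambda>s. c (ix s) \<odot>\<^bsub>M\<^esub> s) \<in> S \<rightarrow> carrier M" if "c \<in> ?C" for c
    using that S(2) by auto
  have cl: "c (ix s) \<odot>\<^bsub>M\<^esub> s \<in> carrier M" if "c \<in> ?C" "s \<in> S" for c s
    using that S(2) by auto
  have cC: "c n \<in> carrier R" if "c \<in> ?C" for c n
    using that by auto
  have "submodule (?p ` ?C) R M"
  proof (rule submoduleI)
    show "?p ` ?C \<subseteq> carrier M"
      using clos by (auto intro: M.finsum_closed)
    have "?p (\<lambda>_. \<zero>) = finsum M (\<lambda>s. \<zero>\<^bsub>M\<^esub>) S"
      by (rule M.finsum_cong') (use S(2) in auto)
    then show "\<zero>\<^bsub>M\<^esub> \<in> ?p ` ?C"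
      by (intro image_eqI[of _ _ "\<lambda>_. \<zero>"]) auto
    show "a \<oplus>\<^bsub>M\<^esub> b \<in> ?p ` ?C" if "a \<in> ?p ` ?C" "b \<in> ?p ` ?C" for a b
    proof -
      obtain c d where cd: "c \<in> ?C" "d \<in> ?C" "a = ?p c" "b = ?p d" using \<open>a \<in> _\<close> \<open>b \<in> _\<close> by blast
      have "?p (\<lambda>i. c i \<oplus> d i)
          = finsum M (\<lambda>s. c (ix s) \<odot>\<^bsub>M\<^esub> s \<oplus>\<^bsub>M\<^esub> d (ix s) \<odot>\<^bsub>M\<^esub> s) S"
        by (rule M.finsum_cong') (use S(2) cl[OF cd(1)] cl[OF cd(2)] cC[OF cd(1)] cC[OF cd(2)] in
              \<open>auto simp: Pi_iff intro!: smult_l_distr\<close>)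
      also have "\<dots> = a \<oplus>\<^bsub>M\<^esub> b"
        using cd clos by (simp add: M.finsum_addf)
      finally show ?thesis
        using cd by (intro image_eqI[of _ _ "\<lambda>i. c i \<oplus> d i"]) auto
    qed
    show sm: "a \<odot>\<^bsub>M\<^esub> x \<in> ?p ` ?C" if "a \<in> carrier R" "x \<in> ?p ` ?C" for a x
    proof -
      obtain c where c: "c \<in> ?C" "x = ?p c" using \<open>x \<in> _\<close> by blast
      have "a \<odot>\<^bsub>M\<^esub> ?p c = finsum M (\<lambda>s. a \<odot>\<^bsub>M\<^esub> (c (ix s) \<odot>\<^bsub>M\<^esub> s)) S"
        using finsum_smult_ldistr[OF S(1) \<open>a \<in> carrier R\<close> clos[OF c(1)]] .
      also have "\<dots> = ?p (\<lambda>i. a \<otimes> c i)"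
        by (rule M.finsum_cong')
           (use S(2) cl[OF c(1)] cC[OF c(1)] that(1) in \<open>auto simp: smult_assoc1 subset_iff\<close>)
      finally show ?thesis
        using c that by (intro image_eqI[of _ _ "\<lambda>i. a \<otimes> c i"]) auto
    qed
    show "\<ominus>\<^bsub>M\<^esub> a \<in> ?p ` ?C" if "a \<in> ?p ` ?C" for a
    proof -
      have "a \<in> carrier M" using that clos by (auto intro: M.finsum_closed)
      then have "\<ominus>\<^bsub>M\<^esub> a = (\<ominus> \<one>) \<odot>\<^bsub>M\<^esub> a"
        by (simp add: smult_l_minus)
      then show ?thesis using sm[OF _ that, of "\<ominus> \<one>"] by simp
    qed
  qed
  moreover have "S \<subseteq> ?p ` ?C"
  proof
    fix s assume s: "s \<in> S"
    let ?c = "\<lambda>i. if i = ix s then \<one> else \<zero>"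
    have "?p ?c = finsum M (\<lambda>t. if s = t then s else \<zero>\<^bsub>M\<^esub>) S"
      by (rule M.finsum_cong') (use S(2) s ix in \<open>auto simp: inj_on_eq_iff\<close>)
    also have "\<dots> = s"
      using M.finsum_singleton[of s S "\<lambda>_. s"] s S by auto
    finally show "s \<in> ?p ` ?C"
      by (intro image_eqI[of _ _ ?c]) auto
  qed
  ultimately have eq: "?p ` ?C = carrier M" by (rule gen)
  have "?p ` ?C \<subseteq> range ?p" by (rule image_mono) (rule subset_UNIV)
  then have "carrier M \<subseteq> range ?p" by (simp only: eq)
  then show ?thesis by (rule exI[of _ ?p])
qed

lemma fin_gen_module_representable:
  fixes M :: "('a, 'm) module"
  assumes M: "module R M" and fg: "fin_gen R M"
  shows "\<exists>M' :: 'a rmod. module R M' \<and> fin_gen R M' \<and> mod_isomorphic R M M'"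
proof -
  interpret module R M by fact
  obtain p :: "(nat \<Rightarrow> 'a) \<Rightarrow> 'm" where p: "carrier M \<subseteq> range p"
    using fin_gen_surj[OF assms] by blast
  define i where "i m = {c. p c = m}" for m
  have inj: "inj_on i (carrier M)"
    unfolding inj_on_def i_def using p by blast
  define j where "j = inv_into (carrier M) i"
  have ji [simp]: "j (i m) = m" if "m \<in> carrier M" for m
    using inv_into_f_f[OF inj that] by (simp add: j_def)
  define M' :: "'a rmod" where "M' =
     \<lparr>carrier = i ` carrier M, monoid.mult = undefined, one = undefined, ring.zero = i \<zero>\<^bsub>M\<^esub>,
      add = (\<lambda>x y. i (j x \<oplus>\<^bsub>M\<^esub> j y)), smult = (\<lambda>a x. i (a \<odot>\<^bsub>M\<^esub> j x))\<rparr>"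
  have c [simp]: "carrier M' = i ` carrier M" by (simp add: M'_def)
  have z [simp]: "\<zero>\<^bsub>M'\<^esub> = i \<zero>\<^bsub>M\<^esub>" by (simp add: M'_def)
  have a [simp]: "i x \<oplus>\<^bsub>M'\<^esub> i y = i (x \<oplus>\<^bsub>M\<^esub> y)" if "x \<in> carrier M" "y \<in> carrier M" for x y
    using that by (simp add: M'_def)
  have s [simp]: "r \<odot>\<^bsub>M'\<^esub> i x = i (r \<odot>\<^bsub>M\<^esub> x)" if "x \<in> carrier M" for r x
    using that by (simp add: M'_def)
  have ab: "abelian_group M'"
  proof (rule abelian_groupI)
    fix x assume "x \<in> carrier M'"
    then obtain m where m: "m \<in> carrier M" "x = i m" by auto
    show "\<exists>y\<in>carrier M'. y \<oplus>\<^bsub>M'\<^esub> x = \<zero>\<^bsub>M'\<^esub>"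
      using m by (intro bexI[of _ "i (\<ominus>\<^bsub>M\<^esub> m)"]) (auto simp: M.l_neg)
  qed (auto simp: M.a_ac)
  have mo: "module R M'"
    by (rule moduleI)
       (auto simp: ab module.axioms(1)[OF M] smult_l_distr smult_r_distr smult_assoc1)
  have iso: "mod_isomorphic R M M'"
    unfolding mod_isomorphic_def mod_hom_def
    using inj by (intro bexI[of _ "restrict i (carrier M)"]) (auto simp: bij_betw_def inj_on_def)
  obtain S where S: "finite S" "S \<subseteq> carrier M"
    and gen: "\<And>H. submodule H R M \<Longrightarrow> S \<subseteq> H \<Longrightarrow> H = carrier M"
    using fg unfolding fin_gen_def by blast
  interpret M': module R M' by fact
  have inv': "\<ominus>\<^bsub>M'\<^esub> i x = i (\<ominus>\<^bsub>M\<^esub> x)" if "x \<in> carrier M" for x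
    by (rule M'.minus_equality) (use that in \<open>auto simp: M.l_neg\<close>)
  have "H = carrier M'" if H: "submodule H R M'" "i ` S \<subseteq> H" for H
  proof -
    note E = M'.submoduleE[OF H(1)]
    have z': "i \<zero>\<^bsub>M\<^esub> \<in> H"
      using subgroup.one_closed[OF submodule.axioms(1)[OF H(1)]] by simp
    have "submodule {x \<in> carrier M. i x \<in> H} R M"
    proof (rule submoduleI)
      show "\<zero>\<^bsub>M\<^esub> \<in> {x \<in> carrier M. i x \<in> H}" using z' by simp
      show "\<ominus>\<^bsub>M\<^esub> a \<in> {x \<in> carrier M. i x \<in> H}" if "a \<in> {x \<in> carrier M. i x \<in> H}" for a
        using that E(3)[of "i a"] inv' by auto
      show "a \<oplus>\<^bsub>M\<^esub> b \<in> {x \<in> carrier M. i x \<in> H}"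
        if "a \<in> {x \<in> carrier M. i x \<in> H}" "b \<in> {x \<in> carrier M. i x \<in> H}" for a b
        using that E(5)[of "i a" "i b"] by auto
      show "a \<odot>\<^bsub>M\<^esub> x \<in> {x \<in> carrier M. i x \<in> H}"
        if "a \<in> carrier R" "x \<in> {x \<in> carrier M. i x \<in> H}" for a x
        using that E(4)[of a "i x"] by auto
    qed auto
    then have "{x \<in> carrier M. i x \<in> H} = carrier M"
      by (rule gen) (use S H(2) in auto)
    then show ?thesis using E(1) by auto
  qed
  then have "fin_gen R M'"
    unfolding fin_gen_def using S by (intro exI[of _ "i ` S"]) auto
  with mo iso show ?thesis by blast
qed

lemma finitely_presented_representable:
  fixes F :: "('a, 'g) contrafunctor"
  assumes fp: "finitely_presented R F"
  shows "\<exists>F' \<in> mod_MCM R. \<exists>t. nat_trans R F F' t \<and>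
           (\<forall>Z\<in>MCM R. bij_betw (t Z) (carrier (ob F Z)) (carrier (ob F' Z)))"
proof -
  obtain M N s t where MN: "M \<in> MCM R" "N \<in> MCM R"
    and s: "nat_trans R (representable R N) (representable R M) s"
    and t: "nat_trans R (representable R M) F t"
    and ks: "\<forall>Z\<in>MCM R.
        kernel (stable_hom R Z M) (ob F Z) (t Z) = s Z ` carrier (stable_hom R Z N) \<and>
        t Z ` carrier (stable_hom R Z M) = carrier (ob F Z)"
    and F: "additive_functor R F"
    using fp unfolding finitely_presented_def by (elim conjE bexE exE) (rule that)
  have ker: "kernel (stable_hom R Z M) (ob F Z) (t Z) = s Z ` carrier (stable_hom R Z N)"
    and sur: "t Z ` carrier (stable_hom R Z M) = carrier (ob F Z)" if "Z \<in> MCM R" for Z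
    using ks that by blast+
  define i where "i Z x = {v \<in> carrier (stable_hom R Z M). t Z v = x}" for Z x
  have inj: "inj_on (i Z) (carrier (ob F Z))" if Z: "Z \<in> MCM R" for Z
  proof (rule inj_onI)
    fix x y assume x: "x \<in> carrier (ob F Z)" and e: "i Z x = i Z y"
    obtain v where v: "v \<in> carrier (stable_hom R Z M)" "t Z v = x"
      using x unfolding sur[OF Z, symmetric] by blast
    then have "v \<in> i Z x" by (simp add: i_def)
    then have "v \<in> i Z y" by (simp only: e)
    then show "x = y" using v by (simp add: i_def)
  qed
  define j where "j Z = inv_into (carrier (ob F Z)) (i Z)" for Z
  have ji [simp]: "j Z (i Z x) = x" if "Z \<in> MCM R" "x \<in> carrier (ob F Z)" for Z x
    using inv_into_f_f[OF inj that(2)] that by (simp add: j_def)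
  define F' :: "('a, 'a shom set) contrafunctor" where "F' =
     \<lparr>ob = (\<lambda>Z. \<lparr>carrier = i Z ` carrier (ob F Z),
                 monoid.mult = (\<lambda>x y. i Z (j Z x \<otimes>\<^bsub>ob F Z\<^esub> j Z y)),
                 one = i Z \<one>\<^bsub>ob F Z\<^esub>\<rparr>),
      ar = (\<lambda>Z Y u x. i Z (ar F Z Y u (j Y x)))\<rparr>"
  have c [simp]: "carrier (ob F' Z) = i Z ` carrier (ob F Z)" for Z by (simp add: F'_def)
  have o [simp]: "\<one>\<^bsub>ob F' Z\<^esub> = i Z \<one>\<^bsub>ob F Z\<^esub>" for Z by (simp add: F'_def)
  have m [simp]: "i Z x \<otimes>\<^bsub>ob F' Z\<^esub> i Z y = i Z (x \<otimes>\<^bsub>ob F Z\<^esub> y)"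
    if "Z \<in> MCM R" "x \<in> carrier (ob F Z)" "y \<in> carrier (ob F Z)" for Z x y
    using that by (simp add: F'_def)
  have r [simp]: "ar F' Z Y u (i Y x) = i Z (ar F Z Y u x)"
    if "Y \<in> MCM R" "x \<in> carrier (ob F Y)" for Z Y u x
    using that by (simp add: F'_def)
  have cg: "comm_group (ob F Z)" if "Z \<in> MCM R" for Z
    using F that unfolding additive_functor_def by blast
  have h: "ar F Z Y u \<in> hom (ob F Y) (ob F Z)"
    if "Z \<in> MCM R" "Y \<in> MCM R" "u \<in> carrier (stable_hom R Z Y)" for Z Y u
    using F that unfolding additive_functor_def by blast
  have hc [simp]: "ar F Z Y u x \<in> carrier (ob F Z)"
    if "Z \<in> MCM R" "Y \<in> MCM R" "u \<in> carrier (stable_hom R Z Y)" "x \<in> carrier (ob F Y)" for Z Y u x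
    using hom_in_carrier[OF h] that by blast
  have ii: "i Z \<in> hom (ob F Z) (ob F' Z)" if "Z \<in> MCM R" for Z
    using that by (auto simp: hom_def)
  have cg': "comm_group (ob F' Z)" if Z: "Z \<in> MCM R" for Z
  proof -
    interpret comm_group "ob F Z" by (rule cg[OF Z])
    show ?thesis
    proof (rule comm_groupI)
      fix x assume "x \<in> carrier (ob F' Z)"
      then obtain y where y: "y \<in> carrier (ob F Z)" "x = i Z y" by auto
      show "\<exists>z\<in>carrier (ob F' Z). z \<otimes>\<^bsub>ob F' Z\<^esub> x = \<one>\<^bsub>ob F' Z\<^esub>"
        using y Z by (intro bexI[of _ "i Z (inv\<^bsub>ob F Z\<^esub> y)"]) auto
    qed (use Z in \<open>auto simp: m_ac\<close>)
  qed
  have add': "additive_functor R F'"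
    unfolding additive_functor_def
  proof (intro conjI ballI)
    show "comm_group (ob F' Z)" if "Z \<in> MCM R" for Z by (rule cg'[OF that])
    show "ar F' Z Y u \<in> hom (ob F' Y) (ob F' Z)"
      if "Z \<in> MCM R" "Y \<in> MCM R" "u \<in> carrier (stable_hom R Z Y)" for Z Y u
    proof -
      interpret comm_group "ob F Y" by (rule cg) fact
      show ?thesis
        using that by (auto simp: hom_def hom_mult[OF h[OF that]])
    qed
  next
    fix Z x assume Z: "Z \<in> MCM R" and "x \<in> carrier (ob F' Z)"
    moreover have "ar F Z Z (stable_id R Z) y = y" if "y \<in> carrier (ob F Z)" for y
      using F Z that unfolding additive_functor_def by blast
    ultimately show "ar F' Z Z (stable_id R Z) x = x" by auto
  next
    fix Z Y W u v x
    assume *: "Z \<in> MCM R" "Y \<in> MCM R" "W \<in> MCM R" "u \<in> carrier (stable_hom R Z Y)"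
      "v \<in> carrier (stable_hom R Y W)" "x \<in> carrier (ob F' W)"
    have "ar F Z W (stable_comp R Z Y W v u) y = ar F Z Y u (ar F Y W v y)"
      if "y \<in> carrier (ob F W)" for y
      using F * that unfolding additive_functor_def by blast
    then show "ar F' Z W (stable_comp R Z Y W v u) x = ar F' Z Y u (ar F' Y W v x)"
      using * by auto
  next
    fix Z Y u v x
    assume *: "Z \<in> MCM R" "Y \<in> MCM R" "u \<in> carrier (stable_hom R Z Y)"
      "v \<in> carrier (stable_hom R Z Y)" "x \<in> carrier (ob F' Y)"
    have "ar F Z Y (u \<otimes>\<^bsub>stable_hom R Z Y\<^esub> v) y = ar F Z Y u y \<otimes>\<^bsub>ob F Z\<^esub> ar F Z Y v y"
      if "y \<in> carrier (ob F Y)" for y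
      using F * that unfolding additive_functor_def by blast
    then show "ar F' Z Y (u \<otimes>\<^bsub>stable_hom R Z Y\<^esub> v) x
        = ar F' Z Y u x \<otimes>\<^bsub>ob F' Z\<^esub> ar F' Z Y v x"
      using * by auto
  qed
  have nt: "nat_trans R F F' i"
    unfolding nat_trans_def using ii by auto
  have th: "t Z \<in> hom (stable_hom R Z M) (ob F Z)" if "Z \<in> MCM R" for Z
    using t that unfolding nat_trans_def representable_def by auto
  have tc: "t Z v \<in> carrier (ob F Z)" if "Z \<in> MCM R" "v \<in> carrier (stable_hom R Z M)" for Z v
    using sur that by blast
  define t' where "t' Z v = i Z (t Z v)" for Z v
  have nt': "nat_trans R (representable R M) F' t'"
    unfolding nat_trans_def
  proof (intro conjI ballI)
    show "t' Z \<in> hom (ob (representable R M) Z) (ob F' Z)" if "Z \<in> MCM R" for Z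
      using hom_compose[OF th ii, OF that that]
      by (simp add: t'_def[abs_def] representable_def comp_def)
    show "t' Z (ar (representable R M) Z Y u x) = ar F' Z Y u (t' Y x)"
      if "Z \<in> MCM R" "Y \<in> MCM R" "u \<in> carrier (stable_hom R Z Y)"
        "x \<in> carrier (ob (representable R M) Y)" for Z Y u x
    proof -
      have "t Z (ar (representable R M) Z Y u x) = ar F Z Y u (t Y x)"
        using t that unfolding nat_trans_def by blast
      moreover have "t Y x \<in> carrier (ob F Y)"
        using tc that by (simp add: representable_def)
      ultimately show ?thesis using that by (simp add: t'_def)
    qed
  qed
  have ex: "kernel (stable_hom R Z M) (ob F' Z) (t' Z) = s Z ` carrier (stable_hom R Z N) \<and>
           t' Z ` carrier (stable_hom R Z M) = carrier (ob F' Z)" if Z: "Z \<in> MCM R" for Z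
  proof -
    interpret comm_group "ob F Z" by (rule cg[OF Z])
    have "kernel (stable_hom R Z M) (ob F' Z) (t' Z) = kernel (stable_hom R Z M) (ob F Z) (t Z)"
      using tc[OF Z] inj[OF Z] by (auto simp: kernel_def t'_def inj_on_eq_iff)
    then show ?thesis
      using ker[OF Z] sur[OF Z] by (auto simp: t'_def image_image[symmetric])
  qed
  have "F' \<in> mod_MCM R"
    unfolding mod_MCM_def finitely_presented_def using add' MN s nt' ex by blast
  then show ?thesis
    using nt inj by (intro bexI[of _ F'] exI[of _ i]) (auto simp: bij_betw_def)
qed

end

theory Submission
  imports Defs
begin

text \<open>A finitely presented functor is the cokernel of \<open>Hom(-, N) \<rightarrow> Hom(-, L)\<close> for some
  \<open>p : N \<rightarrow> L\<close> (Yoneda), so it vanishes at \<open>Z\<close> iff every \<open>Z \<rightarrow> L\<close> factors through \<open>p\<close> up to maps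
  through free modules. All axioms are formal consequences of the Galois connection between \<open>\<Sigma>\<close>
  and \<open>\<gamma>\<close> except two.

  \<open>c(\<emptyset>) = \<emptyset>\<close>: the functor represented by \<open>M\<close> vanishes at \<open>M\<close> only if \<open>id\<^sub>M\<close> factors through a free
  module, and then an indecomposable \<open>M\<close> is isomorphic to \<open>R\<close>.

  \<open>c(A \<union> B) \<subseteq> c(A) \<union> c(B)\<close>: let \<open>F \<in> \<Sigma>(A)\<close> and \<open>G \<in> \<Sigma>(B)\<close> be nonzero at \<open>M\<close>, with nonzero elements
  \<open>u \<in> F(M)\<close> and \<open>u' \<in> G(M)\<close>. The images of \<open>u, u' : Hom(-, M) \<rightarrow> F, G\<close> are cokernels of maps
  \<open>P \<rightarrow> M\<close> and \<open>P' \<rightarrow> M\<close>, where \<open>P\<close> and \<open>P'\<close> are pullbacks; these are again maximal Cohen--Macaulay,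
  because \<open>R\<close> is and because kernels of surjections are. The cokernel of \<open>P \<oplus> P' \<rightarrow> M\<close> is a quotient of
  both images, so it vanishes on \<open>A \<union> B\<close>. It does not vanish at \<open>M\<close>: otherwise \<open>id\<^sub>M\<close> would be a sum of
  elements of two proper right ideals of \<open>End(M)\<close>, which is local because \<open>R\<close> is complete.\<close>

section \<open>Submodules and chain conditions\<close>

text \<open>Quotients such as M/m^j M are never formed: chain conditions are stated for intervals of
  submodules of one module. \<open>M\<close> itself has no descending chain condition in general, so
  Fitting's lemma is available only modulo m^j M, with an exponent depending on j. The
  decompositions are therefore glued by completeness, and Krull's intersection theorem makes the
  glued sum direct.

  The choice of resolution inside \<open>Ext\<close> depends on \<open>R\<close> and
  \<open>K\<close> only, so all modules are tested on the same complex and independence of the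
  resolution is never an issue. The long exact sequence is needed at a single place, for kernels of
  surjections.

  Functors are replaced by Hom sets: \<open>factor_maps R N L p Z\<close> collects the maps from Z
  to L that die in the cokernel of \<open>p\<close>, and vanishing at Z says that it is all of
  Hom(Z, L). From then on only modules and maps occur.

  The types shape the last part. A pullback lives over a product type, outside
  \<open>'a rmod\<close>; its depth is therefore measured by a condition polymorphic in the carrier,
  and only the sum of the two pullbacks is moved back to \<open>'a rmod\<close>.\<close>

definition stationary :: "(nat \<Rightarrow> 'b) \<Rightarrow> bool" where
  "stationary C \<longleftrightarrow> (\<exists>n. \<forall>k\<ge>n. C k = C n)"

context module
begin

lemma mem_sum_iff: "x \<in> A <+>\<^bsub>M\<^esub> B \<longleftrightarrow> (\<exists>a\<in>A. \<exists>b\<in>B. x = a \<oplus>\<^bsub>M\<^esub> b)"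
  by (auto simp: set_add_def')

lemma submodule_mem: "submodule H R M \<Longrightarrow> x \<in> H \<Longrightarrow> x \<in> carrier M"
  using submoduleE(1) by blast

lemma submodule_zero_mem: "submodule H R M \<Longrightarrow> \<zero>\<^bsub>M\<^esub> \<in> H"
  using subgroup.one_closed[OF submodule.axioms(1)] by force

lemma submodule_minus_mem: "submodule H R M \<Longrightarrow> a \<in> H \<Longrightarrow> b \<in> H \<Longrightarrow> a \<ominus>\<^bsub>M\<^esub> b \<in> H"
  by (simp add: a_minus_def submoduleE)

lemma submodule_add_cancel:
  assumes H: "submodule H R M" and "x \<in> carrier M" "h \<in> H" "x \<oplus>\<^bsub>M\<^esub> h \<in> H"
  shows "x \<in> H"
proof -
  have "(x \<oplus>\<^bsub>M\<^esub> h) \<ominus>\<^bsub>M\<^esub> h = x"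
    using assms submodule_mem[OF H] by (simp add: a_minus_def M.a_assoc M.r_neg)
  then show ?thesis using submodule_minus_mem[OF H assms(4,3)] by simp
qed

lemma submodule_sum:
  assumes A: "submodule A R M" and B: "submodule B R M"
  shows "submodule (A <+>\<^bsub>M\<^esub> B) R M"
proof (rule submoduleI)
  note [simp] = submodule_mem[OF A] submodule_mem[OF B]
  show "A <+>\<^bsub>M\<^esub> B \<subseteq> carrier M" by (auto simp: mem_sum_iff)
  show "\<zero>\<^bsub>M\<^esub> \<in> A <+>\<^bsub>M\<^esub> B"
    using submodule_zero_mem[OF A] submodule_zero_mem[OF B] by (force simp: mem_sum_iff)
  show "\<ominus>\<^bsub>M\<^esub> x \<in> A <+>\<^bsub>M\<^esub> B" if "x \<in> A <+>\<^bsub>M\<^esub> B" for x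
    using that submoduleE(3)[OF A] submoduleE(3)[OF B] by (fastforce simp: mem_sum_iff M.minus_add)
  show "x \<oplus>\<^bsub>M\<^esub> y \<in> A <+>\<^bsub>M\<^esub> B" if "x \<in> A <+>\<^bsub>M\<^esub> B" "y \<in> A <+>\<^bsub>M\<^esub> B" for x y
  proof -
    obtain a b c d where *: "a \<in> A" "b \<in> B" "c \<in> A" "d \<in> B" "x = a \<oplus>\<^bsub>M\<^esub> b" "y = c \<oplus>\<^bsub>M\<^esub> d"
      using \<open>x \<in> _\<close> \<open>y \<in> _\<close> unfolding mem_sum_iff by blast
    then have "x \<oplus>\<^bsub>M\<^esub> y = (a \<oplus>\<^bsub>M\<^esub> c) \<oplus>\<^bsub>M\<^esub> (b \<oplus>\<^bsub>M\<^esub> d)" by (simp add: M.a_ac)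
    then show ?thesis using * submoduleE(5)[OF A] submoduleE(5)[OF B] by (metis mem_sum_iff)
  qed
  show "a \<odot>\<^bsub>M\<^esub> x \<in> A <+>\<^bsub>M\<^esub> B" if "a \<in> carrier R" "x \<in> A <+>\<^bsub>M\<^esub> B" for a x
    using that submoduleE(4)[OF A] submoduleE(4)[OF B] by (fastforce simp: mem_sum_iff smult_r_distr)
qed

lemma sum_upper1: "submodule A R M \<Longrightarrow> submodule B R M \<Longrightarrow> A \<subseteq> A <+>\<^bsub>M\<^esub> B"
  using submodule_zero_mem[of B] submodule_mem[of A] by (force simp: mem_sum_iff)

lemma sum_upper2: "submodule A R M \<Longrightarrow> submodule B R M \<Longrightarrow> B \<subseteq> A <+>\<^bsub>M\<^esub> B"
  using submodule_zero_mem[of A] submodule_mem[of B] by (force simp: mem_sum_iff)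

lemma sum_least: "submodule C R M \<Longrightarrow> A \<subseteq> C \<Longrightarrow> B \<subseteq> C \<Longrightarrow> A <+>\<^bsub>M\<^esub> B \<subseteq> C"
  using submoduleE(5)[of C] by (fastforce simp: mem_sum_iff)

lemma sum_mono1: "A \<subseteq> B \<Longrightarrow> A <+>\<^bsub>M\<^esub> Y \<subseteq> B <+>\<^bsub>M\<^esub> Y"
  by (auto simp: mem_sum_iff subset_iff)

lemma submodule_Int: "submodule A R M \<Longrightarrow> submodule B R M \<Longrightarrow> submodule (A \<inter> B) R M"
  by (rule submoduleI) (auto simp: submoduleE submodule_zero_mem dest: submodule_mem)

lemma submodule_INT:
  assumes "\<And>i. submodule (A i) R M"
  shows "submodule (\<Inter>i. A i) R M"
  by (rule submoduleI)
     (use assms submoduleE(3-5)[OF assms] in \<open>auto simp: submodule_zero_mem intro: submodule_mem[OF assms]\<close>)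

lemma submodule_incseq_UN:
  fixes A :: "nat \<Rightarrow> _"
  assumes A: "\<And>i. submodule (A i) R M" and "incseq A"
  shows "submodule (\<Union>i. A i) R M"
proof (rule submoduleI)
  show "a \<oplus>\<^bsub>M\<^esub> b \<in> (\<Union>i. A i)" if "a \<in> (\<Union>i. A i)" "b \<in> (\<Union>i. A i)" for a b
  proof -
    obtain i j where "a \<in> A i" "b \<in> A j" using \<open>a \<in> _\<close> \<open>b \<in> _\<close> by blast
    then have "a \<in> A (max i j)" "b \<in> A (max i j)"
      using incseqD[OF \<open>incseq A\<close>, of _ "max i j"] by (meson in_mono max.cobounded1 max.cobounded2)+
    then show ?thesis using submoduleE(5)[OF A] by blast
  qed
  show "a \<odot>\<^bsub>M\<^esub> x \<in> (\<Union>i. A i)" if "a \<in> carrier R" "x \<in> (\<Union>i. A i)" for a x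
    using that submoduleE(4)[OF A] by blast
qed (use A submoduleE(3)[OF A] submodule_zero_mem[OF A] in \<open>auto intro: submodule_mem\<close>)

lemma submodule_zero: "submodule {\<zero>\<^bsub>M\<^esub>} R M"
  by (rule submoduleI) auto

lemma submodule_cyclic:
  assumes s: "s \<in> carrier M"
  shows "submodule ((\<lambda>r. r \<odot>\<^bsub>M\<^esub> s) ` carrier R) R M"
proof (rule submoduleI)
  show "\<zero>\<^bsub>M\<^esub> \<in> (\<lambda>r. r \<odot>\<^bsub>M\<^esub> s) ` carrier R" using s by (force intro!: image_eqI[of _ _ \<zero>])
  show "\<ominus>\<^bsub>M\<^esub> x \<in> (\<lambda>r. r \<odot>\<^bsub>M\<^esub> s) ` carrier R" if "x \<in> (\<lambda>r. r \<odot>\<^bsub>M\<^esub> s) ` carrier R" for x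
    using that s by (auto simp: smult_l_minus[symmetric])
  show "x \<oplus>\<^bsub>M\<^esub> y \<in> (\<lambda>r. r \<odot>\<^bsub>M\<^esub> s) ` carrier R"
    if "x \<in> (\<lambda>r. r \<odot>\<^bsub>M\<^esub> s) ` carrier R" "y \<in> (\<lambda>r. r \<odot>\<^bsub>M\<^esub> s) ` carrier R" for x y
    using that s by (auto simp: smult_l_distr[symmetric])
  show "a \<odot>\<^bsub>M\<^esub> x \<in> (\<lambda>r. r \<odot>\<^bsub>M\<^esub> s) ` carrier R"
    if "a \<in> carrier R" "x \<in> (\<lambda>r. r \<odot>\<^bsub>M\<^esub> s) ` carrier R" for a x
    using that s by (auto simp: smult_assoc1[symmetric])
qed (use s in auto)

lemma self_mem_cyclic: "s \<in> carrier M \<Longrightarrow> s \<in> (\<lambda>r. r \<odot>\<^bsub>M\<^esub> s) ` carrier R"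
  by (force intro: image_eqI[of _ _ \<one>])

text \<open>Writing b = a + y puts y = b - a into \<open>B\<close>, hence into \<open>A\<close>
  through the common intersection. This form of the modular law lets a chain be controlled by its
  traces on \<open>Y\<close> and its sums with \<open>Y\<close>.\<close>

lemma modular_eq:
  assumes A: "submodule A R M" and B: "submodule B R M" and Y: "submodule Y R M"
    and "A \<subseteq> B" "A \<inter> Y = B \<inter> Y" "A <+>\<^bsub>M\<^esub> Y = B <+>\<^bsub>M\<^esub> Y"
  shows "A = B"
proof
  show "B \<subseteq> A"
  proof
    fix b assume b: "b \<in> B"
    then have "b \<in> A <+>\<^bsub>M\<^esub> Y" using sum_upper1[OF B Y] assms(6) by blast
    then obtain a y where ay: "a \<in> A" "y \<in> Y" "b = a \<oplus>\<^bsub>M\<^esub> y" by (auto simp: mem_sum_iff)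
    have "y \<oplus>\<^bsub>M\<^esub> a \<in> B"
      using ay b submodule_mem[OF A] submodule_mem[OF Y] by (simp add: M.a_comm)
    then have "y \<in> B"
      using submodule_add_cancel[OF B _ _] ay \<open>A \<subseteq> B\<close> submodule_mem[OF Y] by blast
    then show "b \<in> A" using ay assms(5) submoduleE(5)[OF A] by blast
  qed
qed fact

text \<open>The chain condition for the quotient of \<open>Y\<close> by \<open>U\<close>, read
  inside the lattice of submodules of \<open>M\<close>. The relation \<open>r\<close> will be
  inclusion or its converse, so that ascending and descending conditions share their extension
  lemmas.\<close>

definition stationary_between :: "('c set \<Rightarrow> 'c set \<Rightarrow> bool) \<Rightarrow> 'c set \<Rightarrow> 'c set \<Rightarrow> bool" where
  "stationary_between r U Y \<longleftrightarrow> (\<forall>C :: nat \<Rightarrow> 'c set.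
     (\<forall>n. submodule (C n) R M \<and> U \<subseteq> C n \<and> C n \<subseteq> Y \<and> r (C n) (C (Suc n))) \<longrightarrow> stationary C)"

end

lemma chain_comparable:
  fixes C :: "nat \<Rightarrow> 'c set"
  assumes "r = (\<subseteq>) \<or> r = (\<supseteq>)" "\<And>n. r (C n) (C (Suc n))" "n \<le> k"
  shows "r (C n) (C k)"
  using assms(3)
proof (induction rule: dec_induct)
  case (step k)
  then show ?case using assms(1) assms(2)[of k] by auto
qed (use assms(1) in auto)


text \<open>Finite generation of ideals enters through \<open>ideal_chain_is_trivial\<close>: the
  union of a nonempty chain of ideals is a member of the chain.\<close>

lemma ideal_incseq_stationary:
  fixes J :: "nat \<Rightarrow> 'a set"
  assumes R: "noetherian_ring R" and J: "\<And>n. ideal (J n) R" and "incseq J"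
  shows "stationary J"
proof -
  interpret noetherian_ring R by fact
  have total: "J a \<subseteq> J b \<or> J b \<subseteq> J a" for a b
    using incseqD[OF \<open>incseq J\<close>] by (cases "a \<le> b") auto
  have "subset.chain {I. ideal I R} (range J)"
    using J total unfolding subset.chain_def by blast
  then have "\<Union>(range J) \<in> range J" by (intro ideal_chain_is_trivial) auto
  then obtain n where n: "\<Union>(range J) = J n" by blast
  have "J k = J n" if "k \<ge> n" for k
    using n incseqD[OF \<open>incseq J\<close> that] by blast
  then show ?thesis unfolding stationary_def by blast
qed

context module
begin

lemma stationary_modular:
  assumes r: "r = (\<subseteq>) \<or> r = (\<supseteq>)" "\<And>n. r (C n) (C (Suc n))"
    and C: "\<And>n. submodule (C n) R M" and Y: "submodule Y R M"
    and i: "stationary (\<lambda>n. C n \<inter> Y)" and s: "stationary (\<lambda>n. C n <+>\<^bsub>M\<^esub> Y)"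
  shows "stationary C"
proof -
  obtain a b where a: "\<And>k. k \<ge> a \<Longrightarrow> C k \<inter> Y = C a \<inter> Y"
    and b: "\<And>k. k \<ge> b \<Longrightarrow> C k <+>\<^bsub>M\<^esub> Y = C b <+>\<^bsub>M\<^esub> Y"
    using i s unfolding stationary_def by blast
  let ?n = "max a b"
  have "C k = C ?n" if k: "k \<ge> ?n" for k
  proof -
    have e: "C k \<inter> Y = C ?n \<inter> Y" "C k <+>\<^bsub>M\<^esub> Y = C ?n <+>\<^bsub>M\<^esub> Y"
      using k a[of k] a[of ?n] b[of k] b[of ?n] by auto
    have "C k \<subseteq> C ?n \<or> C ?n \<subseteq> C k" using chain_comparable[of r C, OF r k] r(1) by auto
    then show ?thesis using modular_eq[OF C C Y] e by metis
  qed
  then show ?thesis unfolding stationary_def by blast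
qed

text \<open>The extension argument for 0 -> Y/U -> Z/U -> Z/Y -> 0: the traces of a chain on
  \<open>Y\<close> live in the lower interval, its sums with \<open>Y\<close> in the upper one, and
  the modular law recombines them.\<close>

lemma stationary_between_trans:
  assumes r: "r = (\<subseteq>) \<or> r = (\<supseteq>)"
    and XY: "U \<subseteq> Y" and YZ: "Y \<subseteq> Z" and Y: "submodule Y R M" and Z: "submodule Z R M"
    and 1: "stationary_between r U Y" and 2: "stationary_between r Y Z"
  shows "stationary_between r U Z"
  unfolding stationary_between_def
proof (intro allI impI)
  fix C :: "nat \<Rightarrow> _"
  assume C: "\<forall>n. submodule (C n) R M \<and> U \<subseteq> C n \<and> C n \<subseteq> Z \<and> r (C n) (C (Suc n))"
  have "stationary (\<lambda>n. C n \<inter> Y)"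
    using 1[unfolded stationary_between_def, THEN spec[of _ "\<lambda>n. C n \<inter> Y"], THEN mp]
      C r XY Y submodule_Int by auto
  moreover have "stationary (\<lambda>n. C n <+>\<^bsub>M\<^esub> Y)"
  proof (rule 2[unfolded stationary_between_def, THEN spec[of _ "\<lambda>n. C n <+>\<^bsub>M\<^esub> Y"], THEN mp],
      intro allI conjI)
    show "r (C n <+>\<^bsub>M\<^esub> Y) (C (Suc n) <+>\<^bsub>M\<^esub> Y)" for n
      using C r sum_mono1[of "C n" "C (Suc n)" Y] sum_mono1[of "C (Suc n)" "C n" Y] by auto
    show "submodule (C n <+>\<^bsub>M\<^esub> Y) R M" for n using C Y by (blast intro: submodule_sum)
    show "Y \<subseteq> C n <+>\<^bsub>M\<^esub> Y" for n using sum_upper2[OF _ Y] C by blast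
    show "C n <+>\<^bsub>M\<^esub> Y \<subseteq> Z" for n using sum_least[OF Z _ YZ] C by blast
  qed
  ultimately show "stationary C"
    using stationary_modular[OF r _ _ Y] C by blast
qed

text \<open>Each generator adds one cyclic layer on top, and the layers are glued by
  \<open>stationary_between_trans\<close>. The top \<open>Y\<close> stays anonymous; containing
  \<open>S\<close> is all that is asked of it.\<close>

lemma stationary_between_generators:
  assumes r: "r = (\<subseteq>) \<or> r = (\<supseteq>)" and S: "finite S" "S \<subseteq> carrier M" and U: "submodule U R M"
    and step: "\<And>Z s. submodule Z R M \<Longrightarrow> U \<subseteq> Z \<Longrightarrow> s \<in> S \<Longrightarrow>
       stationary_between r Z (Z <+>\<^bsub>M\<^esub> (\<lambda>r. r \<odot>\<^bsub>M\<^esub> s) ` carrier R)"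
  shows "\<exists>Y. submodule Y R M \<and> U \<subseteq> Y \<and> S \<subseteq> Y \<and> stationary_between r U Y"
  using S step
proof (induction S rule: finite_induct)
  case empty
  have "stationary_between r U U"
    unfolding stationary_between_def stationary_def by blast
  then show ?case using U by blast
next
  case (insert s S)
  then obtain Y where Y: "submodule Y R M" "U \<subseteq> Y" "S \<subseteq> Y" "stationary_between r U Y" by auto
  let ?c = "(\<lambda>r. r \<odot>\<^bsub>M\<^esub> s) ` carrier R"
  let ?Z = "Y <+>\<^bsub>M\<^esub> ?c"
  have c: "submodule ?c R M" and s: "s \<in> ?c"
    using insert.prems submodule_cyclic self_mem_cyclic by auto
  note Z = submodule_sum[OF Y(1) c] and up = sum_upper1[OF Y(1) c] sum_upper2[OF Y(1) c]
  have "stationary_between r U ?Z"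
    using stationary_between_trans[OF r Y(2) up(1) Y(1) Z Y(4)] insert.prems Y by auto
  then show ?case using Z up Y s by (intro exI[of _ ?Z]) auto
qed

text \<open>The colon ideal (H : z). It transfers chains of submodules to chains of ideals, and it
  reduces a condition on all of the maximal ideal to its generators.\<close>

lemma submodule_scalars_ideal:
  assumes H: "submodule H R M" and z: "z \<in> carrier M"
  shows "ideal {a \<in> carrier R. a \<odot>\<^bsub>M\<^esub> z \<in> H} R"
proof (rule idealI[OF R.ring_axioms])
  note E = submoduleE[OF H]
  show "subgroup {a \<in> carrier R. a \<odot>\<^bsub>M\<^esub> z \<in> H} (add_monoid R)"
    by (rule R.add.subgroupI)
       (use z E submodule_zero_mem[OF H] smult_l_minus[of _ z] in
         \<open>auto simp: smult_l_distr a_inv_def[symmetric] intro: exI[of _ \<zero>]\<close>)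
  show *: "x \<otimes> a \<in> {a \<in> carrier R. a \<odot>\<^bsub>M\<^esub> z \<in> H}"
    if "a \<in> {a \<in> carrier R. a \<odot>\<^bsub>M\<^esub> z \<in> H}" "x \<in> carrier R" for a x
    using that z E by (auto simp: smult_assoc1)
  show "a \<otimes> x \<in> {a \<in> carrier R. a \<odot>\<^bsub>M\<^esub> z \<in> H}"
    if "a \<in> {a \<in> carrier R. a \<odot>\<^bsub>M\<^esub> z \<in> H}" "x \<in> carrier R" for a x
    using *[OF that] that by (simp add: R.m_comm)
qed

text \<open>The layer (U + R s)/U is a quotient of \<open>R\<close>, so each \<open>C n\<close> is
  determined by the ideal of scalars carrying \<open>s\<close> into it.\<close>

lemma acc_cyclic:
  assumes R: "noetherian_ring R" and U: "submodule U R M" and s: "s \<in> carrier M"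
  shows "stationary_between (\<subseteq>) U (U <+>\<^bsub>M\<^esub> (\<lambda>r. r \<odot>\<^bsub>M\<^esub> s) ` carrier R)"
  unfolding stationary_between_def
proof (intro allI impI)
  fix C :: "nat \<Rightarrow> _"
  assume "\<forall>n. submodule (C n) R M \<and> U \<subseteq> C n \<and> C n \<subseteq> U <+>\<^bsub>M\<^esub> (\<lambda>r. r \<odot>\<^bsub>M\<^esub> s) ` carrier R \<and>
    C n \<subseteq> C (Suc n)"
  then have C: "submodule (C n) R M" "U \<subseteq> C n"
    "C n \<subseteq> U <+>\<^bsub>M\<^esub> (\<lambda>r. r \<odot>\<^bsub>M\<^esub> s) ` carrier R" "C n \<subseteq> C (Suc n)" for n by blast+
  have inc: "incseq C" using C(4) by (rule incseq_SucI)
  define J where "J n = {r \<in> carrier R. r \<odot>\<^bsub>M\<^esub> s \<in> C n}" for n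
  have "ideal (J n) R" for n
    unfolding J_def by (rule submodule_scalars_ideal[OF C(1) s])
  moreover have "incseq J" using inc unfolding incseq_def J_def by blast
  ultimately obtain n where n: "\<And>k. k \<ge> n \<Longrightarrow> J k = J n"
    using ideal_incseq_stationary[OF R] unfolding stationary_def by blast
  have "C k \<subseteq> C n" if "k \<ge> n" for k
  proof
    fix z assume z: "z \<in> C k"
    then have "z \<in> U <+>\<^bsub>M\<^esub> (\<lambda>r. r \<odot>\<^bsub>M\<^esub> s) ` carrier R" using C(3)[of k] by blast
    then obtain x t where x: "x \<in> U" "t \<in> carrier R" "z = x \<oplus>\<^bsub>M\<^esub> t \<odot>\<^bsub>M\<^esub> s"
      unfolding mem_sum_iff by blast
    have "t \<odot>\<^bsub>M\<^esub> s \<oplus>\<^bsub>M\<^esub> x \<in> C k"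
      using x z s submodule_mem[OF U] by (simp add: M.a_comm)
    then have "t \<odot>\<^bsub>M\<^esub> s \<in> C k"
      using submodule_add_cancel[OF C(1)[of k] _ _] x s C(2)[of k] by blast
    then have "t \<in> J n" using n[OF that] x by (auto simp: J_def)
    then show "z \<in> C n" using x C(2)[of n] submoduleE(5)[OF C(1)[of n]] by (auto simp: J_def)
  qed
  moreover have "C n \<subseteq> C k" if "k \<ge> n" for k using inc that by (simp add: incseqD)
  ultimately show "stationary C" unfolding stationary_def by blast
qed

end

locale noetherian_module = module R M + noetherian_ring R
  for R :: "'a ring" (structure) and M :: "('a, 'm) module" (structure) +
  assumes fin_gen: "fin_gen R M"
begin

lemma fin_gen_acc: "stationary_between (\<subseteq>) {\<zero>\<^bsub>M\<^esub>} (carrier M)"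
proof -
  obtain S where S: "finite S" "S \<subseteq> carrier M"
    and gen: "\<And>H. submodule H R M \<Longrightarrow> S \<subseteq> H \<Longrightarrow> H = carrier M"
    using fin_gen unfolding fin_gen_def by blast
  have "\<exists>Y. submodule Y R M \<and> {\<zero>\<^bsub>M\<^esub>} \<subseteq> Y \<and> S \<subseteq> Y \<and> stationary_between (\<subseteq>) {\<zero>\<^bsub>M\<^esub>} Y"
    by (rule stationary_between_generators[OF _ S submodule_zero])
       (use acc_cyclic[OF noetherian_ring_axioms] S in auto)
  then show ?thesis using gen by metis
qed

text \<open>Without a maximal element, choosing a strictly larger submodule again and again would
  contradict the ascending chain condition. The arbitrary predicate \<open>P\<close> makes this the
  common source of generators, of Nakayama's lemma and of Krull's theorem.\<close>

lemma exists_maximal_submodule: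
  assumes H: "submodule H R M" "P H"
  shows "\<exists>K. submodule K R M \<and> P K \<and> (\<forall>L. submodule L R M \<longrightarrow> P L \<longrightarrow> K \<subseteq> L \<longrightarrow> L = K)"
proof (rule ccontr)
  assume neg: "\<not> ?thesis"
  define n where "n K = (SOME L. submodule L R M \<and> P L \<and> K \<subset> L)" for K
  have n: "submodule (n K) R M \<and> P (n K) \<and> K \<subset> n K" if "submodule K R M \<and> P K" for K
    unfolding n_def
  proof (rule someI_ex, rule ccontr)
    assume "\<not> (\<exists>L. submodule L R M \<and> P L \<and> K \<subset> L)"
    then have "\<forall>L. submodule L R M \<longrightarrow> P L \<longrightarrow> K \<subseteq> L \<longrightarrow> L = K"
      unfolding psubset_eq by blast
    with that neg show False by blast
  qed
  define C where "C i = (n ^^ i) H" for i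
  have C: "submodule (C i) R M \<and> P (C i)" for i
  proof (induction i)
    case (Suc i)
    then show ?case using n[of "C i"] by (simp add: C_def)
  qed (simp add: C_def H)
  have s: "C i \<subset> C (Suc i)" for i using n[OF C[of i]] by (simp add: C_def)
  have "stationary C"
  proof (rule fin_gen_acc[unfolded stationary_between_def, THEN spec[of _ C], THEN mp],
      intro allI conjI)
    fix i
    show "submodule (C i) R M" using C by blast
    then show "{\<zero>\<^bsub>M\<^esub>} \<subseteq> C i" "C i \<subseteq> carrier M"
      using submodule_zero_mem[of "C i"] submodule_mem[of "C i"] by auto
    show "C i \<subseteq> C (Suc i)" using s by blast
  qed
  then obtain i where "\<forall>k\<ge>i. C k = C i" unfolding stationary_def by blast
  then have "C (Suc i) = C i" by (rule allE[of _ "Suc i"]) simp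
  then show False using s[of i] by simp
qed

text \<open>A maximal one among the finitely generated submodules of \<open>H\<close> absorbs every
  element of \<open>H\<close>, since adjoining one more generator keeps it finitely
  generated.\<close>

lemma submodule_finite_generators:
  assumes H: "submodule H R M"
  shows "\<exists>S. finite S \<and> S \<subseteq> H \<and> (\<forall>K. submodule K R M \<longrightarrow> S \<subseteq> K \<longrightarrow> H \<subseteq> K)"
proof -
  define P where "P K \<longleftrightarrow> (\<exists>S. finite S \<and> S \<subseteq> K \<and> K \<subseteq> H \<and>
    (\<forall>L. submodule L R M \<longrightarrow> S \<subseteq> L \<longrightarrow> K \<subseteq> L))" for K
  have "P {\<zero>\<^bsub>M\<^esub>}"
    unfolding P_def using submodule_zero_mem H by (intro exI[of _ "{}"]) auto
  then obtain K where K: "submodule K R M" "P K"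
    and max: "\<And>L. submodule L R M \<Longrightarrow> P L \<Longrightarrow> K \<subseteq> L \<Longrightarrow> L = K"
    using exists_maximal_submodule[OF submodule_zero, of P] by blast
  obtain S where S: "finite S" "S \<subseteq> K" "K \<subseteq> H"
    and gen: "\<And>L. submodule L R M \<Longrightarrow> S \<subseteq> L \<Longrightarrow> K \<subseteq> L"
    using K(2) unfolding P_def by blast
  have "H \<subseteq> K"
  proof
    fix s assume s: "s \<in> H"
    let ?c = "(\<lambda>r. r \<odot>\<^bsub>M\<^esub> s) ` carrier R"
    have sM: "s \<in> carrier M" using s H submodule_mem by blast
    note c = submodule_cyclic[OF sM]
    note up = sum_upper1[OF K(1) c] sum_upper2[OF K(1) c]
    have "P (K <+>\<^bsub>M\<^esub> ?c)"
      unfolding P_def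
    proof (intro exI[of _ "insert s S"] conjI allI impI)
      show "insert s S \<subseteq> K <+>\<^bsub>M\<^esub> ?c" using up S self_mem_cyclic[OF sM] by blast
      show "K <+>\<^bsub>M\<^esub> ?c \<subseteq> H" using S s submoduleE(4)[OF H] by (intro sum_least[OF H]) auto
      show "K <+>\<^bsub>M\<^esub> ?c \<subseteq> L" if "submodule L R M" "insert s S \<subseteq> L" for L
        using that gen[of L] submoduleE(4)[OF that(1)] by (intro sum_least) auto
    qed (use S in auto)
    then have "K <+>\<^bsub>M\<^esub> ?c = K" using max submodule_sum[OF K(1) c] up by blast
    then show "s \<in> K" using up self_mem_cyclic[OF sM] by blast
  qed
  then show ?thesis using S gen by (intro exI[of _ S]) blast
qed

end

lemma fin_gen_submodule:
  fixes R :: "'a ring" (structure) and M :: "('a, 'm) module"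
  assumes "module R M" "noetherian_ring R" "fin_gen R M" and H: "submodule H R M"
  shows "fin_gen R (M\<lparr>carrier := H\<rparr>)"
proof -
  interpret noetherian_module R M
    using assms by (simp add: noetherian_module_def noetherian_module_axioms_def)
  obtain S where S: "finite S" "S \<subseteq> H" "\<And>K. submodule K R M \<Longrightarrow> S \<subseteq> K \<Longrightarrow> H \<subseteq> K"
    using submodule_finite_generators[OF H] by blast
  interpret N: module R "M\<lparr>carrier := H\<rparr>" by (rule submodule.submodule_is_module[OF H assms(1)])
  have "K = H" if K: "submodule K R (M\<lparr>carrier := H\<rparr>)" "S \<subseteq> K" for K
  proof -
    note E = N.submoduleE[OF K(1), simplified]
    have "submodule K R M"
    proof (rule submoduleI)
      show "K \<subseteq> carrier M" using E(1) submodule_mem[OF H] by blast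
      show "\<zero>\<^bsub>M\<^esub> \<in> K" using N.submodule_zero_mem[OF K(1)] by simp
      show "\<ominus>\<^bsub>M\<^esub> a \<in> K" if "a \<in> K" for a
      proof -
        \<comment> \<open>Additive inverses are defined relative to the carrier, so those of the
          restricted record are not syntactically those of \<open>M\<close>. Multiplication by -1 is
          common to both.\<close>
        have "a \<in> carrier M" using that E(1) submodule_mem[OF H] by blast
        then have "\<ominus>\<^bsub>M\<^esub> a = (\<ominus> \<one>) \<odot>\<^bsub>M\<^esub> a" by (simp add: smult_l_minus)
        then show ?thesis using E(4)[OF _ that, of "\<ominus> \<one>"] by simp
      qed
    qed (use E in auto)
    then show ?thesis using S(3) K(2) E(1) by blast
  qed
  then show ?thesis unfolding fin_gen_def using S by (intro exI[of _ S]) auto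
qed

section \<open>Local rings: Nakayama's lemma and Krull's intersection theorem\<close>

locale local_noetherian = noetherian_ring R for R :: "'a ring" (structure) +
  assumes local_ring: "local_ring R"
begin

sublocale cring R
  using local_ring unfolding local_ring_def by blast

abbreviation mm :: "'a set" where "mm \<equiv> max_ideal R"

lemma maximalideal_max_ideal: "maximalideal mm R"
  using local_ring theI'[of "\<lambda>I. maximalideal I R"] unfolding local_ring_def max_ideal_def by blast

lemma maximalideal_eq_max_ideal: "maximalideal I R \<Longrightarrow> I = mm"
  using local_ring maximalideal_max_ideal unfolding local_ring_def by blast

sublocale max: maximalideal "max_ideal R" R
  by (rule maximalideal_max_ideal)

text \<open>\<open>local_ring\<close> only speaks of a unique maximal ideal. Zorn's lemma puts some
  maximal ideal above \<open>I\<close>, and uniqueness identifies it with \<open>mm\<close>; the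
  chains have upper bounds because a chain of ideals contains its union.\<close>

lemma proper_ideal_le_max_ideal:
  assumes I: "ideal I R" "I \<noteq> carrier R"
  shows "I \<subseteq> mm"
proof -
  let ?A = "{J. ideal J R \<and> I \<subseteq> J \<and> J \<noteq> carrier R}"
  have "\<exists>K\<in>?A. \<forall>L\<in>?A. K \<subseteq> L \<longrightarrow> L = K"
  proof (rule subset_Zorn_nonempty)
    show "?A \<noteq> {}" using I by blast
    show "\<Union>C \<in> ?A" if "C \<noteq> {}" "subset.chain ?A C" for C
    proof -
      have "subset.chain {I. ideal I R} C" "C \<subseteq> ?A" using that(2) unfolding subset.chain_def by blast+
      then show ?thesis using ideal_chain_is_trivial[OF that(1)] by blast
    qed
  qed
  then obtain K where KA: "K \<in> ?A" and mxA: "\<forall>L\<in>?A. K \<subseteq> L \<longrightarrow> L = K" by (rule bexE)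
  have K: "ideal K R" "I \<subseteq> K" "K \<noteq> carrier R" using KA by auto
  have mx: "L = K \<or> L = carrier R" if "ideal L R" "K \<subseteq> L" for L
    using mxA[rule_format, of L] that K(2) by auto
  have "maximalideal K R"
    using K mx by (intro maximalidealI) auto
  then show ?thesis using K maximalideal_eq_max_ideal by blast
qed

lemma Units_iff: "a \<in> Units R \<longleftrightarrow> a \<in> carrier R \<and> a \<notin> mm"
proof (intro iffI conjI notI)
  assume a: "a \<in> carrier R \<and> a \<notin> mm"
  then have "PIdl a = carrier R"
    using proper_ideal_le_max_ideal[OF cgenideal_ideal[of a]] cgenideal_self[of a] by blast
  then have "\<one> \<in> PIdl a" by simp
  then obtain x where "x \<in> carrier R" "\<one> = x \<otimes> a" unfolding cgenideal_def by blast
  then show "a \<in> Units R"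
    using a unfolding Units_def by (auto simp: m_comm intro!: bexI[of _ x])
next
  assume "a \<in> Units R" "a \<in> mm"
  then have "\<one> \<in> mm" using max.I_l_closed[of a "inv a"] Units_l_inv[of a] Units_inv_closed[of a] by metis
  then show False using max.one_imp_carrier max.I_notcarr by simp
qed auto

lemma one_minus_Units: "a \<in> mm \<Longrightarrow> \<one> \<ominus> a \<in> Units R"
proof -
  assume a: "a \<in> mm"
  have "\<one> \<ominus> a \<notin> mm"
  proof
    assume "\<one> \<ominus> a \<in> mm"
    then have "(\<one> \<ominus> a) \<oplus> a \<in> mm" using a by simp
    moreover have "(\<one> \<ominus> a) \<oplus> a = \<one>" using max.Icarr[OF a] by (simp add: a_minus_def a_assoc l_neg)
    ultimately show False using max.one_imp_carrier max.I_notcarr by simp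
  qed
  then show ?thesis using max.Icarr[OF a] by (simp add: Units_iff)
qed

end

locale local_module = noetherian_module R M + local_noetherian R
  for R :: "'a ring" (structure) and M :: "('a, 'm) module" (structure)
begin

lemma unit_smult_mem:
  assumes H: "submodule H R M" and "u \<in> Units R" "x \<in> carrier M" "u \<odot>\<^bsub>M\<^esub> x \<in> H"
  shows "x \<in> H"
proof -
  have "inv u \<odot>\<^bsub>M\<^esub> (u \<odot>\<^bsub>M\<^esub> x) \<in> H" using assms submoduleE(4)[OF H] by simp
  moreover have "inv u \<odot>\<^bsub>M\<^esub> (u \<odot>\<^bsub>M\<^esub> x) = (inv u \<otimes> u) \<odot>\<^bsub>M\<^esub> x"
    by (rule smult_assoc1[symmetric]) (use assms in auto)
  ultimately show ?thesis using assms by (simp add: Units_l_inv)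
qed

text \<open>The submodule m Y. Taking the intersection of all submodules that contain the products
  gives the universal property \<open>msub_least\<close> at once and avoids finite sums.\<close>

definition msub :: "'m set \<Rightarrow> 'm set" where
  "msub Y = \<Inter>{H. submodule H R M \<and> (\<forall>a\<in>mm. \<forall>y\<in>Y. a \<odot>\<^bsub>M\<^esub> y \<in> H)}"

lemma msub_least: "submodule H R M \<Longrightarrow> (\<And>a y. a \<in> mm \<Longrightarrow> y \<in> Y \<Longrightarrow> a \<odot>\<^bsub>M\<^esub> y \<in> H) \<Longrightarrow> msub Y \<subseteq> H"
  unfolding msub_def by blast

lemma smult_mem_msub: "a \<in> mm \<Longrightarrow> y \<in> Y \<Longrightarrow> a \<odot>\<^bsub>M\<^esub> y \<in> msub Y"
  unfolding msub_def by blast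

lemma submodule_msub:
  assumes Y: "Y \<subseteq> carrier M"
  shows "submodule (msub Y) R M"
proof (rule submoduleI)
  have "a \<odot>\<^bsub>M\<^esub> y \<in> carrier M" if "a \<in> mm" "y \<in> Y" for a y
    using Y that max.Icarr by blast
  then show "msub Y \<subseteq> carrier M"
    by (rule msub_least[OF carrier_is_submodule])
qed (auto simp: msub_def submodule_zero_mem submoduleE(3-5))

lemma msub_subset: "submodule Y R M \<Longrightarrow> msub Y \<subseteq> Y"
  by (rule msub_least) (auto simp: submoduleE(4) max.Icarr)

text \<open>Choose \<open>H\<close> maximal among the submodules that contain \<open>U\<close> but
  not \<open>Y\<close>. If some product a y were outside \<open>H\<close>, then H + R a y would
  contain \<open>Y\<close>, so y = h + r a y; as 1 - r a is a unit, \<open>y\<close> would lie in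
  \<open>H\<close> after all. Hence m Y is inside \<open>H\<close>, and then so is \<open>Y\<close>,
  a contradiction.\<close>

theorem nakayama:
  assumes U: "submodule U R M" and Y: "submodule Y R M" and le: "Y \<subseteq> U <+>\<^bsub>M\<^esub> msub Y"
  shows "Y \<subseteq> U"
proof (rule ccontr)
  assume "\<not> Y \<subseteq> U"
  then obtain H where H: "submodule H R M" "U \<subseteq> H \<and> \<not> Y \<subseteq> H"
    and mx: "\<And>L. submodule L R M \<Longrightarrow> U \<subseteq> L \<and> \<not> Y \<subseteq> L \<Longrightarrow> H \<subseteq> L \<Longrightarrow> L = H"
    using exists_maximal_submodule[OF U, of "\<lambda>H. U \<subseteq> H \<and> \<not> Y \<subseteq> H"] by blast
  have "a \<odot>\<^bsub>M\<^esub> y \<in> H" if a: "a \<in> mm" and y: "y \<in> Y" for a y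
  proof (rule ccontr)
    assume n: "a \<odot>\<^bsub>M\<^esub> y \<notin> H"
    have [simp]: "a \<in> carrier R" "y \<in> carrier M" using a y submodule_mem[OF Y] max.Icarr by auto
    let ?c = "(\<lambda>r. r \<odot>\<^bsub>M\<^esub> (a \<odot>\<^bsub>M\<^esub> y)) ` carrier R"
    have c: "submodule ?c R M" "a \<odot>\<^bsub>M\<^esub> y \<in> ?c" by (simp_all add: submodule_cyclic self_mem_cyclic)
    note up = sum_upper1[OF H(1) c(1)] sum_upper2[OF H(1) c(1)]
    have "Y \<subseteq> H <+>\<^bsub>M\<^esub> ?c"
      using mx[OF submodule_sum[OF H(1) c(1)]] H up n c(2) by blast
    then have "y \<in> H <+>\<^bsub>M\<^esub> ?c" using y by blast
    then obtain h r where hr: "h \<in> H" "r \<in> carrier R" "y = h \<oplus>\<^bsub>M\<^esub> r \<odot>\<^bsub>M\<^esub> (a \<odot>\<^bsub>M\<^esub> y)"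
      unfolding mem_sum_iff by blast
    have hM: "h \<in> carrier M" using hr submodule_mem[OF H(1)] by blast
    let ?w = "(r \<otimes> a) \<odot>\<^bsub>M\<^esub> y"
    have "(\<one> \<ominus> r \<otimes> a) \<odot>\<^bsub>M\<^esub> y = y \<ominus>\<^bsub>M\<^esub> ?w"
      using hr by (simp add: a_minus_def smult_l_distr smult_l_minus)
    also have "\<dots> = (h \<oplus>\<^bsub>M\<^esub> ?w) \<ominus>\<^bsub>M\<^esub> ?w"
      using hr(2,3) by (simp add: smult_assoc1)
    also have "\<dots> = h" using hM hr by (simp add: a_minus_def M.a_assoc M.r_neg)
    finally have "(\<one> \<ominus> r \<otimes> a) \<odot>\<^bsub>M\<^esub> y \<in> H" using hr by simp
    moreover have "\<one> \<ominus> r \<otimes> a \<in> Units R" using one_minus_Units max.I_l_closed[OF a hr(2)] by blast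
    ultimately have "y \<in> H" using unit_smult_mem[OF H(1)] by simp
    then show False using n submoduleE(4)[OF H(1)] by simp
  qed
  then have "msub Y \<subseteq> H" by (rule msub_least[OF H(1)])
  then have "U <+>\<^bsub>M\<^esub> msub Y \<subseteq> H" using sum_least[OF H(1)] H(2) by blast
  then show False using le H(2) by blast
qed

text \<open>The layer (U + R s)/U is killed by the maximal ideal, so it is zero or simple: a
  submodule in between that exceeds \<open>U\<close> contains a unit multiple of \<open>s\<close>
  and is everything.\<close>

lemma dcc_cyclic:
  assumes U: "submodule U R M" and s: "s \<in> carrier M" "\<And>a. a \<in> mm \<Longrightarrow> a \<odot>\<^bsub>M\<^esub> s \<in> U"
  shows "stationary_between (\<supseteq>) U (U <+>\<^bsub>M\<^esub> (\<lambda>r. r \<odot>\<^bsub>M\<^esub> s) ` carrier R)"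
  unfolding stationary_between_def
proof (intro allI impI)
  let ?V = "U <+>\<^bsub>M\<^esub> (\<lambda>r. r \<odot>\<^bsub>M\<^esub> s) ` carrier R"
  fix C :: "nat \<Rightarrow> _"
  assume "\<forall>n. submodule (C n) R M \<and> U \<subseteq> C n \<and> C n \<subseteq> ?V \<and> C (Suc n) \<subseteq> C n"
  then have C: "submodule (C n) R M" "U \<subseteq> C n" "C n \<subseteq> ?V" "C (Suc n) \<subseteq> C n" for n by blast+
  have dec: "decseq C" using C(4) by (rule decseq_SucI)
  have full: "C n = ?V" if n: "C n \<noteq> U" for n
  proof -
    obtain z where z: "z \<in> C n" "z \<notin> U" using n C(2) by blast
    then have "z \<in> ?V" using C(3) by blast
    then obtain x t where x: "x \<in> U" "t \<in> carrier R" "z = x \<oplus>\<^bsub>M\<^esub> t \<odot>\<^bsub>M\<^esub> s"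
      unfolding mem_sum_iff by blast
    have "t \<odot>\<^bsub>M\<^esub> s \<oplus>\<^bsub>M\<^esub> x \<in> C n"
      using x z s submodule_mem[OF U] by (simp add: M.a_comm)
    then have ts: "t \<odot>\<^bsub>M\<^esub> s \<in> C n"
      using submodule_add_cancel[OF C(1)[of n] _ _] x s C(2)[of n] by blast
    have "t \<notin> mm" using z x s(2) submoduleE(5)[OF U] by blast
    then have "s \<in> C n" using unit_smult_mem[OF C(1) _ s(1) ts] x by (simp add: Units_iff)
    then have "(\<lambda>r. r \<odot>\<^bsub>M\<^esub> s) ` carrier R \<subseteq> C n" using submoduleE(4)[OF C(1)] by blast
    then show ?thesis using C(3)[of n] sum_least[OF C(1) C(2)] by blast
  qed
  show "stationary C"
  proof (cases "\<exists>n. C n = U")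
    case True
    then obtain n where "C n = U" by blast
    then have "C k = C n" if "k \<ge> n" for k using decseqD[OF dec that] C(2)[of k] by blast
    then show ?thesis unfolding stationary_def by blast
  next
    case False
    then have "C k = C 0" for k using full by metis
    then show ?thesis unfolding stationary_def by blast
  qed
qed

text \<open>Y/mY is a finite-dimensional vector space over the residue field; adjoining the finitely
  many generators of \<open>Y\<close> gives it one simple or zero layer at a time.\<close>

lemma dcc_msub:
  assumes Y: "submodule Y R M"
  shows "stationary_between (\<supseteq>) (msub Y) Y"
proof -
  have sub: "submodule (msub Y) R M" using submodule_msub submodule_mem[OF Y] by blast
  obtain S where S: "finite S" "S \<subseteq> Y" "\<And>K. submodule K R M \<Longrightarrow> S \<subseteq> K \<Longrightarrow> Y \<subseteq> K"
    using submodule_finite_generators[OF Y] by blast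
  have "\<exists>Z. submodule Z R M \<and> msub Y \<subseteq> Z \<and> S \<subseteq> Z \<and> stationary_between (\<supseteq>) (msub Y) Z"
  proof (rule stationary_between_generators[OF _ S(1) _ sub])
    show "S \<subseteq> carrier M" using S submodule_mem[OF Y] by blast
    show "stationary_between (\<supseteq>) Z (Z <+>\<^bsub>M\<^esub> (\<lambda>r. r \<odot>\<^bsub>M\<^esub> s) ` carrier R)"
      if Z: "submodule Z R M" "msub Y \<subseteq> Z" "s \<in> S" for Z s
    proof (rule dcc_cyclic[OF Z(1)])
      show "s \<in> carrier M" using S Z submodule_mem[OF Y] by blast
      show "a \<odot>\<^bsub>M\<^esub> s \<in> Z" if "a \<in> mm" for a using smult_mem_msub[OF that, of s Y] S Z by blast
    qed
  qed simp
  then obtain Z where Z: "Y \<subseteq> Z" "stationary_between (\<supseteq>) (msub Y) Z" using S(3) by blast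
  then show ?thesis unfolding stationary_between_def by (meson order_trans)
qed

text \<open>The filtration by m^j M, obtained by iterating \<open>msub\<close>; powers of the ideal
  itself are compared with it only where completeness of the ring is used.\<close>

primrec mfilt :: "nat \<Rightarrow> 'm set" where
  "mfilt 0 = carrier M"
| "mfilt (Suc j) = msub (mfilt j)"

lemma submodule_mfilt: "submodule (mfilt j) R M"
  by (induction j) (auto simp: carrier_is_submodule intro!: submodule_msub intro: submodule_mem)

lemma mfilt_Suc_subset: "mfilt (Suc j) \<subseteq> mfilt j"
  using msub_subset[OF submodule_mfilt] by simp

lemma dcc_mfilt: "stationary_between (\<supseteq>) (mfilt j) (carrier M)"
proof (induction j)
  case 0
  have "C = (\<lambda>_. carrier M)" if "\<And>n. carrier M \<subseteq> C n \<and> C n \<subseteq> carrier M" for C :: "nat \<Rightarrow> _"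
    using that by blast
  then show ?case unfolding stationary_between_def stationary_def mfilt.simps by (metis (no_types))
next
  case (Suc j)
  show ?case
    using stationary_between_trans[OF _ mfilt_Suc_subset _ submodule_mfilt carrier_is_submodule _ Suc]
      dcc_msub[OF submodule_mfilt[of j]] submodule_mem[OF submodule_mfilt] by auto
qed

lemma pow_smult_mem:
  assumes H: "submodule H R M" and "a \<in> carrier R" "x \<in> carrier M" "a [^] (k::nat) \<odot>\<^bsub>M\<^esub> x \<in> H"
  shows "a [^] (Suc k) \<odot>\<^bsub>M\<^esub> x \<in> H"
proof -
  have "a [^] (Suc k) \<odot>\<^bsub>M\<^esub> x = a \<odot>\<^bsub>M\<^esub> (a [^] k \<odot>\<^bsub>M\<^esub> x)"
    using assms by (simp add: smult_assoc1[symmetric] m_comm)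
  then show ?thesis using assms submoduleE(4)[OF H] by simp
qed

lemma submodule_smult_vimage:
  assumes H: "submodule H R M" and A: "A \<subseteq> carrier R"
  shows "submodule {x \<in> carrier M. \<forall>a\<in>A. a \<odot>\<^bsub>M\<^esub> x \<in> H} R M"
proof (rule submoduleI)
  note E = submoduleE[OF H]
  show "c \<odot>\<^bsub>M\<^esub> x \<in> {x \<in> carrier M. \<forall>a\<in>A. a \<odot>\<^bsub>M\<^esub> x \<in> H}"
    if "c \<in> carrier R" "x \<in> {x \<in> carrier M. \<forall>a\<in>A. a \<odot>\<^bsub>M\<^esub> x \<in> H}" for c x
  proof -
    have "a \<odot>\<^bsub>M\<^esub> (c \<odot>\<^bsub>M\<^esub> x) = c \<odot>\<^bsub>M\<^esub> (a \<odot>\<^bsub>M\<^esub> x)" if "a \<in> A" for a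
      using that \<open>c \<in> _\<close> \<open>x \<in> _\<close> A by (auto simp: smult_assoc1[symmetric] m_comm)
    then show ?thesis using that E(4) by simp
  qed
qed (use submoduleE[OF H] A in \<open>auto simp: submodule_zero_mem[OF H] smult_r_minus smult_r_distr subset_iff\<close>)

text \<open>A submodule \<open>C\<close> on which every element of the maximal ideal is nilpotent modulo \<open>C\<close>
  contains a step of the filtration; otherwise the stable value of the increasing chain
  \<open>(C : m^i)\<close> would be proper, and multiplying an element outside it by suitable powers of the
  generators of \<open>m\<close> leads to an element outside it that \<open>m\<close> carries into it.\<close>

lemma mfilt_subset_if_nilpotent:
  assumes C: "submodule C R M"
    and nil: "\<And>a. a \<in> mm \<Longrightarrow> \<exists>k::nat. \<forall>x\<in>carrier M. a [^] k \<odot>\<^bsub>M\<^esub> x \<in> C"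
  shows "\<exists>i. mfilt i \<subseteq> C"
proof -
  define E where "E = rec_nat C (\<lambda>_ H. {x \<in> carrier M. \<forall>a\<in>mm. a \<odot>\<^bsub>M\<^esub> x \<in> H})"
  have E0: "E 0 = C" and ES: "E (Suc i) = {x \<in> carrier M. \<forall>a\<in>mm. a \<odot>\<^bsub>M\<^esub> x \<in> E i}" for i
    by (simp_all add: E_def)
  have sub: "submodule (E i) R M" for i
    by (induction i) (simp_all add: E0 ES C submodule_smult_vimage max.a_subset)
  have inc: "E i \<subseteq> E (Suc i)" for i
    unfolding ES using submoduleE(4)[OF sub] submodule_mem[OF sub] max.Icarr by blast
  have "stationary E"
  proof (rule fin_gen_acc[unfolded stationary_between_def, THEN spec[of _ E], THEN mp],
      intro allI conjI)
    show "submodule (E n) R M" "E n \<subseteq> E (Suc n)" for n by (fact sub inc)+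
    show "{\<zero>\<^bsub>M\<^esub>} \<subseteq> E n" "E n \<subseteq> carrier M" for n
      using submodule_zero_mem[OF sub] submodule_mem[OF sub] by auto
  qed
  then obtain i where i: "\<forall>k\<ge>i. E k = E i" unfolding stationary_def by blast
  have iS: "E (Suc i) = E i" using i by (rule allE[of _ "Suc i"]) simp
  have CE: "C \<subseteq> E i" using lift_Suc_mono_le[of E 0 i, OF inc] by (simp add: E0)
  obtain A where A: "A \<subseteq> carrier R" "finite A" "mm = Idl A" using finetely_gen[OF max.is_ideal] by blast
  have full: "E i = carrier M"
  proof (rule ccontr)
    assume "E i \<noteq> carrier M"
    then obtain z0 where z0: "z0 \<in> carrier M" "z0 \<notin> E i" using submodule_mem[OF sub] by blast
    have "\<exists>z. z \<in> carrier M \<and> z \<notin> E i \<and> (\<forall>b\<in>B. b \<odot>\<^bsub>M\<^esub> z \<in> E i)" if "finite B" "B \<subseteq> mm" for B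
      using that
    proof (induction B rule: finite_induct)
      case empty
      then show ?case using z0 by blast
    next
      case (insert a B)
      then obtain z where z: "z \<in> carrier M" "z \<notin> E i" "\<And>b. b \<in> B \<Longrightarrow> b \<odot>\<^bsub>M\<^esub> z \<in> E i" by blast
      have a: "a \<in> mm" "a \<in> carrier R" using insert.prems max.Icarr by auto
      obtain k :: nat where "a [^] k \<odot>\<^bsub>M\<^esub> z \<in> E i" using nil[OF a(1)] z(1) CE by blast
      moreover have "\<not> a [^] (0::nat) \<odot>\<^bsub>M\<^esub> z \<in> E i" using z by simp
      ultimately obtain l :: nat where l: "a [^] l \<odot>\<^bsub>M\<^esub> z \<notin> E i" "a [^] Suc l \<odot>\<^bsub>M\<^esub> z \<in> E i"
        using exists_least_lemma[of "\<lambda>k. a [^] k \<odot>\<^bsub>M\<^esub> z \<in> E i"] by blast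
      let ?z = "a [^] l \<odot>\<^bsub>M\<^esub> z"
      have "a \<odot>\<^bsub>M\<^esub> ?z \<in> E i"
        using l(2) a z by (simp add: smult_assoc1[symmetric] m_comm)
      moreover have "b \<odot>\<^bsub>M\<^esub> ?z \<in> E i" if "b \<in> B" for b
      proof -
        have b: "b \<in> carrier R" using that insert.prems max.Icarr by blast
        have "b \<odot>\<^bsub>M\<^esub> ?z = a [^] l \<odot>\<^bsub>M\<^esub> (b \<odot>\<^bsub>M\<^esub> z)"
          using a z b by (simp add: smult_assoc1[symmetric] m_comm)
        then show ?thesis using z(3)[OF that] submoduleE(4)[OF sub] a by simp
      qed
      ultimately show ?case using l(1) a z by (intro exI[of _ ?z]) auto
    qed
    moreover have "A \<subseteq> mm" using genideal_self[OF A(1)] A(3) by simp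
    ultimately obtain z where z: "z \<in> carrier M" "z \<notin> E i" "\<forall>b\<in>A. b \<odot>\<^bsub>M\<^esub> z \<in> E i"
      using A(2) by blast
    then have "mm \<subseteq> {a \<in> carrier R. a \<odot>\<^bsub>M\<^esub> z \<in> E i}"
      unfolding A(3) using A(1) submodule_scalars_ideal[OF sub] by (intro genideal_minimal) auto
    then have "z \<in> E (Suc i)" unfolding ES using z(1) by blast
    then show False using iS z(2) by simp
  qed
  \<comment> \<open>Since \<open>E i\<close> is everything, each multiplication by the maximal ideal
    lowers the index by one; at \<open>l = i\<close> this arrives at \<open>E 0\<close>, which is
    \<open>C\<close>.\<close>
  have "l \<le> i \<Longrightarrow> mfilt l \<subseteq> E (i - l)" for l
  proof (induction l)
    case (Suc l)
    have e: "i - l = Suc (i - Suc l)" using Suc by simp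
    show ?case
      unfolding mfilt.simps
    proof (rule msub_least[OF sub])
      fix a y assume "a \<in> mm" "y \<in> mfilt l"
      then show "a \<odot>\<^bsub>M\<^esub> y \<in> E (i - Suc l)" using Suc ES[of "i - Suc l"] unfolding e[symmetric] by auto
    qed
  qed (simp add: full)
  from this[of i] show ?thesis using E0 by auto
qed

text \<open>Let \<open>N\<close> be the intersection and \<open>C\<close> a maximal submodule
  containing m N whose trace on \<open>N\<close> is inside m N. Maximality forces a power of each
  \<open>a\<close> in the maximal ideal to carry \<open>M\<close> into \<open>C\<close>, so some m^i
  M lies in \<open>C\<close>. Then \<open>N\<close> is inside \<open>C\<close>, hence inside m N,
  and Nakayama's lemma gives zero.\<close>

theorem krull_intersection: "(\<Inter>j. mfilt j) = {\<zero>\<^bsub>M\<^esub>}"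
proof -
  define N where "N = (\<Inter>j. mfilt j)"
  have N: "submodule N R M" unfolding N_def by (rule submodule_INT) (rule submodule_mfilt)
  have NM: "N \<subseteq> carrier M" using submodule_mem[OF N] by blast
  note Q = submodule_msub[OF NM]
  obtain C where C: "submodule C R M" "msub N \<subseteq> C \<and> C \<inter> N \<subseteq> msub N"
    and mx: "\<And>L. submodule L R M \<Longrightarrow> msub N \<subseteq> L \<and> L \<inter> N \<subseteq> msub N \<Longrightarrow> C \<subseteq> L \<Longrightarrow> L = C"
    using exists_maximal_submodule[OF Q, of "\<lambda>C. msub N \<subseteq> C \<and> C \<inter> N \<subseteq> msub N"] by blast
  have "\<exists>k::nat. \<forall>x\<in>carrier M. a [^] k \<odot>\<^bsub>M\<^esub> x \<in> C" if a: "a \<in> mm" for a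
  proof -
    have [simp]: "a \<in> carrier R" using a max.Icarr by blast
    define K where "K k = {x \<in> carrier M. \<forall>b\<in>{a [^] (k::nat)}. b \<odot>\<^bsub>M\<^esub> x \<in> C}" for k
    have sub: "submodule (K k) R M" for k
      unfolding K_def using C(1) by (rule submodule_smult_vimage) simp
    have "stationary K"
    proof (rule fin_gen_acc[unfolded stationary_between_def, THEN spec[of _ K], THEN mp],
        intro allI conjI)
      show "submodule (K n) R M" for n by (rule sub)
      show "{\<zero>\<^bsub>M\<^esub>} \<subseteq> K n" "K n \<subseteq> carrier M" for n
        using submodule_zero_mem[OF sub] submodule_mem[OF sub] by auto
      show "K n \<subseteq> K (Suc n)" for n
        using pow_smult_mem[OF C(1)] unfolding K_def by auto
    qed
    then obtain k where "\<forall>l\<ge>k. K l = K k" unfolding stationary_def by blast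
    then have KS: "K (Suc k) = K k" by (rule allE[of _ "Suc k"]) simp
    let ?P = "(\<lambda>x. a [^] k \<odot>\<^bsub>M\<^esub> x) ` carrier M"
    have P: "submodule ?P R M"
    proof (rule submoduleI)
      show "\<zero>\<^bsub>M\<^esub> \<in> ?P" by (rule image_eqI[of _ _ "\<zero>\<^bsub>M\<^esub>"]) auto
      show "c \<odot>\<^bsub>M\<^esub> x \<in> ?P" if "c \<in> carrier R" "x \<in> ?P" for c x
      proof -
        obtain y where y: "y \<in> carrier M" "x = a [^] k \<odot>\<^bsub>M\<^esub> y" using \<open>x \<in> _\<close> by blast
        then have "c \<odot>\<^bsub>M\<^esub> x = a [^] k \<odot>\<^bsub>M\<^esub> (c \<odot>\<^bsub>M\<^esub> y)"
          using \<open>c \<in> _\<close> by (simp add: smult_assoc1[symmetric] m_comm)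
        then show ?thesis using y \<open>c \<in> _\<close> by blast
      qed
    qed (auto simp: smult_r_minus[symmetric] smult_r_distr[symmetric])
    note up = sum_upper1[OF C(1) P] sum_upper2[OF C(1) P]
    have "(C <+>\<^bsub>M\<^esub> ?P) \<inter> N \<subseteq> msub N"
    proof
      \<comment> \<open>For y = c + a^k x in \<open>N\<close>, the product a y lies in m N and so in
        \<open>C\<close>. Hence a^(k+1) x is in \<open>C\<close>, and by the choice of
        \<open>k\<close> already a^k x is; thus \<open>y\<close> belongs to both \<open>C\<close>
        and \<open>N\<close>.\<close>
      fix y assume "y \<in> (C <+>\<^bsub>M\<^esub> ?P) \<inter> N"
      then have "y \<in> C <+>\<^bsub>M\<^esub> ?P" and yN: "y \<in> N" by auto
      then obtain c x where cx: "c \<in> C" "x \<in> carrier M" "y = c \<oplus>\<^bsub>M\<^esub> a [^] k \<odot>\<^bsub>M\<^esub> x"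
        unfolding mem_sum_iff by blast
      have cM: "c \<in> carrier M" using cx submodule_mem[OF C(1)] by blast
      have "a \<odot>\<^bsub>M\<^esub> y \<in> C" using smult_mem_msub[OF a yN] C(2) by blast
      moreover have "a \<odot>\<^bsub>M\<^esub> y = a [^] Suc k \<odot>\<^bsub>M\<^esub> x \<oplus>\<^bsub>M\<^esub> a \<odot>\<^bsub>M\<^esub> c"
        using cx cM by (simp add: smult_r_distr smult_assoc1[symmetric] m_comm M.a_comm)
      ultimately have "a [^] Suc k \<odot>\<^bsub>M\<^esub> x \<in> C"
        using submodule_add_cancel[OF C(1), of "a [^] Suc k \<odot>\<^bsub>M\<^esub> x" "a \<odot>\<^bsub>M\<^esub> c"]
          submoduleE(4)[OF C(1)] cx by simp
      then have "x \<in> K k" using KS cx unfolding K_def by blast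
      then have "y \<in> C" using cx submoduleE(5)[OF C(1)] unfolding K_def by simp
      then show "y \<in> msub N" using yN C(2) by blast
    qed
    then have "C <+>\<^bsub>M\<^esub> ?P = C" using mx[OF submodule_sum[OF C(1) P]] up C(2) by blast
    then show ?thesis using up(2) by blast
  qed
  then obtain i where "mfilt i \<subseteq> C" using mfilt_subset_if_nilpotent[OF C(1)] by blast
  then have "N \<subseteq> msub N" using C(2) unfolding N_def by blast
  then have "N \<subseteq> {\<zero>\<^bsub>M\<^esub>} <+>\<^bsub>M\<^esub> msub N" using sum_upper2[OF submodule_zero Q] by blast
  then have "N \<subseteq> {\<zero>\<^bsub>M\<^esub>}" by (rule nakayama[OF submodule_zero N])
  then show ?thesis using submodule_zero_mem[OF N] unfolding N_def by blast
qed

end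

section \<open>Homomorphisms and free modules\<close>

lemma noetherian_moduleI:
  fixes R :: "'a ring" and M :: "('a, 'm) module"
  shows "module R M \<Longrightarrow> noetherian_ring R \<Longrightarrow> fin_gen R M \<Longrightarrow> noetherian_module R M"
  by (simp add: noetherian_module_def noetherian_module_axioms_def)

context
  fixes R :: "'a ring" (structure)
begin

lemma mod_homD:
  assumes "f \<in> mod_hom R M N"
  shows "x \<in> carrier M \<Longrightarrow> f x \<in> carrier N"
    and "x \<in> carrier M \<Longrightarrow> y \<in> carrier M \<Longrightarrow> f (x \<oplus>\<^bsub>M\<^esub> y) = f x \<oplus>\<^bsub>N\<^esub> f y"
    and "a \<in> carrier R \<Longrightarrow> x \<in> carrier M \<Longrightarrow> f (a \<odot>\<^bsub>M\<^esub> x) = a \<odot>\<^bsub>N\<^esub> f x"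
    and "f \<in> extensional (carrier M)"
  using assms unfolding mod_hom_def by (auto simp: PiE_def)

lemma mod_homI:
  assumes "module R M"
    and "\<And>x. x \<in> carrier M \<Longrightarrow> f x \<in> carrier N"
    and "\<And>x y. x \<in> carrier M \<Longrightarrow> y \<in> carrier M \<Longrightarrow> f (x \<oplus>\<^bsub>M\<^esub> y) = f x \<oplus>\<^bsub>N\<^esub> f y"
    and "\<And>a x. a \<in> carrier R \<Longrightarrow> x \<in> carrier M \<Longrightarrow> f (a \<odot>\<^bsub>M\<^esub> x) = a \<odot>\<^bsub>N\<^esub> f x"
  shows "restrict f (carrier M) \<in> mod_hom R M N"
proof -
  interpret module R M by fact
  show ?thesis using assms unfolding mod_hom_def by auto
qed

lemma mod_hom_zero:
  assumes M: "module R M" and N: "module R N" and f: "f \<in> mod_hom R M N"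
  shows "f \<zero>\<^bsub>M\<^esub> = \<zero>\<^bsub>N\<^esub>"
proof -
  interpret M: module R M by fact
  interpret N: module R N by fact
  have "f (\<zero> \<odot>\<^bsub>M\<^esub> \<zero>\<^bsub>M\<^esub>) = \<zero> \<odot>\<^bsub>N\<^esub> f \<zero>\<^bsub>M\<^esub>" by (rule mod_homD(3)[OF f]) auto
  then show ?thesis using mod_homD(1)[OF f] by simp
qed

lemma mod_hom_minus:
  assumes M: "module R M" and N: "module R N" and f: "f \<in> mod_hom R M N" and x: "x \<in> carrier M"
  shows "f (\<ominus>\<^bsub>M\<^esub> x) = \<ominus>\<^bsub>N\<^esub> f x"
proof -
  interpret M: module R M by fact
  interpret N: module R N by fact
  have "f ((\<ominus> \<one>) \<odot>\<^bsub>M\<^esub> x) = (\<ominus> \<one>) \<odot>\<^bsub>N\<^esub> f x" by (rule mod_homD(3)[OF f _ x]) auto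
  then show ?thesis using mod_homD(1)[OF f] x by (simp add: M.smult_l_minus N.smult_l_minus)
qed

lemma mod_hom_diff:
  assumes M: "module R M" and N: "module R N" and f: "f \<in> mod_hom R M N"
    and x: "x \<in> carrier M" "y \<in> carrier M"
  shows "f (x \<ominus>\<^bsub>M\<^esub> y) = f x \<ominus>\<^bsub>N\<^esub> f y"
proof -
  interpret M: module R M by fact
  show ?thesis
    using x mod_homD(2)[OF f] mod_hom_minus[OF M N f] by (simp add: a_minus_def)
qed

lemma mod_hom_compose:
  assumes L: "module R L" and f: "f \<in> mod_hom R L M" and g: "g \<in> mod_hom R M N"
  shows "compose (carrier L) g f \<in> mod_hom R L N"
  unfolding compose_def
  by (rule mod_homI[OF L]) (simp_all add: mod_homD[OF f] mod_homD[OF g])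

lemma mod_hom_id: "module R M \<Longrightarrow> (\<lambda>x\<in>carrier M. x) \<in> mod_hom R M M"
  by (rule mod_homI) auto

lemma mod_hom_inverse:
  assumes N: "module R N" and M: "module R M" and f: "f \<in> mod_hom R M N"
    and bij: "bij_betw f (carrier M) (carrier N)"
  shows "\<exists>g\<in>mod_hom R N M. (\<forall>x\<in>carrier M. g (f x) = x) \<and> (\<forall>y\<in>carrier N. f (g y) = y)"
proof -
  interpret M: module R M by fact
  let ?h = "inv_into (carrier M) f"
  let ?g = "restrict ?h (carrier N)"
  have hc: "?h y \<in> carrier M" "f (?h y) = y" if "y \<in> carrier N" for y
    using that bij inv_into_into[of y f "carrier M"] f_inv_into_f[of y f "carrier M"]
    unfolding bij_betw_def by simp_all
  have hf: "?h (f x) = x" if "x \<in> carrier M" for x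
    using bij_betw_inv_into_left[OF bij that] .
  have "?g \<in> mod_hom R N M"
  proof (rule mod_homI[OF N])
    show "?h (x \<oplus>\<^bsub>N\<^esub> y) = ?h x \<oplus>\<^bsub>M\<^esub> ?h y" if "x \<in> carrier N" "y \<in> carrier N" for x y
      using that hc mod_homD(2)[OF f, of "?h x" "?h y"] hf[of "?h x \<oplus>\<^bsub>M\<^esub> ?h y"] by simp
    show "?h (a \<odot>\<^bsub>N\<^esub> x) = a \<odot>\<^bsub>M\<^esub> ?h x" if "a \<in> carrier R" "x \<in> carrier N" for a x
      using that hc mod_homD(3)[OF f, of a "?h x"] hf[of "a \<odot>\<^bsub>M\<^esub> ?h x"] by simp
  qed (rule hc)
  then show ?thesis using hf hc mod_homD(1)[OF f] by (intro bexI[of _ ?g]) auto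
qed

lemma submodule_vimage:
  assumes M: "module R M" and N: "module R N" and f: "f \<in> mod_hom R M N" and H: "submodule H R N"
  shows "submodule {x \<in> carrier M. f x \<in> H} R M"
proof -
  interpret M: module R M by fact
  interpret N: module R N by fact
  show ?thesis
    by (rule M.submoduleI)
       (simp_all add: mod_homD[OF f] mod_hom_zero[OF M N f] mod_hom_minus[OF M N f]
          N.submodule_zero_mem[OF H] N.submoduleE[OF H])
qed

lemma submodule_image:
  assumes M: "module R M" and N: "module R N" and f: "f \<in> mod_hom R M N" and H: "submodule H R M"
  shows "submodule (f ` H) R N"
proof -
  interpret M: module R M by fact
  interpret N: module R N by fact
  note E = M.submoduleE[OF H] and z = M.submodule_zero_mem[OF H]
  have c: "x \<in> carrier M" if "x \<in> H" for x using that M.submodule_mem[OF H] by blast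
  show ?thesis
  proof (rule N.submoduleI)
    show "\<zero>\<^bsub>N\<^esub> \<in> f ` H" using z mod_hom_zero[OF M N f] by (metis image_eqI)
    show "\<ominus>\<^bsub>N\<^esub> a \<in> f ` H" if "a \<in> f ` H" for a
      using that E(3) c by (auto simp: mod_hom_minus[OF M N f, symmetric])
    show "a \<oplus>\<^bsub>N\<^esub> b \<in> f ` H" if "a \<in> f ` H" "b \<in> f ` H" for a b
      using that E(5) c by (auto simp: mod_homD(2)[OF f, symmetric])
    show "a \<odot>\<^bsub>N\<^esub> b \<in> f ` H" if "a \<in> carrier R" "b \<in> f ` H" for a b
      using that E(4) c by (auto simp: mod_homD(3)[OF f, symmetric])
  qed (use c mod_homD(1)[OF f] in blast)
qed

lemma submodule_kernel:
  assumes "module R M" "module R N" "f \<in> mod_hom R M N"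
  shows "submodule {x \<in> carrier M. f x = \<zero>\<^bsub>N\<^esub>} R M"
  using submodule_vimage[OF assms module.submodule_zero[OF assms(2)]] by simp

lemma submodule_equalizer:
  assumes M: "module R M" and N: "module R N" and f: "f \<in> mod_hom R M N" and g: "g \<in> mod_hom R M N"
  shows "submodule {x \<in> carrier M. f x = g x} R M"
proof -
  interpret M: module R M by fact
  show ?thesis
    by (rule M.submoduleI)
       (auto simp: mod_homD[OF f] mod_homD[OF g] mod_hom_zero[OF M N f] mod_hom_zero[OF M N g]
          mod_hom_minus[OF M N f] mod_hom_minus[OF M N g])
qed

section \<open>Free modules of finite rank: universal property, projectivity, covers and
  resolutions\<close>

lemma carrier_free_module: "carrier (free_module R n) = {..<n} \<rightarrow>\<^sub>E carrier R"
  and zero_free_module: "\<zero>\<^bsub>free_module R n\<^esub> = (\<lambda>i\<in>{..<n}. \<zero>)"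
  and add_free_module: "x \<oplus>\<^bsub>free_module R n\<^esub> y = (\<lambda>i\<in>{..<n}. x i \<oplus> y i)"
  and smult_free_module: "a \<odot>\<^bsub>free_module R n\<^esub> x = (\<lambda>i\<in>{..<n}. a \<otimes> x i)"
  by (simp_all add: free_module_def)

lemmas free_module_simps =
  carrier_free_module zero_free_module add_free_module smult_free_module

definition unit_vec :: "nat \<Rightarrow> nat \<Rightarrow> nat \<Rightarrow> 'a" where
  "unit_vec n i = (\<lambda>k\<in>{..<n}. if k = i then \<one> else \<zero>)"

context
  assumes cring: "cring R"
begin

interpretation cring R by (fact cring)

lemma module_free_module: "module R (free_module R n)"
proof (rule moduleI[OF cring])
  show "abelian_group (free_module R n)"
  proof (rule abelian_groupI)
    fix x assume x: "x \<in> carrier (free_module R n)"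
    show "\<exists>y\<in>carrier (free_module R n). y \<oplus>\<^bsub>free_module R n\<^esub> x = \<zero>\<^bsub>free_module R n\<^esub>"
      using x by (intro bexI[of _ "\<lambda>i\<in>{..<n}. \<ominus> x i"]) (auto simp: free_module_simps l_neg PiE_iff intro!: restrict_ext)
  qed (auto simp: free_module_simps PiE_iff extensional_def a_ac intro!: ext)
qed (auto simp: free_module_simps PiE_iff extensional_def l_distr r_distr m_assoc intro!: ext)

lemma minus_free_module:
  assumes x: "x \<in> carrier (free_module R n)"
  shows "\<ominus>\<^bsub>free_module R n\<^esub> x = (\<lambda>i\<in>{..<n}. \<ominus> x i)"
proof -
  interpret F: module R "free_module R n" by (rule module_free_module)
  show ?thesis
    by (rule F.minus_equality) (use x in \<open>auto simp: free_module_simps l_neg PiE_iff intro!: restrict_ext\<close>)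
qed

lemma diff_free_module:
  assumes "x \<in> carrier (free_module R n)" "y \<in> carrier (free_module R n)" "i < n"
  shows "(x \<ominus>\<^bsub>free_module R n\<^esub> y) i = x i \<ominus> y i"
  using assms by (simp add: a_minus_def minus_free_module add_free_module)

lemma unit_vec_closed [simp]: "unit_vec n i \<in> carrier (free_module R n)"
  by (simp add: unit_vec_def free_module_simps)

lemma free_module_mem_submodule:
  assumes H: "submodule H R (free_module R n)" and z: "z \<in> carrier (free_module R n)"
    and e: "\<And>i. i < n \<Longrightarrow> z i \<odot>\<^bsub>free_module R n\<^esub> unit_vec n i \<in> H"
  shows "z \<in> H"
proof -
  interpret F: module R "free_module R n" by (rule module_free_module)
  note E = F.submoduleE[OF H]
  have zc: "z i \<in> carrier R" if "i < n" for i using z that by (auto simp: free_module_simps)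
  \<comment> \<open>The truncations of \<open>z\<close> to its first \<open>k\<close> coordinates
    are reached by adding one multiple of a unit vector at a time.\<close>
  have "k \<le> n \<Longrightarrow> (\<lambda>i\<in>{..<n}. if i < k then z i else \<zero>) \<in> H" for k
  proof (induction k)
    case 0
    then show ?case using F.submodule_zero_mem[OF H] by (simp add: free_module_simps restrict_def)
  next
    case (Suc k)
    have eq: "(\<lambda>i\<in>{..<n}. if i < Suc k then z i else \<zero>) = (\<lambda>i\<in>{..<n}. if i < k then z i else \<zero>)
        \<oplus>\<^bsub>free_module R n\<^esub> z k \<odot>\<^bsub>free_module R n\<^esub> unit_vec n k"
      using zc Suc.prems by (auto simp: free_module_simps unit_vec_def less_Suc_eq intro!: ext)
    have "k \<le> n" "k < n" using Suc.prems by auto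
    then show ?case unfolding eq by (intro E(5) Suc.IH e)
  qed
  from this[of n] have "(\<lambda>i\<in>{..<n}. if i < n then z i else \<zero>) \<in> H" by simp
  moreover have "(\<lambda>i\<in>{..<n}. if i < n then z i else \<zero>) = z"
    using z by (auto simp: free_module_simps PiE_iff extensional_def)
  ultimately show ?thesis by simp
qed

lemma free_module_submodule_eqI:
  assumes H: "submodule H R (free_module R n)" and e: "\<And>i. i < n \<Longrightarrow> unit_vec n i \<in> H"
  shows "H = carrier (free_module R n)"
proof -
  interpret F: module R "free_module R n" by (rule module_free_module)
  have "z \<in> H" if z: "z \<in> carrier (free_module R n)" for z
    by (rule free_module_mem_submodule[OF H z])
       (use z e F.submoduleE(4)[OF H] in \<open>auto simp: free_module_simps PiE_iff\<close>)
  then show ?thesis using F.submoduleE(1)[OF H] by blast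
qed

lemma fin_gen_free_module: "fin_gen R (free_module R n)"
  unfolding fin_gen_def
  by (rule exI[of _ "unit_vec n ` {..<n}"]) (auto intro!: free_module_submodule_eqI)

lemma free_module_hom_exists:
  assumes M: "module R M" and v: "\<And>i. i < n \<Longrightarrow> v i \<in> carrier M"
  shows "\<exists>h\<in>mod_hom R (free_module R n) M. \<forall>i<n. h (unit_vec n i) = v i"
proof -
  interpret M: module R M by fact
  let ?F = "free_module R n"
  let ?h = "\<lambda>z. finsum M (\<lambda>i. z i \<odot>\<^bsub>M\<^esub> v i) {..<n}"
  have c: "z i \<in> carrier R" if "z \<in> carrier ?F" "i < n" for z i using that by (auto simp: free_module_simps)
  have "restrict ?h (carrier ?F) \<in> mod_hom R ?F M"
  proof (rule mod_homI[OF module_free_module])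
    show "?h z \<in> carrier M" if "z \<in> carrier ?F" for z
      using v c[OF that] by (auto intro!: M.M.finsum_closed)
    show "?h (y \<oplus>\<^bsub>?F\<^esub> z) = ?h y \<oplus>\<^bsub>M\<^esub> ?h z" if yz: "y \<in> carrier ?F" "z \<in> carrier ?F" for y z
    proof -
      have "?h (y \<oplus>\<^bsub>?F\<^esub> z) = finsum M (\<lambda>i. y i \<odot>\<^bsub>M\<^esub> v i \<oplus>\<^bsub>M\<^esub> z i \<odot>\<^bsub>M\<^esub> v i) {..<n}"
        by (rule M.M.finsum_cong')
           (use v c[OF yz(1)] c[OF yz(2)] in \<open>auto simp: add_free_module M.smult_l_distr\<close>)
      then show ?thesis
        using v c[OF yz(1)] c[OF yz(2)] by (simp add: M.M.finsum_addf Pi_iff)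
    qed
    show "?h (a \<odot>\<^bsub>?F\<^esub> z) = a \<odot>\<^bsub>M\<^esub> ?h z" if az: "a \<in> carrier R" "z \<in> carrier ?F" for a z
    proof -
      have "?h (a \<odot>\<^bsub>?F\<^esub> z) = finsum M (\<lambda>i. a \<odot>\<^bsub>M\<^esub> (z i \<odot>\<^bsub>M\<^esub> v i)) {..<n}"
        by (rule M.M.finsum_cong')
           (use v az c[OF az(2)] in \<open>auto simp: smult_free_module M.smult_assoc1\<close>)
      then show ?thesis
        using v az c[OF az(2)] by (simp add: M.finsum_smult_ldistr Pi_iff)
    qed
  qed
  moreover have "?h (unit_vec n i) = v i" if "i < n" for i
  proof -
    have "?h (unit_vec n i) = finsum M (\<lambda>j. if i = j then v j else \<zero>\<^bsub>M\<^esub>) {..<n}"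
      by (rule M.M.finsum_cong') (use v in \<open>auto simp: unit_vec_def\<close>)
    also have "\<dots> = v i" using M.M.finsum_singleton[of i "{..<n}" v] that v by auto
    finally show ?thesis .
  qed
  ultimately show ?thesis by (intro bexI[of _ "restrict ?h (carrier ?F)"]) auto
qed

text \<open>Projectivity of R^n: the images of the unit vectors are lifted arbitrarily, and the
  equalizer of both maps is a submodule containing the unit vectors. The condition \<open>le\<close>
  speaks of the image of \<open>p\<close> only, which is the form met when lifting along a
  differential into the kernel of the preceding one.\<close>

lemma free_module_lift:
  assumes A: "module R A" and B: "module R B" and f: "f \<in> mod_hom R (free_module R n) B"
    and p: "p \<in> mod_hom R A B" and le: "\<And>z. z \<in> carrier (free_module R n) \<Longrightarrow> f z \<in> p ` carrier A"
  shows "\<exists>g\<in>mod_hom R (free_module R n) A. \<forall>z\<in>carrier (free_module R n). p (g z) = f z"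
proof -
  let ?F = "free_module R n"
  have "\<forall>i. \<exists>a. i < n \<longrightarrow> a \<in> carrier A \<and> p a = f (unit_vec n i)"
    using le[OF unit_vec_closed] by (metis imageE)
  then obtain v where v: "\<forall>i. i < n \<longrightarrow> v i \<in> carrier A \<and> p (v i) = f (unit_vec n i)" by metis
  then obtain g where g: "g \<in> mod_hom R ?F A" "\<forall>i<n. g (unit_vec n i) = v i"
    using free_module_hom_exists[OF A, of n v] by blast
  note pg = mod_hom_compose[OF module_free_module g(1) p]
  have eq: "{z \<in> carrier ?F. compose (carrier ?F) p g z = f z} = carrier ?F"
    by (rule free_module_submodule_eqI[OF submodule_equalizer[OF module_free_module B pg f]])
       (use g v in \<open>auto simp: compose_def\<close>)
  have "p (g z) = f z" if "z \<in> carrier ?F" for z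
    using that eq by (metis (mono_tags, lifting) compose_eq mem_Collect_eq)
  then show ?thesis using g(1) by blast
qed

lemma free_cover_of_finite_set:
  assumes M: "module R M" and S: "finite S" "S \<subseteq> carrier M"
  shows "\<exists>n. \<exists>p\<in>mod_hom R (free_module R n) M. S \<subseteq> p ` carrier (free_module R n) \<and>
    (\<forall>K. submodule K R M \<longrightarrow> S \<subseteq> K \<longrightarrow> p ` carrier (free_module R n) \<subseteq> K)"
proof -
  obtain n :: nat and v where v: "S = v ` {..<n}"
    using finite_imp_nat_seg_image_inj_on[OF S(1)] unfolding lessThan_def by metis
  then obtain p where p: "p \<in> mod_hom R (free_module R n) M" "\<forall>i<n. p (unit_vec n i) = v i"
    using free_module_hom_exists[OF M, of n v] S(2) by blast
  have "p ` carrier (free_module R n) \<subseteq> K" if K: "submodule K R M" "S \<subseteq> K" for K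
  proof -
    have "{z \<in> carrier (free_module R n). p z \<in> K} = carrier (free_module R n)"
      by (rule free_module_submodule_eqI[OF submodule_vimage[OF module_free_module M p(1) K(1)]])
         (use p v K in auto)
    then show ?thesis by blast
  qed
  moreover have "v i \<in> p ` carrier (free_module R n)" if "i < n" for i
    using p(2) that imageI[OF unit_vec_closed, of p n i] by simp
  then have "S \<subseteq> p ` carrier (free_module R n)" unfolding v by blast
  ultimately show ?thesis using p(1) by (intro exI[of _ n] bexI[of _ p]) auto
qed

lemma free_cover:
  assumes M: "module R M" and fg: "fin_gen R M"
  shows "\<exists>n. \<exists>p\<in>mod_hom R (free_module R n) M. p ` carrier (free_module R n) = carrier M"
proof -
  obtain S where S: "finite S" "S \<subseteq> carrier M" "\<forall>H. submodule H R M \<and> S \<subseteq> H \<longrightarrow> H = carrier M"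
    using fg unfolding fin_gen_def by blast
  obtain n p where p: "p \<in> mod_hom R (free_module R n) M" "S \<subseteq> p ` carrier (free_module R n)"
    using free_cover_of_finite_set[OF M S(1,2)] by blast
  have "submodule (p ` carrier (free_module R n)) R M"
    by (rule submodule_image[OF module_free_module M p(1)
          module.carrier_is_submodule[OF module_free_module]])
  then show ?thesis using S(3) p by blast
qed

end

lemma cring_of_module: "module R M \<Longrightarrow> cring R"
  unfolding module_def by blast

text \<open>The cover keeps \<open>M\<close> as its codomain and has \<open>H\<close> as its image,
  so that a cover of a kernel is directly the next differential of a resolution.\<close>

lemma free_cover_submodule:
  assumes M: "noetherian_module R M" and H: "submodule H R M"
  shows "\<exists>n. \<exists>p\<in>mod_hom R (free_module R n) M. p ` carrier (free_module R n) = H"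
proof -
  interpret noetherian_module R M by fact
  obtain S where S: "finite S" "S \<subseteq> H" "\<And>K. submodule K R M \<Longrightarrow> S \<subseteq> K \<Longrightarrow> H \<subseteq> K"
    using submodule_finite_generators[OF H] by blast
  have SM: "S \<subseteq> carrier M" using S(2) submodule_mem[OF H] by blast
  obtain n p where p: "p \<in> mod_hom R (free_module R n) M" "S \<subseteq> p ` carrier (free_module R n)"
    and least: "\<forall>K. submodule K R M \<longrightarrow> S \<subseteq> K \<longrightarrow> p ` carrier (free_module R n) \<subseteq> K"
    using free_cover_of_finite_set[OF R.is_cring module_axioms S(1) SM] by (elim exE bexE conjE) (rule that)
  have "p ` carrier (free_module R n) \<subseteq> H" using least H S(2) by simp
  moreover have "submodule (p ` carrier (free_module R n)) R M"
    by (rule submodule_image[OF module_free_module[OF R.is_cring] module_axioms p(1)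
          module.carrier_is_submodule[OF module_free_module[OF R.is_cring]]])
  ultimately show ?thesis using S(3) p by blast
qed

lemma noetherian_free_module:
  assumes "cring R" "noetherian_ring R"
  shows "noetherian_module R (free_module R n)"
  using noetherian_moduleI module_free_module fin_gen_free_module assms by blast

lemma free_resolution_exists:
  assumes R: "cring R" "noetherian_ring R" and K: "module R K" "fin_gen R K"
  shows "\<exists>r d e. free_resolution R K r d e"
proof -
  note F = module_free_module[OF R(1)]
  have cover: "\<exists>m. \<exists>q\<in>mod_hom R (free_module R m) (free_module R n).
      {x \<in> carrier (free_module R n). f x = \<zero>\<^bsub>N\<^esub>} = q ` carrier (free_module R m)"
    if "module R N" "f \<in> mod_hom R (free_module R n) N" for n f and N :: "('a, 'n) module"
    using free_cover_submodule[OF noetherian_free_module[OF R] submodule_kernel[OF F that]] by metis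
  obtain r0 e where e: "e \<in> mod_hom R (free_module R r0) K" "e ` carrier (free_module R r0) = carrier K"
    using free_cover[OF R(1) K] by blast
  obtain r1 d0 where d0: "d0 \<in> mod_hom R (free_module R r1) (free_module R r0)"
    "{x \<in> carrier (free_module R r0). e x = \<zero>\<^bsub>K\<^esub>} = d0 ` carrier (free_module R r1)"
    using free_cover_submodule[OF noetherian_free_module[OF R] submodule_kernel[OF F K(1) e(1)]] by metis
  \<comment> \<open>The state of the recursion is a triple of target rank, source rank and map.
    \<open>P\<close> also pins the first state to the cover of the kernel of the augmentation, and
    \<open>Q\<close> expresses exactness between consecutive states.\<close>
  define P where "P i t \<longleftrightarrow> (case t of (n, m, f) \<Rightarrow>
      f \<in> mod_hom R (free_module R m) (free_module R n) \<and> (i = 0 \<longrightarrow> (n, m, f) = (r0, r1, d0)))"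
    for i :: nat and t
  define Q where "Q t t' \<longleftrightarrow> (case t of (n, m, f) \<Rightarrow> case t' of (n', m', f') \<Rightarrow> n' = m \<and>
     {x \<in> carrier (free_module R m). f x = \<zero>\<^bsub>free_module R n\<^esub>} = f' ` carrier (free_module R m'))"
    for t t' :: "nat \<times> nat \<times> ((nat \<Rightarrow> 'a) \<Rightarrow> nat \<Rightarrow> 'a)"
  have "\<exists>T. \<forall>i. P i (T i) \<and> Q (T i) (T (Suc i))"
  proof (rule dependent_nat_choice)
    show "\<exists>t. P 0 t" using d0(1) unfolding P_def by (intro exI[of _ "(r0, r1, d0)"]) simp
    fix t i assume "P i t"
    moreover obtain n m f where t: "t = (n, m, f)" by (cases t)
    ultimately have f: "f \<in> mod_hom R (free_module R m) (free_module R n)" unfolding P_def by simp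
    obtain m' q where "q \<in> mod_hom R (free_module R m') (free_module R m)"
      "{x \<in> carrier (free_module R m). f x = \<zero>\<^bsub>free_module R n\<^esub>} = q ` carrier (free_module R m')"
      using cover[OF F f] by blast
    then show "\<exists>t'. P (Suc i) t' \<and> Q t t'"
      unfolding P_def Q_def t by (intro exI[of _ "(m, m', q)"]) simp
  qed
  then obtain T where T: "\<And>i. P i (T i)" "\<And>i. Q (T i) (T (Suc i))" by blast
  define r where "r i = fst (T i)" for i
  define d where "d i = snd (snd (T i))" for i
  have Teq: "T i = (r i, r (Suc i), d i)" for i
    using T(2)[of i] unfolding Q_def r_def d_def by (auto split: prod.splits)
  have "T 0 = (r0, r1, d0)" using T(1)[of 0] unfolding P_def by (auto split: prod.splits)
  then have z: "r 0 = r0" "r 1 = r1" "d 0 = d0" using Teq[of 0] by auto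
  have dh: "d i \<in> mod_hom R (free_module R (r (Suc i))) (free_module R (r i))" for i
    using T(1)[of i] unfolding P_def Teq by simp
  have ex: "{x \<in> carrier (free_module R (r (Suc i))). d i x = \<zero>\<^bsub>free_module R (r i)\<^esub>}
        = d (Suc i) ` carrier (free_module R (r (Suc (Suc i))))" for i
    using T(2)[of i] unfolding Q_def Teq[of i] Teq[of "Suc i"] by simp
  have "free_resolution R K r d e"
    unfolding free_resolution_def using e d0 dh ex z by simp
  then show ?thesis by blast
qed

end

section \<open>Endomorphisms of indecomposable modules over complete local rings\<close>

lemma (in abelian_group) a_cancel:
  assumes "x \<in> carrier G" "y \<in> carrier G"
  shows "x \<oplus> (y \<oplus> \<ominus> x) = y" "\<ominus> x \<oplus> (y \<oplus> x) = y"
  using assms by (simp_all add: a_comm[of y] r_neg1 r_neg2)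

locale complete_local_module = local_module R M
  for R :: "'a ring" (structure) and M :: "('a, 'm) module" (structure) +
  assumes complete: "adic_complete R (max_ideal R)"
begin

abbreviation mpow :: "nat \<Rightarrow> 'a set" where "mpow n \<equiv> mm [^]\<^bsub>ideals_set R\<^esub> n"

lemma mpow_0: "mpow 0 = carrier R" and mpow_Suc: "mpow (Suc n) = mpow n \<cdot> mm"
proof -
  interpret S: semiring "ideals_set R" by (rule ideals_set_is_semiring)
  show "mpow 0 = carrier R" using S.nat_pow_0 by (simp add: ideals_set_def)
  show "mpow (Suc n) = mpow n \<cdot> mm" using S.nat_pow_Suc[of mm n] by (simp add: ideals_set_def)
qed

lemma ideal_mpow: "ideal (mpow n) R"
proof (induction n)
  case 0
  then show ?case by (simp only: mpow_0 oneideal)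
next
  case (Suc n)
  then show ?case by (simp only: mpow_Suc ideal_prod_is_ideal max.is_ideal)
qed

lemma mpow_Suc_subset: "mpow (Suc n) \<subseteq> mpow n"
  using ideal_prod_inter[OF ideal_mpow[of n] max.is_ideal] by (simp only: mpow_Suc) blast

text \<open>Completeness is phrased with decreasing families of cosets. A sequence whose n-th step
  lies in m^n yields such a family, and the element representing all its cosets is the
  limit.\<close>

lemma adic_limit_exists:
  assumes r: "\<And>n. r n \<in> carrier R" and d: "\<And>n. r (Suc n) \<ominus> r n \<in> mpow n"
  shows "\<exists>l\<in>carrier R. \<forall>n. l \<ominus> r n \<in> mpow n"
proof -
  have "mpow (Suc n) +> r (Suc n) \<subseteq> mpow n +> r n" for n
  proof -
    have "mpow (Suc n) +> r (Suc n) \<subseteq> mpow n +> r (Suc n)"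
      using mpow_Suc_subset by (auto simp: a_r_coset_def')
    also have "\<dots> = mpow n +> r n"
      using quotient_eq_iff_same_a_r_cos[OF ideal_mpow] r d by blast
    finally show ?thesis .
  qed
  moreover have "mpow n +> r n \<in> carrier (R Quot mpow n)" for n
    using R.a_rcosetsI[of "mpow n" "r n"] r ideal.Icarr[OF ideal_mpow] by (simp add: FactRing_def subset_iff)
  ultimately obtain l where l: "l \<in> carrier R" "\<And>n. mpow n +> r n = mpow n +> l"
    using complete[unfolded adic_complete_def, rule_format, of "\<lambda>n. mpow n +> r n"] by blast
  then have "l \<ominus> r n \<in> mpow n" for n
    using quotient_eq_iff_same_a_r_cos[OF ideal_mpow, of l "r n"] r by metis
  then show ?thesis using l(1) by blast
qed

lemma mpow_smult_mem_mfilt: "a \<in> mpow j \<Longrightarrow> x \<in> carrier M \<Longrightarrow> a \<odot>\<^bsub>M\<^esub> x \<in> mfilt j"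
proof (induction j arbitrary: a)
  case 0
  then show ?case using mpow_0 by simp
next
  case (Suc j)
  have c: "mpow j \<cdot> mm \<subseteq> carrier R" by (rule ideal_prod_in_carrier[OF ideal_mpow max.is_ideal])
  have "a \<in> mpow j \<cdot> mm" using Suc.prems(1) by (simp only: mpow_Suc)
  then show ?case
  proof (induction rule: ideal_prod.induct)
    case (prod i b)
    have "i \<in> carrier R" "b \<in> carrier R" using prod ideal.Icarr[OF ideal_mpow] max.Icarr by auto
    then have "(i \<otimes> b) \<odot>\<^bsub>M\<^esub> x = b \<odot>\<^bsub>M\<^esub> (i \<odot>\<^bsub>M\<^esub> x)"
      using Suc.prems(2) by (simp add: m_comm smult_assoc1)
    then show ?case using smult_mem_msub[OF prod(2) Suc.IH[OF prod(1) Suc.prems(2)]] by simp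
  next
    case (sum s1 s2)
    then show ?case
      using subsetD[OF c, of s1] subsetD[OF c, of s2] Suc.prems(2)
        submoduleE(5)[OF submodule_mfilt[of "Suc j"]] smult_l_distr[of s1 s2 x] by simp
  qed
qed

text \<open>Completeness passes from \<open>R\<close> to R^n coordinatewise and then to
  \<open>M\<close> along a cover \<open>p\<close>. For this the steps of the given sequence must be
  lifted with control of the filtration, which is possible because \<open>p\<close> carries that of
  R^n onto that of \<open>M\<close>.\<close>

lemma mfilt_complete:
  assumes x: "\<And>n. x n \<in> carrier M" and d: "\<And>n. x (Suc n) \<ominus>\<^bsub>M\<^esub> x n \<in> mfilt n"
  shows "\<exists>l\<in>carrier M. \<forall>n. l \<ominus>\<^bsub>M\<^esub> x n \<in> mfilt n"
proof -
  obtain n p where p: "p \<in> mod_hom R (free_module R n) M"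
    and onto: "p ` carrier (free_module R n) = carrier M"
    using free_cover[OF R.is_cring module_axioms fin_gen] by blast
  let ?F = "free_module R n"
  note FM = module_free_module[OF R.is_cring, of n]
  interpret F: module R ?F by (rule FM)
  \<comment> \<open>The vectors with all coordinates in m^j. The facts \<open>le\<close> and
    \<open>ge\<close> below show that \<open>p\<close> maps \<open>T j\<close> exactly onto
    \<open>mfilt j\<close>.\<close>
  define T where "T j = {z \<in> carrier ?F. \<forall>i<n. z i \<in> mpow j}" for j
  have zc: "z i \<in> carrier R" if "z \<in> carrier ?F" "i < n" for z i
    using that by (auto simp: carrier_free_module)
  have T: "submodule (T j) R ?F" for j
  proof -
    interpret I: ideal "mpow j" R by (rule ideal_mpow)
    show ?thesis
      by (rule F.submoduleI)
         (auto simp: T_def minus_free_module[OF R.is_cring] zero_free_module add_free_module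
           smult_free_module carrier_free_module PiE_iff extensional_def I.I_l_closed)
  qed
  have le: "mfilt j \<subseteq> p ` T j" for j
  proof (induction j)
    case 0
    have "T 0 = carrier ?F" using zc by (auto simp only: T_def mpow_0)
    then show ?case using onto by simp
  next
    case (Suc j)
    show ?case
      unfolding mfilt.simps
    proof (rule msub_least[OF submodule_image[OF FM module_axioms p T]])
      fix a y assume a: "a \<in> mm" and "y \<in> mfilt j"
      then obtain z where z: "z \<in> T j" "y = p z" using Suc by blast
      have aR: "a \<in> carrier R" using a max.Icarr by blast
      have zF: "z \<in> carrier ?F" using z unfolding T_def by blast
      have "a \<odot>\<^bsub>?F\<^esub> z \<in> T (Suc j)"
        unfolding T_def
      proof (intro CollectI conjI allI impI)
        fix i assume i: "i < n"
        have "z i \<otimes> a \<in> mpow (Suc j)"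
          using ideal_prod.prod[of "z i" "mpow j" a mm R] z i a unfolding T_def mpow_Suc by blast
        then show "(a \<odot>\<^bsub>?F\<^esub> z) i \<in> mpow (Suc j)"
          using i zc[OF zF i] aR by (simp add: smult_free_module m_comm)
      qed (use aR zF in simp)
      moreover have "a \<odot>\<^bsub>M\<^esub> y = p (a \<odot>\<^bsub>?F\<^esub> z)" using mod_homD(3)[OF p aR zF] z by simp
      ultimately show "a \<odot>\<^bsub>M\<^esub> y \<in> p ` T (Suc j)" by blast
    qed
  qed
  have ge: "p z \<in> mfilt j" if z: "z \<in> T j" for z j
  proof -
    have zF: "z \<in> carrier ?F" using z unfolding T_def by blast
    have "z \<in> {z \<in> carrier ?F. p z \<in> mfilt j}"
    proof (rule free_module_mem_submodule[OF R.is_cring submodule_vimage[OF FM module_axioms p submodule_mfilt] zF])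
      fix i assume i: "i < n"
      have e: "unit_vec R n i \<in> carrier ?F" by (rule unit_vec_closed[OF R.is_cring])
      have "p (z i \<odot>\<^bsub>?F\<^esub> unit_vec R n i) = z i \<odot>\<^bsub>M\<^esub> p (unit_vec R n i)"
        using zc[OF zF i] e by (rule mod_homD(3)[OF p])
      moreover have "z i \<in> mpow j" using z i unfolding T_def by blast
      ultimately show "z i \<odot>\<^bsub>?F\<^esub> unit_vec R n i \<in> {z \<in> carrier ?F. p z \<in> mfilt j}"
        using mpow_smult_mem_mfilt mod_homD(1)[OF p e] zc[OF zF i] e by simp
    qed
    then show ?thesis by blast
  qed
  have "\<forall>j. \<exists>z. z \<in> T j \<and> p z = x (Suc j) \<ominus>\<^bsub>M\<^esub> x j" using le d by (metis (no_types, lifting) imageE subsetD)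
  then obtain z where z: "\<And>j. z j \<in> T j" "\<And>j. p (z j) = x (Suc j) \<ominus>\<^bsub>M\<^esub> x j" by metis
  then have zF: "z j \<in> carrier ?F" for j unfolding T_def by blast
  obtain y0 where y0: "y0 \<in> carrier ?F" "p y0 = x 0" using onto x[of 0] by (metis imageE)
  \<comment> \<open>Partial sums of the lifted differences: \<open>Y j\<close> lies over
    \<open>x j\<close>, and its coordinates form Cauchy sequences in the ring.\<close>
  define Y where "Y = rec_nat y0 (\<lambda>j y. y \<oplus>\<^bsub>?F\<^esub> z j)"
  have Y0: "Y 0 = y0" and YS: "Y (Suc j) = Y j \<oplus>\<^bsub>?F\<^esub> z j" for j by (simp_all add: Y_def)
  have YF: "Y j \<in> carrier ?F" for j by (induction j) (simp_all add: Y0 YS y0 zF)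
  have pY: "p (Y j) = x j" for j
  proof (induction j)
    case (Suc j)
    have "p (Y (Suc j)) = x j \<oplus>\<^bsub>M\<^esub> (x (Suc j) \<ominus>\<^bsub>M\<^esub> x j)"
      using Suc mod_homD(2)[OF p YF zF] by (simp add: YS z)
    also have "\<dots> = x (Suc j)" using x[of j] x[of "Suc j"] M.a_comm[of "x j" "x (Suc j) \<ominus>\<^bsub>M\<^esub> x j"]
      by (simp add: a_minus_def M.a_assoc M.l_neg)
    finally show ?case .
  qed (simp add: Y0 y0)
  have "\<forall>i. \<exists>c. i < n \<longrightarrow> c \<in> carrier R \<and> (\<forall>j. c \<ominus> Y j i \<in> mpow j)"
  proof
    fix i
    show "\<exists>c. i < n \<longrightarrow> c \<in> carrier R \<and> (\<forall>j. c \<ominus> Y j i \<in> mpow j)"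
    proof (cases "i < n")
      case True
      have "Y (Suc j) i \<ominus> Y j i = z j i" for j
        using zc[OF YF True] zc[OF zF True] True R.a_comm[of "Y j i" "z j i"]
        by (simp add: YS add_free_module a_minus_def R.a_assoc R.r_neg)
      moreover have "z j i \<in> mpow j" for j using z(1) True unfolding T_def by blast
      ultimately show ?thesis
        using adic_limit_exists[of "\<lambda>j. Y j i"] zc[OF YF True] by auto
    qed simp
  qed
  then obtain c where c: "\<And>i. i < n \<Longrightarrow> c i \<in> carrier R" "\<And>i j. i < n \<Longrightarrow> c i \<ominus> Y j i \<in> mpow j"
    by metis
  let ?L = "\<lambda>i\<in>{..<n}. c i"
  have L: "?L \<in> carrier ?F" using c(1) by (simp add: carrier_free_module)
  have "p ?L \<ominus>\<^bsub>M\<^esub> x j \<in> mfilt j" for j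
  proof -
    have "?L \<ominus>\<^bsub>?F\<^esub> Y j \<in> T j"
      unfolding T_def using c L YF diff_free_module[OF R.is_cring L YF] by (auto intro!: F.M.minus_closed)
    then have "p (?L \<ominus>\<^bsub>?F\<^esub> Y j) \<in> mfilt j" by (rule ge)
    then show ?thesis using mod_hom_diff[OF FM module_axioms p L YF] pY by simp
  qed
  then show ?thesis using mod_homD(1)[OF p L] by blast
qed

end

context noetherian_module
begin

lemma funpow_mod_hom:
  assumes f: "f \<in> mod_hom R M M"
  shows "restrict (f ^^ n) (carrier M) \<in> mod_hom R M M"
proof -
  have c: "(f ^^ n) x \<in> carrier M" if "x \<in> carrier M" for x n
    by (induction n) (simp_all add: that mod_homD(1)[OF f])
  show ?thesis
  proof (rule mod_homI[OF module_axioms])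
    show "(f ^^ n) (x \<oplus>\<^bsub>M\<^esub> y) = (f ^^ n) x \<oplus>\<^bsub>M\<^esub> (f ^^ n) y" if "x \<in> carrier M" "y \<in> carrier M" for x y
      by (induction n) (simp_all add: c that mod_homD(2)[OF f])
    show "(f ^^ n) (a \<odot>\<^bsub>M\<^esub> x) = a \<odot>\<^bsub>M\<^esub> (f ^^ n) x" if "a \<in> carrier R" "x \<in> carrier M" for a x
      by (induction n) (simp_all add: c that mod_homD(3)[OF f])
  qed (rule c)
qed

text \<open>The kernels of the powers of \<open>f\<close> become constant from some \<open>n\<close>
  on. An x with f x = 0 is f^n y by surjectivity, so \<open>y\<close> is killed by the power n + 1,
  hence already by the power n, which means x = 0.\<close>

lemma surj_endo_bij:
  assumes f: "f \<in> mod_hom R M M" and onto: "f ` carrier M = carrier M"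
  shows "bij_betw f (carrier M) (carrier M)"
proof -
  define K where "K n = {x \<in> carrier M. restrict (f ^^ n) (carrier M) x = \<zero>\<^bsub>M\<^esub>}" for n
  have K: "submodule (K n) R M" for n
    unfolding K_def by (rule submodule_kernel[OF module_axioms module_axioms funpow_mod_hom[OF f]])
  have f0: "f \<zero>\<^bsub>M\<^esub> = \<zero>\<^bsub>M\<^esub>" by (rule mod_hom_zero[OF module_axioms module_axioms f])
  have "stationary K"
  proof (rule fin_gen_acc[unfolded stationary_between_def, THEN spec[of _ K], THEN mp],
      intro allI conjI)
    show "submodule (K n) R M" for n by (rule K)
    show "{\<zero>\<^bsub>M\<^esub>} \<subseteq> K n" "K n \<subseteq> carrier M" for n
      using submodule_zero_mem[OF K] submodule_mem[OF K] by auto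
    show "K n \<subseteq> K (Suc n)" for n
      unfolding K_def using f0 by auto
  qed
  then obtain n where "\<forall>k\<ge>n. K k = K n" unfolding stationary_def by blast
  then have KS: "K (Suc n) = K n" by (rule allE[of _ "Suc n"]) simp
  have pn: "\<exists>y\<in>carrier M. (f ^^ k) y = x" if "x \<in> carrier M" for x k
    using that
  proof (induction k arbitrary: x)
    case (Suc k)
    then obtain w where w: "w \<in> carrier M" "f w = x" using onto by (metis imageE)
    then show ?case using Suc.IH[of w] by auto
  qed simp
  have "x = \<zero>\<^bsub>M\<^esub>" if x: "x \<in> carrier M" "f x = \<zero>\<^bsub>M\<^esub>" for x
  proof -
    obtain y where y: "y \<in> carrier M" "(f ^^ n) y = x" using pn[OF x(1)] by blast
    then have "y \<in> K (Suc n)" using x unfolding K_def by simp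
    then have "y \<in> K n" by (simp only: KS)
    then show ?thesis using y unfolding K_def by simp
  qed
  then have zero: "x \<ominus>\<^bsub>M\<^esub> y = \<zero>\<^bsub>M\<^esub>" if "x \<in> carrier M" "y \<in> carrier M" "f x = f y" for x y
    using that mod_hom_diff[OF module_axioms module_axioms f] mod_homD(1)[OF f]
    by (simp add: a_minus_def M.r_neg)
  have "inj_on f (carrier M)"
  proof (rule inj_onI)
    fix x y assume xy: "x \<in> carrier M" "y \<in> carrier M" "f x = f y"
    have "x = (x \<ominus>\<^bsub>M\<^esub> y) \<oplus>\<^bsub>M\<^esub> y" using xy by (simp add: a_minus_def M.a_assoc M.l_neg)
    then show "x = y" using zero[OF xy] xy by simp
  qed
  then show ?thesis using onto unfolding bij_betw_def by blast
qed

end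

context local_module
begin

lemma mod_hom_mfilt:
  assumes f: "f \<in> mod_hom R M M"
  shows "x \<in> mfilt j \<Longrightarrow> f x \<in> mfilt j"
proof (induction j arbitrary: x)
  case 0
  then show ?case using mod_homD(1)[OF f] by simp
next
  case (Suc j)
  have "msub (mfilt j) \<subseteq> {x \<in> carrier M. f x \<in> mfilt (Suc j)}"
  proof (rule msub_least[OF submodule_vimage[OF module_axioms module_axioms f submodule_mfilt]])
    fix a y assume a: "a \<in> mm" and y: "y \<in> mfilt j"
    have c: "a \<in> carrier R" "y \<in> carrier M" using a y max.Icarr submodule_mem[OF submodule_mfilt] by auto
    show "a \<odot>\<^bsub>M\<^esub> y \<in> {x \<in> carrier M. f x \<in> mfilt (Suc j)}"
      using c smult_mem_msub[OF a Suc.IH[OF y]] mod_homD(3)[OF f c] by simp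
  qed
  then show ?case using Suc.prems by auto
qed

lemma nakayama_carrier:
  assumes H: "submodule H R M" and le: "carrier M \<subseteq> H <+>\<^bsub>M\<^esub> mfilt 1"
  shows "H = carrier M"
  using nakayama[OF H carrier_is_submodule] le submodule_mem[OF H] by auto

end

text \<open>Fitting's lemma modulo each step of the filtration: \<open>M\<close> is the sum of the submodules on
  which \<open>f\<close> is surjective, respectively nilpotent, modulo every step. Completeness passes from the
  decompositions modulo the steps to a decomposition of \<open>M\<close>.\<close>

lemma (in complete_local_module) indecomposable_endo_surj:
  assumes ind: "indecomposable R M" and f: "f \<in> mod_hom R M M"
  shows "f ` carrier M = carrier M \<or> (\<lambda>x. x \<ominus>\<^bsub>M\<^esub> f x) ` carrier M = carrier M"
proof -
  define g where "g n = restrict (f ^^ n) (carrier M)" for n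
  have g: "g n \<in> mod_hom R M M" for n unfolding g_def by (rule funpow_mod_hom[OF f])
  have gS: "g (Suc n) x = f (g n x)" "g (Suc n) x = g n (f x)" if "x \<in> carrier M" for n x
    using that mod_homD(1)[OF f] funpow_swap1[of f n x] by (simp_all add: g_def)
  have gadd: "g (n + m) x = g n (g m x)" if "x \<in> carrier M" for n m x
    using that mod_homD(1)[OF g[of m]] by (simp add: g_def funpow_add)
  have gi: "submodule (g n ` carrier M) R M" for n
    by (rule submodule_image[OF module_axioms module_axioms g carrier_is_submodule])
  \<comment> \<open>\<open>C j n\<close> and \<open>W j n\<close> are the preimages in
    \<open>M\<close> of the image and of the kernel of the n-th power of \<open>f\<close> on M/m^j
    M.\<close>
  define C where "C j n = g n ` carrier M <+>\<^bsub>M\<^esub> mfilt j" for j n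
  define W where "W j n = {x \<in> carrier M. g n x \<in> mfilt j}" for j n
  have C: "submodule (C j n) R M" for j n
    unfolding C_def by (rule submodule_sum[OF gi submodule_mfilt])
  have W: "submodule (W j n) R M" for j n
    unfolding W_def by (rule submodule_vimage[OF module_axioms module_axioms g submodule_mfilt])
  have gC: "g n x \<in> C j n" if "x \<in> carrier M" for n j x
    using sum_upper1[OF gi submodule_mfilt] that unfolding C_def by blast
  have mC: "mfilt j \<subseteq> C j n" for j n
    unfolding C_def by (rule sum_upper2[OF gi submodule_mfilt])
  have mW: "mfilt j \<subseteq> W j n" for j n
    unfolding W_def using mod_hom_mfilt[OF g] submodule_mem[OF submodule_mfilt] by blast
  have Cdec: "C j (Suc n) \<subseteq> C j n" for j n
    unfolding C_def by (rule sum_mono1) (use gS(2) mod_homD(1)[OF f] in auto)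
  have Winc: "W j n \<subseteq> W j (Suc n)" for j n
    unfolding W_def using gS(1) mod_hom_mfilt[OF f] by auto
  \<comment> \<open>Images stabilize by the descending chain condition modulo m^j M, kernels by the
    ascending one. The bound depends on \<open>j\<close>, so the stable values \<open>A j\<close>
    and \<open>B j\<close> are formed separately at every level.\<close>
  have "\<exists>n. (\<forall>k\<ge>n. C j k = C j n) \<and> (\<forall>k\<ge>n. W j k = W j n)" for j
  proof -
    have "stationary (C j)"
      using dcc_mfilt[of j, unfolded stationary_between_def, THEN spec[of _ "C j"]]
        C mC Cdec submodule_mem[OF C] by blast
    moreover have "stationary (W j)"
    proof (rule fin_gen_acc[unfolded stationary_between_def, THEN spec[of _ "W j"], THEN mp],
        intro allI conjI)
      show "submodule (W j n) R M" "W j n \<subseteq> W j (Suc n)" for n by (fact W Winc)+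
      show "{\<zero>\<^bsub>M\<^esub>} \<subseteq> W j n" "W j n \<subseteq> carrier M" for n
        using submodule_zero_mem[OF W] submodule_mem[OF W] by auto
    qed
    ultimately obtain a b where ab: "\<forall>k\<ge>a. C j k = C j a" "\<forall>k\<ge>b. W j k = W j b"
      unfolding stationary_def by blast
    have "C j k = C j (max a b)" "W j k = W j (max a b)" if "k \<ge> max a b" for k
      using ab(1)[rule_format, of k] ab(1)[rule_format, of "max a b"]
        ab(2)[rule_format, of k] ab(2)[rule_format, of "max a b"] that by simp_all
    then show ?thesis by (intro exI[of _ "max a b"]) blast
  qed
  then obtain n where n: "\<And>j k. k \<ge> n j \<Longrightarrow> C j k = C j (n j)" "\<And>j k. k \<ge> n j \<Longrightarrow> W j k = W j (n j)"
    by metis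
  define A where "A j = (\<Inter>k. C j k)" for j
  define B where "B j = (\<Union>k. W j k)" for j
  have Cle: "k \<le> l \<Longrightarrow> C j l \<subseteq> C j k" for j k l using lift_Suc_antimono_le[of "C j", OF Cdec] by blast
  have Wle: "k \<le> l \<Longrightarrow> W j k \<subseteq> W j l" for j k l using lift_Suc_mono_le[of "W j", OF Winc] by blast
  have Ain: "x \<in> A j" if "x \<in> C j (n j)" for x j
    unfolding A_def
  proof
    fix k
    show "x \<in> C j k"
      using that n(1)[of j "max k (n j)"] Cle[of k "max k (n j)" j] by auto
  qed
  have Bin: "x \<in> W j (n j)" if x: "x \<in> B j" for x j
  proof -
    obtain k where "x \<in> W j k" using x unfolding B_def by blast
    then show ?thesis using n(2)[of j "max k (n j)"] Wle[of k "max k (n j)" j] by auto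
  qed
  have A: "submodule (A j) R M" and B: "submodule (B j) R M" for j
    unfolding A_def B_def
    using submodule_INT[OF C] submodule_incseq_UN[of "W j"] W Winc by (auto simp: incseq_Suc_iff)
  have AM: "a \<in> carrier M" if "a \<in> A j" for a j using that submodule_mem[OF A] by blast
  have BM: "b \<in> carrier M" if "b \<in> B j" for b j using that submodule_mem[OF B] by blast
  have mA: "mfilt j \<subseteq> A j" and mB: "mfilt j \<subseteq> B j" for j
    using mC mW[of j 0] unfolding A_def B_def by blast+
  have "C (Suc j) k \<subseteq> C j k" for j k
    unfolding C_def subset_iff mem_sum_iff using mfilt_Suc_subset[of j] by blast
  then have Asub: "A (Suc j) \<subseteq> A j" for j unfolding A_def by blast
  have Bsub: "B (Suc j) \<subseteq> B j" for j
    unfolding B_def W_def using mfilt_Suc_subset[of j] by blast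
  \<comment> \<open>With n the stable exponent, f^n x agrees modulo m^j M with some f^(2n) y. So x -
    f^n y lies in the stable kernel, and f^n y in the stable image.\<close>
  have ex: "\<exists>a b. a \<in> A j \<and> b \<in> B j \<and> x = a \<oplus>\<^bsub>M\<^esub> b" if x: "x \<in> carrier M" for x j
  proof -
    let ?n = "n j"
    have "g ?n x \<in> C j (?n + ?n)" using gC[OF x, of ?n j] n(1)[of j "?n + ?n"] by simp
    then obtain y d where yd: "y \<in> carrier M" "d \<in> mfilt j" "g ?n x = g (?n + ?n) y \<oplus>\<^bsub>M\<^esub> d"
      unfolding C_def mem_sum_iff by blast
    let ?a = "g ?n y"
    have [simp]: "?a \<in> carrier M" "d \<in> carrier M" "g ?n x \<in> carrier M" "g ?n ?a \<in> carrier M"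
      using yd x mod_homD(1)[OF g] submodule_mem[OF submodule_mfilt] by auto
    have "g ?n (x \<ominus>\<^bsub>M\<^esub> ?a) = g ?n x \<ominus>\<^bsub>M\<^esub> g ?n ?a"
      by (rule mod_hom_diff[OF module_axioms module_axioms g x]) simp
    also have "\<dots> = (g ?n ?a \<oplus>\<^bsub>M\<^esub> d) \<ominus>\<^bsub>M\<^esub> g ?n ?a"
      using yd gadd[OF yd(1)] by simp
    also have "\<dots> = d" by (simp add: a_minus_def M.a_ac M.r_neg1 M.r_neg M.r_neg2 M.a_cancel)
    finally have "x \<ominus>\<^bsub>M\<^esub> ?a \<in> B j" using yd x unfolding B_def W_def by auto
    moreover have "?a \<in> A j" using Ain gC yd(1) by blast
    moreover have "x = ?a \<oplus>\<^bsub>M\<^esub> (x \<ominus>\<^bsub>M\<^esub> ?a)" using x by (simp add: a_minus_def M.a_ac M.r_neg1 M.r_neg M.r_neg2 M.a_cancel)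
    ultimately show ?thesis by blast
  qed
  \<comment> \<open>If z is f^n y modulo m^j M and f^n kills \<open>z\<close> there, then f^(2n)
    kills \<open>y\<close>, hence f^n does by stability, and \<open>z\<close> is zero modulo m^j
    M.\<close>
  have AB: "z \<in> mfilt j" if z: "z \<in> A j" "z \<in> B j" for z j
  proof -
    let ?n = "n j"
    have "z \<in> C j ?n" using z(1) unfolding A_def by blast
    then obtain y d where yd: "y \<in> carrier M" "d \<in> mfilt j" "z = g ?n y \<oplus>\<^bsub>M\<^esub> d"
      unfolding C_def mem_sum_iff by blast
    have d: "d \<in> carrier M" using yd submodule_mem[OF submodule_mfilt] by blast
    have gy: "g ?n y \<in> carrier M" using mod_homD(1)[OF g yd(1)] .
    have "g ?n z \<in> mfilt j" using Bin[OF z(2)] unfolding W_def by blast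
    then have "g ?n (g ?n y) \<oplus>\<^bsub>M\<^esub> g ?n d \<in> mfilt j" using yd mod_homD(2)[OF g gy d] by simp
    then have "g ?n (g ?n y) \<in> mfilt j"
      using submodule_add_cancel[OF submodule_mfilt] mod_homD(1)[OF g gy] mod_hom_mfilt[OF g yd(2)] by blast
    then have "y \<in> W j (?n + ?n)" unfolding W_def using yd gadd by simp
    then have "y \<in> W j ?n" using n(2)[of j "?n + ?n"] by simp
    then show ?thesis using yd submoduleE(5)[OF submodule_mfilt] unfolding W_def by blast
  qed
  let ?A = "\<Inter>j. A j" and ?B = "\<Inter>j. B j"
  have sA: "submodule ?A R M" and sB: "submodule ?B R M" using submodule_INT A B by auto
  have "?A \<inter> ?B = {\<zero>\<^bsub>M\<^esub>}"
  proof -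
    have "?A \<inter> ?B \<subseteq> (\<Inter>j. mfilt j)" using AB by blast
    then have "?A \<inter> ?B \<subseteq> {\<zero>\<^bsub>M\<^esub>}" by (simp only: krull_intersection)
    then show ?thesis
      by (rule subset_antisym)
         (use IntI[OF submodule_zero_mem[OF sA] submodule_zero_mem[OF sB]] in simp)
  qed
  moreover have AB_sum: "?A <+>\<^bsub>M\<^esub> ?B = carrier M"
  proof
    show "?A <+>\<^bsub>M\<^esub> ?B \<subseteq> carrier M" using submodule_mem[OF submodule_sum[OF sA sB]] by blast
    show "carrier M \<subseteq> ?A <+>\<^bsub>M\<^esub> ?B"
    proof
      fix x assume x: "x \<in> carrier M"
      have "\<forall>j. \<exists>a b. a \<in> A j \<and> b \<in> B j \<and> x = a \<oplus>\<^bsub>M\<^esub> b" using ex[OF x] by blast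
      then obtain a b where ab: "\<And>j. a j \<in> A j" "\<And>j. b j \<in> B j" "\<And>j. x = a j \<oplus>\<^bsub>M\<^esub> b j" by metis
      have aM: "a j \<in> carrier M" and bM: "b j \<in> carrier M" for j using ab AM BM by blast+
      \<comment> \<open>This trades a difference of first components for one of second components.
        For \<open>u = a (Suc j)\<close> the step a_(j+1) - a_j equals b_j - b_(j+1); it therefore
        lies in both \<open>A j\<close> and \<open>B j\<close>, so in m^j M, and the first
        components form a Cauchy sequence.\<close>
      have swap: "u \<ominus>\<^bsub>M\<^esub> a j = b j \<ominus>\<^bsub>M\<^esub> (x \<ominus>\<^bsub>M\<^esub> u)" if u: "u \<in> carrier M" for u j
      proof -
        have "b j \<ominus>\<^bsub>M\<^esub> ((a j \<oplus>\<^bsub>M\<^esub> b j) \<ominus>\<^bsub>M\<^esub> u) = u \<ominus>\<^bsub>M\<^esub> a j"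
          using u aM bM
          by (simp add: a_minus_def M.minus_add M.a_ac M.r_neg1 M.r_neg M.r_neg2 M.a_cancel M.l_neg)
        then show ?thesis by (simp only: ab(3)[of j, symmetric])
      qed
      have xa: "x \<ominus>\<^bsub>M\<^esub> a j = b j" for j
      proof -
        have "(a j \<oplus>\<^bsub>M\<^esub> b j) \<ominus>\<^bsub>M\<^esub> a j = b j"
          using aM bM by (simp add: a_minus_def M.a_ac M.r_neg1 M.r_neg M.r_neg2 M.a_cancel)
        then show ?thesis by (simp only: ab(3)[of j, symmetric])
      qed
      have "a (Suc j) \<ominus>\<^bsub>M\<^esub> a j \<in> mfilt j" for j
      proof (rule AB)
        show "a (Suc j) \<ominus>\<^bsub>M\<^esub> a j \<in> A j" using submodule_minus_mem[OF A] ab(1) Asub by blast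
        show "a (Suc j) \<ominus>\<^bsub>M\<^esub> a j \<in> B j"
          unfolding swap[OF aM] xa using submodule_minus_mem[OF B] ab(2) Bsub by blast
      qed
      then obtain l where l: "l \<in> carrier M" "\<And>j. l \<ominus>\<^bsub>M\<^esub> a j \<in> mfilt j"
        using mfilt_complete[of a] aM by blast
      have "l = (l \<ominus>\<^bsub>M\<^esub> a j) \<oplus>\<^bsub>M\<^esub> a j" for j using l(1) aM by (simp add: a_minus_def M.a_assoc M.l_neg)
      then have "l \<in> A j" for j using submoduleE(5)[OF A] l(2) mA ab(1) by (metis subsetD)
      moreover have "x \<ominus>\<^bsub>M\<^esub> l \<in> B j" for j
      proof -
        have "b j \<ominus>\<^bsub>M\<^esub> (l \<ominus>\<^bsub>M\<^esub> a j) = b j \<ominus>\<^bsub>M\<^esub> (b j \<ominus>\<^bsub>M\<^esub> (x \<ominus>\<^bsub>M\<^esub> l))" using swap[OF l(1)] by simp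
        also have "\<dots> = x \<ominus>\<^bsub>M\<^esub> l"
          using x l(1) bM by (simp add: a_minus_def M.minus_add M.a_ac M.r_neg1 M.r_neg M.r_neg2 M.a_cancel)
        finally show ?thesis using submodule_minus_mem[OF B] ab(2) l(2) mB by (metis subsetD)
      qed
      moreover have "x = l \<oplus>\<^bsub>M\<^esub> (x \<ominus>\<^bsub>M\<^esub> l)" using x l by (simp add: a_minus_def M.a_ac M.r_neg1 M.r_neg M.r_neg2 M.a_cancel)
      ultimately show "x \<in> ?A <+>\<^bsub>M\<^esub> ?B" unfolding mem_sum_iff by blast
    qed
  qed
  ultimately have "?A = {\<zero>\<^bsub>M\<^esub>} \<or> ?B = {\<zero>\<^bsub>M\<^esub>}"
    using ind sA sB unfolding indecomposable_def by blast
  then show ?thesis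
  proof
    \<comment> \<open>Here all of \<open>M\<close> is in \<open>B 1\<close>, so \<open>f\<close> is
      nilpotent modulo m M. The telescoping fact \<open>tel\<close> puts every x - f^k x into the
      image of 1 - f, which is therefore everything modulo m M, and Nakayama's lemma
      applies.\<close>
    assume "?A = {\<zero>\<^bsub>M\<^esub>}"
    then have "?A \<subseteq> ?B" using submodule_zero_mem[OF sB] by (simp only: insert_subset empty_subsetI simp_thms)
    then have "carrier M \<subseteq> ?B" using sum_least[OF sB _ subset_refl] AB_sum by metis
    then have nil: "g (n 1) x \<in> mfilt 1" if "x \<in> carrier M" for x
      using that Bin[of x 1] unfolding W_def by blast
    let ?h = "\<lambda>x. x \<ominus>\<^bsub>M\<^esub> f x"
    have fc: "f x \<in> carrier M" if "x \<in> carrier M" for x using mod_homD(1)[OF f that] .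
    have h: "restrict ?h (carrier M) \<in> mod_hom R M M"
      by (rule mod_homI[OF module_axioms])
         (auto simp: fc mod_homD(2,3)[OF f] a_minus_def M.minus_add M.a_ac smult_r_distr smult_r_minus)
    have H: "submodule (?h ` carrier M) R M"
      using submodule_image[OF module_axioms module_axioms h carrier_is_submodule] by simp
    have tel: "x \<ominus>\<^bsub>M\<^esub> g k x \<in> ?h ` carrier M" if x: "x \<in> carrier M" for x k
    proof (induction k)
      case 0
      have "x \<ominus>\<^bsub>M\<^esub> g 0 x = \<zero>\<^bsub>M\<^esub>" using x by (simp add: g_def a_minus_def M.r_neg)
      then show ?case using submodule_zero_mem[OF H] by simp
    next
      case (Suc k)
      have gk: "g k x \<in> carrier M" using mod_homD(1)[OF g x] .
      have "x \<ominus>\<^bsub>M\<^esub> g (Suc k) x = (x \<ominus>\<^bsub>M\<^esub> g k x) \<oplus>\<^bsub>M\<^esub> ?h (g k x)"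
        using x gk fc[OF gk] by (simp add: gS(1) a_minus_def M.a_ac M.r_neg1 M.r_neg M.r_neg2 M.a_cancel)
      then show ?case using submoduleE(5)[OF H Suc.IH imageI[OF gk]] by simp
    qed
    have "x \<in> ?h ` carrier M <+>\<^bsub>M\<^esub> mfilt 1" if x: "x \<in> carrier M" for x
    proof -
      have "x = (x \<ominus>\<^bsub>M\<^esub> g (n 1) x) \<oplus>\<^bsub>M\<^esub> g (n 1) x"
        using x mod_homD(1)[OF g x] by (simp add: a_minus_def M.a_assoc M.l_neg)
      then show ?thesis using tel[OF x] nil[OF x] unfolding mem_sum_iff by blast
    qed
    then show ?thesis using nakayama_carrier[OF H] by blast
  next
    \<comment> \<open>Now all of \<open>M\<close> is in \<open>A 1\<close>, hence in
      \<open>C 1 1\<close>: already the first power of \<open>f\<close> is onto modulo m M.\<close>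
    assume "?B = {\<zero>\<^bsub>M\<^esub>}"
    then have "?B \<subseteq> ?A" using submodule_zero_mem[OF sA] by (simp only: insert_subset empty_subsetI simp_thms)
    then have "carrier M \<subseteq> ?A" using sum_least[OF sA subset_refl] AB_sum by metis
    then have "carrier M \<subseteq> C 1 1" unfolding A_def by blast
    moreover have "g 1 ` carrier M = f ` carrier M" by (simp add: g_def)
    ultimately have "f ` carrier M = carrier M"
      using nakayama_carrier[OF submodule_image[OF module_axioms module_axioms f carrier_is_submodule]]
      unfolding C_def by simp
    then show ?thesis ..
  qed
qed

section \<open>Vanishing of Ext and closure properties of the category\<close>

lemma FactGroup_trivial_iff:
  fixes G (structure)
  assumes "comm_group G" and H: "subgroup H G"
  shows "trivial_group (G Mod H) \<longleftrightarrow> carrier G \<subseteq> H"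
proof -
  interpret comm_group G by fact
  have N: "H \<lhd> G" using H by (simp add: normal_iff_subgroup)
  have "carrier (G Mod H) = {\<one>\<^bsub>G Mod H\<^esub>} \<longleftrightarrow> (\<forall>a\<in>carrier G. H #> a = H)"
    using subgroup.rcosets_carrier[OF H] by (auto simp: FactGroup_def RCOSETS_def)
  also have "\<dots> \<longleftrightarrow> carrier G \<subseteq> H"
    using coset_join1[OF _ _ H] coset_join2[OF _ H] subgroup.subset[OF H] by blast
  finally show ?thesis
    using normal.factorgroup_is_group[OF N] by (simp add: trivial_group_def)
qed

context
  fixes R :: "'a ring" (structure)
begin

lemma hom_group_comm_group:
  assumes M: "module R M" and N: "module R N"
  shows "comm_group (hom_group R M N)"
proof -
  interpret M: module R M by fact
  interpret N: module R N by fact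
  have closed: "(\<lambda>x\<in>carrier M. f x \<oplus>\<^bsub>N\<^esub> g x) \<in> mod_hom R M N"
    if "f \<in> mod_hom R M N" "g \<in> mod_hom R M N" for f g
    by (rule mod_homI[OF M])
       (simp_all add: mod_homD[OF that(1)] mod_homD[OF that(2)] N.M.a_ac N.smult_r_distr)
  have zero: "(\<lambda>x\<in>carrier M. \<zero>\<^bsub>N\<^esub>) \<in> mod_hom R M N"
    by (rule mod_homI[OF M]) simp_all
  show ?thesis
  proof (rule comm_groupI)
    fix f assume "f \<in> carrier (hom_group R M N)"
    then have f: "f \<in> mod_hom R M N" by (simp add: hom_group_def)
    have "(\<lambda>x\<in>carrier M. \<ominus>\<^bsub>N\<^esub> f x) \<in> mod_hom R M N"
      by (rule mod_homI[OF M]) (simp_all add: mod_homD[OF f] N.M.minus_add N.M.a_comm N.smult_r_minus)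
    then show "\<exists>g\<in>carrier (hom_group R M N).
        g \<otimes>\<^bsub>hom_group R M N\<^esub> f = \<one>\<^bsub>hom_group R M N\<^esub>"
      by (intro bexI[of _ "\<lambda>x\<in>carrier M. \<ominus>\<^bsub>N\<^esub> f x"])
         (auto simp: hom_group_def mod_homD[OF f] N.M.l_neg intro!: restrict_ext)
  next
    fix f assume "f \<in> carrier (hom_group R M N)"
    then have f: "f \<in> mod_hom R M N" by (simp add: hom_group_def)
    show "\<one>\<^bsub>hom_group R M N\<^esub> \<otimes>\<^bsub>hom_group R M N\<^esub> f = f"
      using mod_homD[OF f] by (auto simp: hom_group_def extensional_def)
  next
    fix f g h
    assume "f \<in> carrier (hom_group R M N)" "g \<in> carrier (hom_group R M N)" "h \<in> carrier (hom_group R M N)"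
    then have "f \<in> mod_hom R M N" "g \<in> mod_hom R M N" "h \<in> mod_hom R M N" by (simp_all add: hom_group_def)
    then show "f \<otimes>\<^bsub>hom_group R M N\<^esub> g \<otimes>\<^bsub>hom_group R M N\<^esub> h =
        f \<otimes>\<^bsub>hom_group R M N\<^esub> (g \<otimes>\<^bsub>hom_group R M N\<^esub> h)"
      by (auto simp: hom_group_def N.M.a_assoc mod_homD(1) intro!: restrict_ext)
  next
    fix f g
    assume "f \<in> carrier (hom_group R M N)" "g \<in> carrier (hom_group R M N)"
    then have "f \<in> mod_hom R M N" "g \<in> mod_hom R M N" by (simp_all add: hom_group_def)
    then show "f \<otimes>\<^bsub>hom_group R M N\<^esub> g = g \<otimes>\<^bsub>hom_group R M N\<^esub> f"
      by (auto simp: hom_group_def N.M.a_comm mod_homD(1) intro!: restrict_ext)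
  qed (simp_all add: hom_group_def closed zero)
qed

lemma hom_group_simps:
  shows "carrier (hom_group R M N) = mod_hom R M N"
    and "f \<otimes>\<^bsub>hom_group R M N\<^esub> g = (\<lambda>x\<in>carrier M. f x \<oplus>\<^bsub>N\<^esub> g x)"
    and "\<one>\<^bsub>hom_group R M N\<^esub> = (\<lambda>x\<in>carrier M. \<zero>\<^bsub>N\<^esub>)"
  by (simp_all add: hom_group_def)

lemma hom_group_inv:
  assumes M: "module R M" and N: "module R N" and f: "f \<in> mod_hom R M N"
  shows "inv\<^bsub>hom_group R M N\<^esub> f = (\<lambda>x\<in>carrier M. \<ominus>\<^bsub>N\<^esub> f x)"
proof -
  interpret N: module R N by fact
  interpret H: comm_group "hom_group R M N" by (rule hom_group_comm_group[OF M N])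
  have "(\<lambda>x\<in>carrier M. \<ominus>\<^bsub>N\<^esub> f x) \<in> mod_hom R M N"
    by (rule mod_homI[OF M]) (simp_all add: mod_homD[OF f] N.M.minus_add N.M.a_comm N.smult_r_minus)
  then show ?thesis
    by (intro H.inv_equality) (auto simp: hom_group_simps f mod_homD[OF f] N.M.l_neg intro!: restrict_ext)
qed

text \<open>Vanishing of the i-th cohomology of Hom(-, M) on the complex, tested on elements so that
  neither quotient groups nor restricted composites occur. In degree 0 there are no coboundaries
  except zero.\<close>

definition exact_at ::
    "(nat \<Rightarrow> nat) \<Rightarrow> (nat \<Rightarrow> (nat \<Rightarrow> 'a) \<Rightarrow> (nat \<Rightarrow> 'a)) \<Rightarrow> ('a, 'm) module \<Rightarrow> nat \<Rightarrow> bool" where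
  "exact_at r d M i \<longleftrightarrow> (\<forall>f\<in>mod_hom R (free_module R (r i)) M.
     (\<forall>z\<in>carrier (free_module R (r (Suc i))). f (d i z) = \<zero>\<^bsub>M\<^esub>) \<longrightarrow>
     (case i of 0 \<Rightarrow> \<forall>z\<in>carrier (free_module R (r 0)). f z = \<zero>\<^bsub>M\<^esub>
      | Suc j \<Rightarrow> \<exists>g\<in>mod_hom R (free_module R (r j)) M.
          \<forall>z\<in>carrier (free_module R (r (Suc j))). f z = g (d j z)))"

lemma free_resolutionD:
  assumes "free_resolution R K r d e"
  shows "e \<in> mod_hom R (free_module R (r 0)) K"
    and "d i \<in> mod_hom R (free_module R (r (Suc i))) (free_module R (r i))"
    and "e ` carrier (free_module R (r 0)) = carrier K"
    and "{x \<in> carrier (free_module R (r 0)). e x = \<zero>\<^bsub>K\<^esub>} = d 0 ` carrier (free_module R (r 1))"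
    and "{x \<in> carrier (free_module R (r (Suc i))). d i x = \<zero>\<^bsub>free_module R (r i)\<^esub>}
        = d (Suc i) ` carrier (free_module R (r (Suc (Suc i))))"
  using assms unfolding free_resolution_def by blast+

lemma free_resolution_dd:
  assumes "free_resolution R K r d e" "z \<in> carrier (free_module R (r (Suc (Suc i))))"
  shows "d i (d (Suc i) z) = \<zero>\<^bsub>free_module R (r i)\<^esub>"
  using free_resolutionD(5)[OF assms(1), of i] assms(2) by blast

lemma compose_eq_iff:
  assumes "f \<in> extensional A"
  shows "f = compose A g h \<longleftrightarrow> (\<forall>z\<in>A. f z = g (h z))"
proof
  assume "\<forall>z\<in>A. f z = g (h z)"
  then show "f = compose A g h"
    unfolding compose_def by (intro extensionalityI[OF assms restrict_extensional]) simp
qed (simp add: compose_eq)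

lemma cocycles_iff:
  "f \<in> cocycles R r d M i \<longleftrightarrow> f \<in> mod_hom R (free_module R (r i)) M \<and>
     (\<forall>z\<in>carrier (free_module R (r (Suc i))). f (d i z) = \<zero>\<^bsub>M\<^esub>)"
  unfolding cocycles_def hom_group_simps
  by (auto simp: compose_def fun_eq_iff split: if_splits)

lemma cocycles_subset_coboundaries_iff:
  "cocycles R r d M i \<subseteq> coboundaries R r d M i \<longleftrightarrow> exact_at r d M i"
proof (cases i)
  case 0
  have "f = (\<lambda>x\<in>carrier (free_module R (r 0)). \<zero>\<^bsub>M\<^esub>) \<longleftrightarrow>
      (\<forall>z\<in>carrier (free_module R (r 0)). f z = \<zero>\<^bsub>M\<^esub>)"
    if f: "f \<in> mod_hom R (free_module R (r 0)) M" for f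
  proof
    assume "\<forall>z\<in>carrier (free_module R (r 0)). f z = \<zero>\<^bsub>M\<^esub>"
    then show "f = (\<lambda>x\<in>carrier (free_module R (r 0)). \<zero>\<^bsub>M\<^esub>)"
      by (intro extensionalityI[OF mod_homD(4)[OF f] restrict_extensional]) simp
  qed simp
  then show ?thesis
    unfolding exact_at_def subset_iff cocycles_iff coboundaries_def hom_group_simps 0 by auto
next
  case (Suc j)
  have "f \<in> (\<lambda>g. compose (carrier (free_module R (r (Suc j)))) g (d j)) ` mod_hom R (free_module R (r j)) M
      \<longleftrightarrow> (\<exists>g\<in>mod_hom R (free_module R (r j)) M. \<forall>z\<in>carrier (free_module R (r (Suc j))). f z = g (d j z))"
    if "f \<in> mod_hom R (free_module R (r (Suc j))) M" for f
    unfolding image_iff compose_eq_iff[OF mod_homD(4)[OF that]] ..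
  then show ?thesis
    unfolding exact_at_def subset_iff cocycles_iff coboundaries_def Suc by auto
qed

text \<open>The resolution picked by \<open>SOME\<close> depends on \<open>K\<close> and not on
  \<open>M\<close>, so Ext into different modules may be compared on the same cochains.\<close>

lemma trivial_Ext_iff:
  fixes M :: "('a, 'm) module" and K :: "('a, 'k) module"
  assumes R: "cring R" and M: "module R M" and K: "\<exists>r d e. free_resolution R K r d e"
    and res: "(SOME (r, d, e). free_resolution R K r d e) = (r, d, e)"
  shows "trivial_group (Ext R K M i) \<longleftrightarrow> exact_at r d M i"
proof -
  have "case (SOME (r, d, e). free_resolution R K r d e) of (r, d, e) \<Rightarrow> free_resolution R K r d e"
    using K by (intro someI_ex[of "\<lambda>(r, d, e). free_resolution R K r d e"]) auto
  then have FR: "free_resolution R K r d e" unfolding res by simp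
  let ?F = "\<lambda>i. free_module R (r i)"
  note FM = module_free_module[OF R]
  interpret M: module R M by fact
  let ?H = "hom_group R (?F i) M"
  interpret H: comm_group ?H by (rule hom_group_comm_group[OF FM M])
  have Z: "subgroup (cocycles R r d M i) ?H"
  proof (rule H.subgroupI)
    note dh = mod_homD(1)[OF free_resolutionD(2)[OF FR]]
    show "cocycles R r d M i \<subseteq> carrier ?H" by (auto simp: cocycles_iff hom_group_simps)
    have "(\<lambda>x\<in>carrier (?F i). \<zero>\<^bsub>M\<^esub>) \<in> cocycles R r d M i"
      using H.one_closed dh unfolding cocycles_iff hom_group_simps by simp
    then show "cocycles R r d M i \<noteq> {}" by blast
    show "inv\<^bsub>?H\<^esub> f \<in> cocycles R r d M i" if f: "f \<in> cocycles R r d M i" for f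
    proof -
      have fh: "f \<in> mod_hom R (?F i) M" using f by (simp add: cocycles_iff)
      have "inv\<^bsub>?H\<^esub> f \<in> mod_hom R (?F i) M" using H.inv_closed[of f] fh by (simp add: hom_group_simps)
      then show ?thesis
        using f dh hom_group_inv[OF FM M fh] by (simp add: cocycles_iff)
    qed
    show "f \<otimes>\<^bsub>?H\<^esub> g \<in> cocycles R r d M i" if "f \<in> cocycles R r d M i" "g \<in> cocycles R r d M i" for f g
    proof -
      have "f \<otimes>\<^bsub>?H\<^esub> g \<in> mod_hom R (?F i) M"
        using H.m_closed[of f g] that by (simp add: hom_group_simps(1) cocycles_iff)
      then show ?thesis
        using that dh by (simp add: cocycles_iff hom_group_simps)
    qed
  qed
  let ?G = "?H\<lparr>carrier := cocycles R r d M i\<rparr>"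
  have G: "comm_group ?G" 
    by (rule group.group_comm_groupI[OF H.subgroup_imp_group[OF Z]])
       (use subgroup.subset[OF Z] H.m_comm in auto)
  have B: "subgroup (coboundaries R r d M i) ?G"
  proof -
    have "subgroup (coboundaries R r d M i) ?H"
    proof (cases i)
      case 0
      then show ?thesis unfolding coboundaries_def using H.triv_subgroup by simp
    next
      case (Suc j)
      interpret Hj: comm_group "hom_group R (?F j) M" by (rule hom_group_comm_group[OF FM M])
      let ?c = "\<lambda>g. compose (carrier (?F (Suc j))) g (d j)"
      note dj = free_resolutionD(2)[OF FR, of j]
      have "group_hom (hom_group R (?F j) M) ?H ?c"
      proof (rule group_hom.intro)
        show "group_hom_axioms (hom_group R (?F j) M) ?H ?c"
          unfolding group_hom_axioms_def hom_def hom_group_simps Suc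
          using mod_hom_compose[OF FM dj] mod_homD(1)[OF dj]
          by (auto simp: compose_def intro!: restrict_ext)
      qed unfold_locales
      then have "subgroup (?c ` carrier (hom_group R (?F j) M)) ?H"
        by (rule group_hom.img_is_subgroup)
      then show ?thesis unfolding coboundaries_def Suc by (simp add: hom_group_simps)
    qed
    moreover have "coboundaries R r d M i \<subseteq> cocycles R r d M i"
    proof (cases i)
      case 0
      then show ?thesis
        unfolding coboundaries_def using H.one_closed mod_homD(1)[OF free_resolutionD(2)[OF FR]]
        by (simp add: cocycles_iff hom_group_simps)
    next
      case (Suc j)
      note dj = free_resolutionD(2)[OF FR]
      have "compose (carrier (?F (Suc j))) g (d j) \<in> cocycles R r d M (Suc j)"
        if g: "g \<in> mod_hom R (?F j) M" for g
        unfolding cocycles_iff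
        using mod_hom_compose[OF FM dj g] mod_homD(1)[OF dj] mod_hom_zero[OF FM M g]
          free_resolution_dd[OF FR, of _ j]
        by (auto simp: compose_eq)
      then show ?thesis unfolding coboundaries_def Suc by auto
    qed
    ultimately show ?thesis by (rule H.subgroup_incl[OF _ Z])
  qed
  have "Ext R K M i = ?G Mod coboundaries R r d M i" unfolding Ext_def res by simp
  then show "trivial_group (Ext R K M i) \<longleftrightarrow> exact_at r d M i"
    using FactGroup_trivial_iff[OF G B] cocycles_subset_coboundaries_iff by simp
qed

subsection \<open>Products, kernels, isomorphisms\<close>

definition mod_prod :: "('a, 'm) module \<Rightarrow> ('a, 'n) module \<Rightarrow> ('a, 'm \<times> 'n) module" where
  "mod_prod M N = \<lparr>carrier = carrier M \<times> carrier N, monoid.mult = undefined, one = undefined,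
     ring.zero = (\<zero>\<^bsub>M\<^esub>, \<zero>\<^bsub>N\<^esub>), add = (\<lambda>x y. (fst x \<oplus>\<^bsub>M\<^esub> fst y, snd x \<oplus>\<^bsub>N\<^esub> snd y)),
     smult = (\<lambda>a x. (a \<odot>\<^bsub>M\<^esub> fst x, a \<odot>\<^bsub>N\<^esub> snd x))\<rparr>"

lemma mod_prod_simps [simp]:
  shows "carrier (mod_prod M N) = carrier M \<times> carrier N"
    and "\<zero>\<^bsub>mod_prod M N\<^esub> = (\<zero>\<^bsub>M\<^esub>, \<zero>\<^bsub>N\<^esub>)"
    and "x \<oplus>\<^bsub>mod_prod M N\<^esub> y = (fst x \<oplus>\<^bsub>M\<^esub> fst y, snd x \<oplus>\<^bsub>N\<^esub> snd y)"
    and "a \<odot>\<^bsub>mod_prod M N\<^esub> x = (a \<odot>\<^bsub>M\<^esub> fst x, a \<odot>\<^bsub>N\<^esub> snd x)"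
  by (simp_all add: mod_prod_def)

lemma module_mod_prod:
  assumes M: "module R M" and N: "module R N"
  shows "module R (mod_prod M N)"
proof -
  interpret M: module R M by fact
  interpret N: module R N by fact
  show ?thesis
  proof (rule moduleI[OF M.R.is_cring])
    show "abelian_group (mod_prod M N)"
    proof (rule abelian_groupI)
      fix x assume "x \<in> carrier (mod_prod M N)"
      then show "\<exists>y\<in>carrier (mod_prod M N). y \<oplus>\<^bsub>mod_prod M N\<^esub> x = \<zero>\<^bsub>mod_prod M N\<^esub>"
        by (intro bexI[of _ "(\<ominus>\<^bsub>M\<^esub> fst x, \<ominus>\<^bsub>N\<^esub> snd x)"]) (auto simp: M.M.l_neg N.M.l_neg)
    qed (auto simp: M.M.a_ac N.M.a_ac)
  qed (auto simp: M.smult_l_distr N.smult_l_distr M.smult_r_distr N.smult_r_distr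
         M.smult_assoc1 N.smult_assoc1)
qed

lemma mod_prod_projections:
  assumes M: "module R M" and N: "module R N"
  shows "restrict fst (carrier M \<times> carrier N) \<in> mod_hom R (mod_prod M N) M"
    and "restrict snd (carrier M \<times> carrier N) \<in> mod_hom R (mod_prod M N) N"
  using mod_homI[OF module_mod_prod[OF M N], of fst M] mod_homI[OF module_mod_prod[OF M N], of snd N]
  by auto

lemma mod_prod_pairing:
  assumes L: "module R L" and f: "f \<in> mod_hom R L M" and g: "g \<in> mod_hom R L N"
  shows "(\<lambda>x\<in>carrier L. (f x, g x)) \<in> mod_hom R L (mod_prod M N)"
  by (rule mod_homI[OF L]) (simp_all add: mod_homD[OF f] mod_homD[OF g])

lemma fin_gen_mod_prod:
  assumes M: "module R M" "fin_gen R M" and N: "module R N" "fin_gen R N"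
  shows "fin_gen R (mod_prod M N)"
proof -
  interpret M: module R M by fact
  interpret N: module R N by fact
  note P = module_mod_prod[OF M(1) N(1)]
  interpret P: module R "mod_prod M N" by (rule P)
  obtain S where S: "finite S" "S \<subseteq> carrier M" "\<forall>H. submodule H R M \<and> S \<subseteq> H \<longrightarrow> H = carrier M"
    using M(2) unfolding fin_gen_def by blast
  obtain T where T: "finite T" "T \<subseteq> carrier N" "\<forall>H. submodule H R N \<and> T \<subseteq> H \<longrightarrow> H = carrier N"
    using N(2) unfolding fin_gen_def by blast
  have inl: "(\<lambda>x\<in>carrier M. (x, \<zero>\<^bsub>N\<^esub>)) \<in> mod_hom R M (mod_prod M N)"
    by (rule mod_homI[OF M(1)]) auto
  have inr: "(\<lambda>x\<in>carrier N. (\<zero>\<^bsub>M\<^esub>, x)) \<in> mod_hom R N (mod_prod M N)"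
    by (rule mod_homI[OF N(1)]) auto
  have "H = carrier (mod_prod M N)"
    if H: "submodule H R (mod_prod M N)" "(\<lambda>x. (x, \<zero>\<^bsub>N\<^esub>)) ` S \<union> (\<lambda>x. (\<zero>\<^bsub>M\<^esub>, x)) ` T \<subseteq> H" for H
  proof -
    have 1: "{x \<in> carrier M. (\<lambda>x\<in>carrier M. (x, \<zero>\<^bsub>N\<^esub>)) x \<in> H} = carrier M"
      using S(3) submodule_vimage[OF M(1) P inl H(1)] S(2) H(2)
      by (intro S(3)[rule_format] conjI) auto
    have 2: "{x \<in> carrier N. (\<lambda>x\<in>carrier N. (\<zero>\<^bsub>M\<^esub>, x)) x \<in> H} = carrier N"
      using T(3) submodule_vimage[OF N(1) P inr H(1)] T(2) H(2)
      by (intro T(3)[rule_format] conjI) auto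
    have "(x, y) \<in> H" if "x \<in> carrier M" "y \<in> carrier N" for x y
    proof -
      have "(x, \<zero>\<^bsub>N\<^esub>) \<in> H" using that(1) 1 by (metis (no_types, lifting) mem_Collect_eq restrict_apply')
      moreover have "(\<zero>\<^bsub>M\<^esub>, y) \<in> H" using that(2) 2 by (metis (no_types, lifting) mem_Collect_eq restrict_apply')
      ultimately have "(x, \<zero>\<^bsub>N\<^esub>) \<oplus>\<^bsub>mod_prod M N\<^esub> (\<zero>\<^bsub>M\<^esub>, y) \<in> H" by (rule P.submoduleE(5)[OF H(1)])
      then show ?thesis using that by simp
    qed
    then show ?thesis using P.submoduleE(1)[OF H(1)] by auto
  qed
  then show ?thesis
    unfolding fin_gen_def using S(1,2) T(1,2)
    by (intro exI[of _ "(\<lambda>x. (x, \<zero>\<^bsub>N\<^esub>)) ` S \<union> (\<lambda>x. (\<zero>\<^bsub>M\<^esub>, x)) ` T"]) auto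
qed

lemma exact_at_mod_prod:
  assumes M: "module R M" and N: "module R N" and ex: "exact_at r d M i" "exact_at r d N i"
    and d: "\<And>i. d i \<in> mod_hom R (free_module R (r (Suc i))) (free_module R (r i))"
  shows "exact_at r d (mod_prod M N) i"
  unfolding exact_at_def
proof (intro ballI impI)
  let ?F = "\<lambda>i. free_module R (r i)"
  have FM: "module R (?F k)" for k using module_free_module cring_of_module[OF M] by blast
  fix f assume f: "f \<in> mod_hom R (?F i) (mod_prod M N)"
    and z: "\<forall>z\<in>carrier (?F (Suc i)). f (d i z) = \<zero>\<^bsub>mod_prod M N\<^esub>"
  define f1 where "f1 = compose (carrier (?F i)) (restrict fst (carrier M \<times> carrier N)) f"
  define f2 where "f2 = compose (carrier (?F i)) (restrict snd (carrier M \<times> carrier N)) f"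
  have h: "f1 \<in> mod_hom R (?F i) M" "f2 \<in> mod_hom R (?F i) N"
    unfolding f1_def f2_def using mod_hom_compose[OF FM f] mod_prod_projections[OF M N] by blast+
  have e: "f1 x = fst (f x)" "f2 x = snd (f x)" if "x \<in> carrier (?F i)" for x
    using that mod_homD(1)[OF f that] by (auto simp: f1_def f2_def compose_eq mem_Times_iff)
  have "\<forall>z\<in>carrier (?F (Suc i)). f1 (d i z) = \<zero>\<^bsub>M\<^esub>" "\<forall>z\<in>carrier (?F (Suc i)). f2 (d i z) = \<zero>\<^bsub>N\<^esub>"
    using z e mod_homD(1)[OF d] by auto
  then have ex1: "case i of 0 \<Rightarrow> \<forall>z\<in>carrier (?F 0). f1 z = \<zero>\<^bsub>M\<^esub>
      | Suc j \<Rightarrow> \<exists>g\<in>mod_hom R (?F j) M. \<forall>z\<in>carrier (?F (Suc j)). f1 z = g (d j z)"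
    and ex2: "case i of 0 \<Rightarrow> \<forall>z\<in>carrier (?F 0). f2 z = \<zero>\<^bsub>N\<^esub>
      | Suc j \<Rightarrow> \<exists>g\<in>mod_hom R (?F j) N. \<forall>z\<in>carrier (?F (Suc j)). f2 z = g (d j z)"
    using ex h unfolding exact_at_def by blast+
  show "case i of 0 \<Rightarrow> \<forall>z\<in>carrier (?F 0). f z = \<zero>\<^bsub>mod_prod M N\<^esub>
      | Suc j \<Rightarrow> \<exists>g\<in>mod_hom R (?F j) (mod_prod M N). \<forall>z\<in>carrier (?F (Suc j)). f z = g (d j z)"
  proof (cases i)
    case 0
    then show ?thesis using ex1 ex2 e by (auto simp: prod_eq_iff)
  next
    case (Suc j)
    obtain g1 where g1: "g1 \<in> mod_hom R (?F j) M" "\<And>z. z \<in> carrier (?F (Suc j)) \<Longrightarrow> f1 z = g1 (d j z)"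
      using ex1 unfolding Suc by auto
    obtain g2 where g2: "g2 \<in> mod_hom R (?F j) N" "\<And>z. z \<in> carrier (?F (Suc j)) \<Longrightarrow> f2 z = g2 (d j z)"
      using ex2 unfolding Suc by auto
    have "f z = (g1 (d j z), g2 (d j z))" if "z \<in> carrier (?F (Suc j))" for z
      using e[of z] g1(2)[OF that] g2(2)[OF that] that unfolding Suc by (simp add: prod_eq_iff)
    then show ?thesis
      unfolding Suc using mod_homD(1)[OF d, of _ j]
      by (auto intro!: bexI[OF _ mod_prod_pairing[OF FM g1(1) g2(1)]])
  qed
qed

text \<open>The two modules may have different carrier types, so this is what permits replacing a
  module over a product type by a copy in \<open>'a rmod\<close>.\<close>

lemma exact_at_iso:
  assumes M: "module R M" and N: "module R N" and iso: "mod_isomorphic R M N" and ex: "exact_at r d M i"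
    and d: "\<And>i. d i \<in> mod_hom R (free_module R (r (Suc i))) (free_module R (r i))"
  shows "exact_at r d N i"
  unfolding exact_at_def
proof (intro ballI impI)
  let ?F = "\<lambda>i. free_module R (r i)"
  have FM: "module R (?F k)" for k using module_free_module cring_of_module[OF M] by blast
  obtain p where p: "p \<in> mod_hom R M N" "bij_betw p (carrier M) (carrier N)"
    using iso unfolding mod_isomorphic_def by blast
  obtain q where q: "q \<in> mod_hom R N M" "\<forall>x\<in>carrier M. q (p x) = x" "\<forall>y\<in>carrier N. p (q y) = y"
    using mod_hom_inverse[OF N M p] by blast
  fix f assume f: "f \<in> mod_hom R (?F i) N" and z: "\<forall>z\<in>carrier (?F (Suc i)). f (d i z) = \<zero>\<^bsub>N\<^esub>"
  define f1 where "f1 = compose (carrier (?F i)) q f"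
  have h: "f1 \<in> mod_hom R (?F i) M" unfolding f1_def by (rule mod_hom_compose[OF FM f q(1)])
  have e: "f z = p (f1 z)" if "z \<in> carrier (?F i)" for z
    using that q(3) mod_homD(1)[OF f] by (simp add: f1_def compose_eq)
  have "\<forall>z\<in>carrier (?F (Suc i)). f1 (d i z) = \<zero>\<^bsub>M\<^esub>"
    using z mod_homD(1)[OF d] mod_hom_zero[OF N M q(1)] by (simp add: f1_def compose_eq)
  then have ex1: "case i of 0 \<Rightarrow> \<forall>z\<in>carrier (?F 0). f1 z = \<zero>\<^bsub>M\<^esub>
      | Suc j \<Rightarrow> \<exists>g\<in>mod_hom R (?F j) M. \<forall>z\<in>carrier (?F (Suc j)). f1 z = g (d j z)"
    using ex h unfolding exact_at_def by blast
  show "case i of 0 \<Rightarrow> \<forall>z\<in>carrier (?F 0). f z = \<zero>\<^bsub>N\<^esub>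
      | Suc j \<Rightarrow> \<exists>g\<in>mod_hom R (?F j) N. \<forall>z\<in>carrier (?F (Suc j)). f z = g (d j z)"
  proof (cases i)
    case 0
    then show ?thesis using ex1 e mod_hom_zero[OF M N p(1)] by simp
  next
    case (Suc j)
    obtain g1 where g1: "g1 \<in> mod_hom R (?F j) M" "\<And>z. z \<in> carrier (?F (Suc j)) \<Longrightarrow> f1 z = g1 (d j z)"
      using ex1 unfolding Suc by auto
    have "f z = compose (carrier (?F j)) p g1 (d j z)" if "z \<in> carrier (?F (Suc j))" for z
      using e[of z] g1(2)[OF that] that mod_homD(1)[OF d that] unfolding Suc by (simp add: compose_eq)
    then show ?thesis
      unfolding Suc using mod_hom_compose[OF FM g1(1) p(1)] by auto
  qed
qed

lemma mod_hom_subI: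
  assumes "f \<in> mod_hom R L M" "\<And>x. x \<in> carrier L \<Longrightarrow> f x \<in> H"
  shows "f \<in> mod_hom R L (M\<lparr>carrier := H\<rparr>)"
  using assms unfolding mod_hom_def by auto

lemma mod_hom_subD:
  assumes "f \<in> mod_hom R L (M\<lparr>carrier := H\<rparr>)" "H \<subseteq> carrier M"
  shows "f \<in> mod_hom R L M"
  using assms unfolding mod_hom_def by auto

text \<open>The connecting map of the long exact sequence, spelled out on cochains: a cocycle with values
  in the kernel is \<open>g \<circ> d\<close> in \<open>E\<close>, and \<open>p \<circ> g\<close> is a cocycle of degree one less in \<open>L\<close>, hence \<open>g\<close>
  can be corrected to take values in the kernel.\<close>

lemma exact_at_kernel:
  assumes E: "module R E" and L: "module R L" and p: "p \<in> mod_hom R E L"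
    and onto: "p ` carrier E = carrier L" and H: "H = {x \<in> carrier E. p x = \<zero>\<^bsub>L\<^esub>}"
    and exE: "exact_at r d E i" and exL: "\<And>j. i = Suc j \<Longrightarrow> exact_at r d L j"
    and d: "\<And>i. d i \<in> mod_hom R (free_module R (r (Suc i))) (free_module R (r i))"
    and dd: "\<And>i z. z \<in> carrier (free_module R (r (Suc (Suc i)))) \<Longrightarrow> d i (d (Suc i) z) = \<zero>\<^bsub>free_module R (r i)\<^esub>"
  shows "exact_at r d (E\<lparr>carrier := H\<rparr>) i"
  unfolding exact_at_def
proof (intro ballI impI)
  let ?F = "\<lambda>i. free_module R (r i)" and ?P = "E\<lparr>carrier := H\<rparr>"
  have cR: "cring R" using cring_of_module[OF E] .
  note FM = module_free_module[OF cR]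
  interpret E: module R E by fact
  interpret L: module R L by fact
  have HE: "H \<subseteq> carrier E" using H by blast
  fix f assume f: "f \<in> mod_hom R (?F i) ?P" and z: "\<forall>z\<in>carrier (?F (Suc i)). f (d i z) = \<zero>\<^bsub>?P\<^esub>"
  have fE: "f \<in> mod_hom R (?F i) E" by (rule mod_hom_subD[OF f HE])
  have fH: "p (f x) = \<zero>\<^bsub>L\<^esub>" if "x \<in> carrier (?F i)" for x using mod_homD(1)[OF f that] H by simp
  have ex1: "case i of 0 \<Rightarrow> \<forall>z\<in>carrier (?F 0). f z = \<zero>\<^bsub>E\<^esub>
      | Suc j \<Rightarrow> \<exists>g\<in>mod_hom R (?F j) E. \<forall>z\<in>carrier (?F (Suc j)). f z = g (d j z)"
    using exE fE z unfolding exact_at_def by simp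
  show "case i of 0 \<Rightarrow> \<forall>z\<in>carrier (?F 0). f z = \<zero>\<^bsub>?P\<^esub>
      | Suc j \<Rightarrow> \<exists>g\<in>mod_hom R (?F j) ?P. \<forall>z\<in>carrier (?F (Suc j)). f z = g (d j z)"
  proof (cases i)
    case 0
    then show ?thesis using ex1 by simp
  next
    case (Suc j)
    obtain g where g: "g \<in> mod_hom R (?F j) E" "\<And>z. z \<in> carrier (?F (Suc j)) \<Longrightarrow> f z = g (d j z)"
      using ex1 unfolding Suc by auto
    define q where "q = compose (carrier (?F j)) p g"
    have q: "q \<in> mod_hom R (?F j) L" unfolding q_def by (rule mod_hom_compose[OF FM g(1) p])
    have qe: "q z = p (g z)" if "z \<in> carrier (?F j)" for z using that by (simp add: q_def compose_eq)
    have "\<forall>z\<in>carrier (?F (Suc j)). q (d j z) = \<zero>\<^bsub>L\<^esub>"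
      using qe mod_homD(1)[OF d] g(2) fH Suc by simp
    then have exq: "case j of 0 \<Rightarrow> \<forall>z\<in>carrier (?F 0). q z = \<zero>\<^bsub>L\<^esub>
        | Suc k \<Rightarrow> \<exists>g\<in>mod_hom R (?F k) L. \<forall>z\<in>carrier (?F (Suc k)). q z = g (d k z)"
      using exL[OF Suc] q unfolding exact_at_def by blast
    \<comment> \<open>The correction of \<open>g\<close>: it must keep its values on boundaries
      while \<open>p\<close> kills it. For \<open>j = 0\<close> exactness in \<open>L\<close> says
      that \<open>p\<close> kills \<open>g\<close> itself.\<close>
    have "\<exists>g'\<in>mod_hom R (?F j) E. (\<forall>z\<in>carrier (?F j). p (g' z) = \<zero>\<^bsub>L\<^esub>) \<and>
        (\<forall>z\<in>carrier (?F (Suc j)). g' (d j z) = g (d j z))"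
    proof (cases j)
      case 0
      then show ?thesis using exq qe g(1) by (intro bexI[of _ g]) auto
    next
      case j: (Suc k)
      obtain h where h: "h \<in> mod_hom R (?F k) L" "\<And>z. z \<in> carrier (?F j) \<Longrightarrow> q z = h (d k z)"
        using exq unfolding j by auto
      \<comment> \<open>Exactness in \<open>L\<close> gives p g = h d. Since the source of
        \<open>h\<close> is free and \<open>p\<close> is onto, \<open>h\<close> lifts to
        \<open>E\<close>, and g - h' d is the wanted correction because d d = 0.\<close>
      obtain h' where h': "h' \<in> mod_hom R (?F k) E" "\<And>z. z \<in> carrier (?F k) \<Longrightarrow> p (h' z) = h z"
        using free_module_lift[OF cR E L h(1) p] onto mod_homD(1)[OF h(1)] by auto
      have dk: "d k z \<in> carrier (?F k)" if "z \<in> carrier (?F j)" for z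
        using mod_homD(1)[OF d[of k]] that j by simp
      let ?g = "\<lambda>z. g z \<ominus>\<^bsub>E\<^esub> h' (d k z)"
      have hd: "compose (carrier (?F j)) h' (d k) \<in> mod_hom R (?F j) E"
        using mod_hom_compose[OF FM _ h'(1)] d[of k] j by simp
      have gh: "restrict ?g (carrier (?F j)) \<in> mod_hom R (?F j) E"
      proof -
        interpret G: comm_group "hom_group R (?F j) E" by (rule hom_group_comm_group[OF FM E])
        have "g \<otimes>\<^bsub>hom_group R (?F j) E\<^esub> inv\<^bsub>hom_group R (?F j) E\<^esub> (compose (carrier (?F j)) h' (d k))
            \<in> carrier (hom_group R (?F j) E)"
          using g(1) hd by (intro G.m_closed G.inv_closed) (simp_all add: hom_group_simps(1))
        moreover have "g \<otimes>\<^bsub>hom_group R (?F j) E\<^esub> inv\<^bsub>hom_group R (?F j) E\<^esub> (compose (carrier (?F j)) h' (d k))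
            = restrict ?g (carrier (?F j))"
          unfolding hom_group_inv[OF FM E hd] hom_group_simps
          by (auto simp: compose_eq a_minus_def intro!: restrict_ext)
        ultimately show ?thesis by (simp add: hom_group_simps(1))
      qed
      show ?thesis
      proof (intro bexI[OF _ gh] conjI ballI)
        fix z assume z: "z \<in> carrier (?F j)"
        have "p (?g z) = p (g z) \<ominus>\<^bsub>L\<^esub> p (h' (d k z))"
          using mod_hom_diff[OF E L p] mod_homD(1)[OF g(1) z] mod_homD(1)[OF h'(1) dk[OF z]] by blast
        also have "\<dots> = \<zero>\<^bsub>L\<^esub>"
          using h'(2)[OF dk[OF z]] h(2)[OF z] qe[OF z] mod_homD(1)[OF q z] by (simp add: a_minus_def L.M.r_neg)
        finally show "p (restrict ?g (carrier (?F j)) z) = \<zero>\<^bsub>L\<^esub>" using z by simp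
      next
        fix z assume z: "z \<in> carrier (?F (Suc j))"
        then have "d k (d j z) = \<zero>\<^bsub>?F k\<^esub>" using dd[of z k] j by simp
        then have "h' (d k (d j z)) = \<zero>\<^bsub>E\<^esub>" using mod_hom_zero[OF FM E h'(1)] by simp
        then show "restrict ?g (carrier (?F j)) (d j z) = g (d j z)"
          using mod_homD(1)[OF d z] mod_homD(1)[OF g(1)] by (simp add: a_minus_def)
      qed
    qed
    then obtain g' where g': "g' \<in> mod_hom R (?F j) E" "\<forall>z\<in>carrier (?F j). p (g' z) = \<zero>\<^bsub>L\<^esub>"
      "\<forall>z\<in>carrier (?F (Suc j)). g' (d j z) = g (d j z)" by blast
    have "g' \<in> mod_hom R (?F j) ?P"
      by (rule mod_hom_subI[OF g'(1)]) (use mod_homD(1)[OF g'(1)] g'(2) H in simp)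
    then show ?thesis unfolding Suc nat.case using g(2) g'(3) by (intro bexI[of _ g']) auto
  qed
qed

end

section \<open>The ring and the kernels of surjections are maximal Cohen--Macaulay\<close>

context
  fixes R :: "'a ring" (structure)
begin

lemma regular_module_simps [simp]:
  shows "carrier (regular_module R) = carrier R"
    and "\<zero>\<^bsub>regular_module R\<^esub> = \<zero>"
    and "x \<oplus>\<^bsub>regular_module R\<^esub> y = x \<oplus> y"
    and "a \<odot>\<^bsub>regular_module R\<^esub> x = a \<otimes> x"
  by (simp_all add: regular_module_def)

lemma residue_module_simps:
  shows "carrier (residue_module R) = carrier (R Quot max_ideal R)"
    and "\<zero>\<^bsub>residue_module R\<^esub> = \<zero>\<^bsub>R Quot max_ideal R\<^esub>"
    and "x \<oplus>\<^bsub>residue_module R\<^esub> y = x \<oplus>\<^bsub>R Quot max_ideal R\<^esub> y"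
    and "a \<odot>\<^bsub>residue_module R\<^esub> x = (max_ideal R +> a) \<otimes>\<^bsub>R Quot max_ideal R\<^esub> x"
  by (simp_all add: residue_module_def Let_def)

lemma module_regular_module: "cring R \<Longrightarrow> module R (regular_module R)"
proof -
  assume "cring R"
  then interpret cring R .
  show ?thesis
  proof (rule moduleI[OF is_cring])
    show "abelian_group (regular_module R)"
      by (rule abelian_groupI) (auto simp: a_ac intro: bexI[of _ "\<ominus> x" for x] l_neg)
  qed (auto simp: l_distr r_distr m_assoc)
qed

lemma ideal_submodule_regular:
  assumes R: "cring R" and I: "ideal I R"
  shows "submodule I R (regular_module R)"
proof -
  interpret ideal I R by fact
  interpret M: module R "regular_module R" by (rule module_regular_module[OF R])
  have m: "\<ominus>\<^bsub>regular_module R\<^esub> x = \<ominus> x" if "x \<in> carrier R" for x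
    by (rule M.M.minus_equality) (use that in \<open>auto simp: l_neg\<close>)
  show ?thesis
    by (rule M.submoduleI) (auto simp: I_l_closed m)
qed

text \<open>Multiplication by \<open>x\<close> on the resolution covers the zero map on
  \<open>K\<close>, so it is homotopic to zero by the comparison argument: each component of the
  homotopy is lifted along the next differential, using exactness.\<close>

lemma null_homotopy:
  assumes R: "cring R" and FR: "free_resolution R K r d e" and K: "module R K"
    and x: "x \<in> carrier R" "\<forall>y\<in>carrier K. x \<odot>\<^bsub>K\<^esub> y = \<zero>\<^bsub>K\<^esub>"
  shows "\<exists>h. (\<forall>i. h i \<in> mod_hom R (free_module R (r i)) (free_module R (r (Suc i)))) \<and>
    (\<forall>z\<in>carrier (free_module R (r 0)). d 0 (h 0 z) = x \<odot>\<^bsub>free_module R (r 0)\<^esub> z) \<and>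
    (\<forall>i. \<forall>z\<in>carrier (free_module R (r (Suc i))).
      d (Suc i) (h (Suc i) z) = x \<odot>\<^bsub>free_module R (r (Suc i))\<^esub> z \<ominus>\<^bsub>free_module R (r (Suc i))\<^esub> h i (d i z))"
proof -
  let ?F = "\<lambda>i. free_module R (r i)"
  note FM = module_free_module[OF R]
  interpret R: cring R by fact
  have F: "module R (?F i)" for i by (rule FM)
  note D = free_resolutionD[OF FR]
  have mul: "restrict (\<lambda>z. x \<odot>\<^bsub>?F i\<^esub> z) (carrier (?F i)) \<in> mod_hom R (?F i) (?F i)" for i
  proof -
    interpret F: module R "?F i" by (rule FM)
    show ?thesis
      by (rule mod_homI[OF FM])
         (use x(1) in \<open>simp_all add: F.smult_r_distr F.smult_assoc1[symmetric] R.m_comm\<close>)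
  qed
  \<comment> \<open>The invariant d h d = x d makes x - h d a map into the kernel of
    \<open>d i\<close>, so that it lifts along \<open>d (Suc i)\<close>. The homotopy relation in
    the next degree (\<open>Q\<close>) restores the invariant, since d d = 0.\<close>
  define P where "P i h \<longleftrightarrow> h \<in> mod_hom R (?F i) (?F (Suc i)) \<and>
      (\<forall>z\<in>carrier (?F (Suc i)). d i (h (d i z)) = x \<odot>\<^bsub>?F i\<^esub> d i z) \<and>
      (i = 0 \<longrightarrow> (\<forall>z\<in>carrier (?F 0). d 0 (h z) = x \<odot>\<^bsub>?F 0\<^esub> z))" for i h
  define Q where "Q i h h' \<longleftrightarrow> (\<forall>z\<in>carrier (?F (Suc i)).
      d (Suc i) (h' z) = x \<odot>\<^bsub>?F (Suc i)\<^esub> z \<ominus>\<^bsub>?F (Suc i)\<^esub> h (d i z))" for i h h'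
  have "\<exists>h. \<forall>i. P i (h i) \<and> Q i (h i) (h (Suc i))"
  proof (rule dependent_nat_choice)
    have "x \<odot>\<^bsub>?F 0\<^esub> z \<in> d 0 ` carrier (?F 1)" if z: "z \<in> carrier (?F 0)" for z
    proof -
      interpret F: module R "?F 0" by (rule FM)
      have "e (x \<odot>\<^bsub>?F 0\<^esub> z) = \<zero>\<^bsub>K\<^esub>"
        using mod_homD(3)[OF D(1) x(1) z] x(2) mod_homD(1)[OF D(1) z] by simp
      then show ?thesis using D(4) F.smult_closed[OF x(1) z] by blast
    qed
    then obtain h where h: "h \<in> mod_hom R (?F 0) (?F 1)" "\<forall>z\<in>carrier (?F 0). d 0 (h z) = x \<odot>\<^bsub>?F 0\<^esub> z"
      using free_module_lift[OF R F F mul[of 0] D(2)[of 0]] by auto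
    then have "P 0 h" using mod_homD(1)[OF D(2)[of 0]] unfolding P_def by simp
    then show "\<exists>h. P 0 h" by blast
  next
    fix h i assume Ph: "P i h"
    then have h: "h \<in> mod_hom R (?F i) (?F (Suc i))"
      and hx: "\<And>z. z \<in> carrier (?F (Suc i)) \<Longrightarrow> d i (h (d i z)) = x \<odot>\<^bsub>?F i\<^esub> d i z"
      unfolding P_def by blast+
    let ?G = "?F (Suc i)"
    interpret G: module R ?G by (rule FM)
    interpret F: module R "?F i" by (rule FM)
    let ?p = "\<lambda>z. x \<odot>\<^bsub>?G\<^esub> z \<ominus>\<^bsub>?G\<^esub> h (d i z)"
    have di: "d i z \<in> carrier (?F i)" and hd: "h (d i z) \<in> carrier ?G" if "z \<in> carrier ?G" for z
      using mod_homD(1)[OF D(2)[of i] that] mod_homD(1)[OF h] by auto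
    have p: "restrict ?p (carrier ?G) \<in> mod_hom R ?G ?G"
      by (rule mod_homI[OF FM])
         (use x(1) di hd mod_homD(1)[OF h] in \<open>simp_all add: mod_homD(2,3)[OF D(2)[of i]] mod_homD(2,3)[OF h]
            G.smult_r_distr G.smult_r_minus a_minus_def G.smult_assoc1[symmetric] R.m_comm G.M.minus_add G.M.a_ac\<close>)
    have "restrict ?p (carrier ?G) z \<in> d (Suc i) ` carrier (?F (Suc (Suc i)))" if z: "z \<in> carrier ?G" for z
    proof -
      have "d i (?p z) = d i (x \<odot>\<^bsub>?G\<^esub> z) \<ominus>\<^bsub>?F i\<^esub> d i (h (d i z))"
        by (rule mod_hom_diff[OF FM FM D(2)]) (use z hd x in auto)
      also have "\<dots> = \<zero>\<^bsub>?F i\<^esub>"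
        using hx[OF z] mod_homD(3)[OF D(2)[of i] x(1) z] di[OF z] x(1) by (simp add: a_minus_def F.M.r_neg)
      finally have "?p z \<in> {y \<in> carrier ?G. d i y = \<zero>\<^bsub>?F i\<^esub>}"
        using z hd[OF z] x(1) by (simp add: G.M.minus_closed)
      then show ?thesis unfolding D(5) using z by simp
    qed
    then obtain h' where h': "h' \<in> mod_hom R ?G (?F (Suc (Suc i)))"
      "\<forall>z\<in>carrier ?G. d (Suc i) (h' z) = restrict ?p (carrier ?G) z"
      using free_module_lift[OF R F F p D(2)[of "Suc i"]] by blast
    have Q: "Q i h h'" using h'(2) unfolding Q_def by simp
    have "d (Suc i) (h' (d (Suc i) z)) = x \<odot>\<^bsub>?G\<^esub> d (Suc i) z" if z: "z \<in> carrier (?F (Suc (Suc i)))" for z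
    proof -
      have "d (Suc i) z \<in> carrier ?G" using mod_homD(1)[OF D(2)[of "Suc i"] z] .
      moreover have "h (d i (d (Suc i) z)) = \<zero>\<^bsub>?G\<^esub>"
        using free_resolution_dd[OF FR z] mod_hom_zero[OF FM FM h] by simp
      ultimately show ?thesis using Q x(1) unfolding Q_def by (simp add: a_minus_def)
    qed
    then have "P (Suc i) h'" using h'(1) unfolding P_def by simp
    then show "\<exists>h'. P (Suc i) h' \<and> Q i h h'" using Q by blast
  qed
  then obtain h where "\<forall>i. P i (h i) \<and> Q i (h i) (h (Suc i))" by blast
  then show ?thesis unfolding P_def Q_def by (intro exI[of _ h]) blast
qed

text \<open>An ideal containing \<open>x\<close> and \<open>A\<close> is given by the sum of the
  principal ideal of \<open>x\<close> and the ideal of \<open>A\<close>; it lies above the generated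
  one by minimality.\<close>

lemma Idl_insert_decomposition:
  assumes R: "cring R" and A: "A \<subseteq> carrier R" and x: "x \<in> carrier R" and u: "u \<in> Idl (insert x A)"
  shows "\<exists>v\<in>carrier R. u \<ominus> x \<otimes> v \<in> Idl A"
proof -
  interpret cring R by fact
  have iA: "ideal (Idl A) R" by (rule genideal_ideal[OF A])
  have "ideal (PIdl x <+>\<^bsub>R\<^esub> Idl A) R" by (rule add_ideals[OF cgenideal_ideal[OF x] iA])
  moreover have "insert x A \<subseteq> PIdl x <+>\<^bsub>R\<^esub> Idl A"
  proof -
    interpret A: ideal "Idl A" R by (rule iA)
    interpret P: ideal "PIdl x" R by (rule cgenideal_ideal[OF x])
    have "x \<oplus> \<zero> \<in> PIdl x <+>\<^bsub>R\<^esub> Idl A"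
      unfolding set_add_def' using cgenideal_self[OF x] A.zero_closed by blast
    then have "x \<in> PIdl x <+>\<^bsub>R\<^esub> Idl A" using x by simp
    moreover have "a \<in> PIdl x <+>\<^bsub>R\<^esub> Idl A" if "a \<in> A" for a
    proof -
      have "\<zero> \<oplus> a \<in> PIdl x <+>\<^bsub>R\<^esub> Idl A"
        unfolding set_add_def' using genideal_self[OF A] P.zero_closed that by blast
      then show ?thesis using that A by auto
    qed
    ultimately show ?thesis by blast
  qed
  ultimately have "Idl (insert x A) \<subseteq> PIdl x <+>\<^bsub>R\<^esub> Idl A" by (rule genideal_minimal)
  then have "u \<in> PIdl x <+>\<^bsub>R\<^esub> Idl A" using u by blast
  then obtain v a where v: "v \<in> carrier R" "a \<in> Idl A" "u = v \<otimes> x \<oplus> a"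
    unfolding set_add_def' cgenideal_def by blast
  then have "u \<ominus> x \<otimes> v = a"
    using x ideal.Icarr[OF iA v(2)] by (simp add: a_minus_def a_ac m_comm r_neg a_cancel)
  then show ?thesis using v by blast
qed

text \<open>Descending along a regular sequence: if \<open>f\<close> is a cocycle modulo \<open>(x\<^sub>1, \<dots>, x\<^sub>j)\<close> and \<open>x\<close> is
  the next element, then \<open>x f\<close> is, modulo that ideal, the coboundary of \<open>f \<circ> h\<close> for the homotopy \<open>h\<close>
  of \<open>x\<close>, and \<open>f \<circ> h\<close> is a cocycle modulo \<open>(x\<^sub>1, \<dots>, x\<^sub>j, x)\<close> of degree one less.\<close>

lemma regular_sequence_exact_mod:
  assumes R: "cring R" and FR: "free_resolution R K r d e" and K: "module R K"
    and reg: "regular_sequence R xs"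
    and ann: "\<And>x y. x \<in> set xs \<Longrightarrow> y \<in> carrier K \<Longrightarrow> x \<odot>\<^bsub>K\<^esub> y = \<zero>\<^bsub>K\<^esub>"
    and "i + j < length xs" "f \<in> mod_hom R (free_module R (r i)) (regular_module R)"
    and "\<And>z. z \<in> carrier (free_module R (r (Suc i))) \<Longrightarrow> f (d i z) \<in> Idl (set (take j xs))"
  shows "case i of 0 \<Rightarrow> \<forall>z\<in>carrier (free_module R (r 0)). f z \<in> Idl (set (take j xs))
     | Suc k \<Rightarrow> \<exists>g\<in>mod_hom R (free_module R (r k)) (regular_module R).
         \<forall>z\<in>carrier (free_module R (r (Suc k))). f z \<ominus> g (d k z) \<in> Idl (set (take j xs))"
  using assms(6-)
proof (induction i arbitrary: j f)
  case (0 j f)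
  let ?F = "\<lambda>i. free_module R (r i)" and ?I = "Idl (set (take j xs))" and ?x = "xs ! j"
  interpret R: cring R by fact
  have j: "j < length xs" using 0 by simp
  have xc: "?x \<in> carrier R" using reg j unfolding regular_sequence_def by (meson nth_mem subsetD)
  have xann: "\<forall>y\<in>carrier K. ?x \<odot>\<^bsub>K\<^esub> y = \<zero>\<^bsub>K\<^esub>" using ann[OF nth_mem[OF j]] by blast
  obtain h where h0: "\<forall>i. h i \<in> mod_hom R (?F i) (?F (Suc i))"
    and h1: "\<forall>z\<in>carrier (?F 0). d 0 (h 0 z) = ?x \<odot>\<^bsub>?F 0\<^esub> z"
    using null_homotopy[OF R FR K xc xann]
    by (elim exE conjE) (rule that)
  note h = h0[rule_format, of 0] h1
  \<comment> \<open>In degree 0 the homotopy gives x f(z) = f(x z) = f(d h z), which lies in the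
    ideal, and regularity of the sequence cancels x.\<close>
  have "f z \<in> ?I" if z: "z \<in> carrier (?F 0)" for z
  proof -
    have "f (d 0 (h 0 z)) \<in> ?I" using 0(3)[OF mod_homD(1)[OF h(1) z]] .
    moreover have "f (d 0 (h 0 z)) = ?x \<otimes> f z" using h(2) z mod_homD(3)[OF 0(2) xc z] by simp
    moreover have "f z \<in> carrier R" using mod_homD(1)[OF 0(2) z] by simp
    ultimately show ?thesis using reg j unfolding regular_sequence_def by metis
  qed
  then show ?case by simp
next
  case (Suc k j f)
  let ?F = "\<lambda>i. free_module R (r i)" and ?I = "\<lambda>j. Idl (set (take j xs))" and ?x = "xs ! j"
    and ?R = "regular_module R"
  interpret R: cring R by fact
  note FM = module_free_module[OF R] and RM = module_regular_module[OF R]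
  note D = free_resolutionD[OF FR]
  have j: "j < length xs" using Suc by simp
  have xsR: "set xs \<subseteq> carrier R" using reg unfolding regular_sequence_def by blast
  have xc: "?x \<in> carrier R" using xsR j by (meson nth_mem subsetD)
  have tR: "set (take l xs) \<subseteq> carrier R" for l using xsR set_take_subset[of l xs] by blast
  have I: "ideal (?I l) R" for l by (rule R.genideal_ideal[OF tR])
  interpret I: ideal "?I j" R by (rule I)
  interpret I': ideal "?I (Suc j)" R by (rule I)
  have tS: "set (take (Suc j) xs) = insert ?x (set (take j xs))" using j by (simp add: take_Suc_conv_app_nth)
  have II: "?I j \<subseteq> ?I (Suc j)" by (rule R.subset_Idl_subset[OF tR]) (use tS in blast)
  have xI: "?x \<in> ?I (Suc j)" using R.genideal_self[OF tR, of "Suc j"] unfolding tS by blast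
  have xann: "\<forall>y\<in>carrier K. ?x \<odot>\<^bsub>K\<^esub> y = \<zero>\<^bsub>K\<^esub>" using ann[OF nth_mem[OF j]] by blast
  obtain h where h': "\<forall>i. h i \<in> mod_hom R (?F i) (?F (Suc i))"
    and hh': "\<forall>i. \<forall>z\<in>carrier (?F (Suc i)).
      d (Suc i) (h (Suc i) z) = ?x \<odot>\<^bsub>?F (Suc i)\<^esub> z \<ominus>\<^bsub>?F (Suc i)\<^esub> h i (d i z)"
    using null_homotopy[OF R FR K xc xann]
    by (elim exE conjE) (rule that)
  note h = h'[rule_format] and hh = hh'[rule_format]
  have f: "f \<in> mod_hom R (?F (Suc k)) ?R" by (rule Suc.prems(2))
  have fc: "f w \<in> carrier R" if "w \<in> carrier (?F (Suc k))" for w using mod_homD(1)[OF f that] by simp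
  have dc: "d k w \<in> carrier (?F k)" if "w \<in> carrier (?F (Suc k))" for w using mod_homD(1)[OF D(2) that] .
  define g where "g = compose (carrier (?F k)) f (h k)"
  have g: "g \<in> mod_hom R (?F k) ?R" unfolding g_def by (rule mod_hom_compose[OF FM h f])
  have gc: "g w \<in> carrier R" if "w \<in> carrier (?F k)" for w using mod_homD(1)[OF g that] by simp
  \<comment> \<open>Here \<open>f\<close> is applied to the homotopy relation: x w - h d w is a
    boundary, and on boundaries \<open>f\<close> has values in the smaller ideal.\<close>
  have gd: "?x \<otimes> f w \<ominus> g (d k w) \<in> ?I j" if w: "w \<in> carrier (?F (Suc k))" for w
  proof -
    interpret F: module R "?F (Suc k)" by (rule FM)
    have hw: "h (Suc k) w \<in> carrier (?F (Suc (Suc k)))" using mod_homD(1)[OF h w] .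
    have hd: "h k (d k w) \<in> carrier (?F (Suc k))" using mod_homD(1)[OF h dc[OF w]] .
    have "f (?x \<odot>\<^bsub>?F (Suc k)\<^esub> w \<ominus>\<^bsub>?F (Suc k)\<^esub> h k (d k w)) \<in> ?I j"
      using Suc.prems(3)[OF hw] hh[OF w] by simp
    moreover have "f (?x \<odot>\<^bsub>?F (Suc k)\<^esub> w \<ominus>\<^bsub>?F (Suc k)\<^esub> h k (d k w)) =
        f (?x \<odot>\<^bsub>?F (Suc k)\<^esub> w) \<ominus>\<^bsub>?R\<^esub> f (h k (d k w))"
      by (rule mod_hom_diff[OF FM RM f]) (use w hd xc in auto)
    moreover have "\<ominus>\<^bsub>?R\<^esub> y = \<ominus> y" if "y \<in> carrier R" for y
    proof -
      interpret M: module R ?R by (rule RM)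
      show ?thesis by (rule M.M.minus_equality) (use that in \<open>auto simp: R.l_neg\<close>)
    qed
    ultimately show ?thesis
      using mod_homD(3)[OF f xc w] fc[OF hd] dc[OF w] by (simp add: a_minus_def g_def compose_eq)
  qed
  have gI: "g (d k w) \<in> ?I (Suc j)" if w: "w \<in> carrier (?F (Suc k))" for w
  proof -
    have a: "?x \<otimes> f w \<in> ?I (Suc j)" using I'.I_r_closed[OF xI fc[OF w]] .
    have b: "?x \<otimes> f w \<ominus> g (d k w) \<in> ?I (Suc j)" using gd[OF w] II by blast
    have "g (d k w) = ?x \<otimes> f w \<ominus> (?x \<otimes> f w \<ominus> g (d k w))"
      using gc[OF dc[OF w]] fc[OF w] xc by (simp add: a_minus_def R.minus_add R.r_neg2)
    then show ?thesis using I'.a_closed[OF a I'.a_inv_closed[OF b]] by (simp add: a_minus_def)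
  qed
  \<comment> \<open>The induction hypothesis lowers the degree by one and uses up one more member of
    the sequence, which leaves \<open>i + j\<close> unchanged. In positive degree it provides
    \<open>p\<close> with g - p d valued in the larger ideal; the subtracted term vanishes on
    boundaries.\<close>
  have "\<exists>t\<in>mod_hom R (?F k) ?R. (\<forall>z\<in>carrier (?F k). t z \<in> ?I (Suc j)) \<and>
      (\<forall>w\<in>carrier (?F (Suc k)). t (d k w) = g (d k w))"
  proof -
    have "k + Suc j < length xs" using Suc.prems(1) by simp
    from Suc.IH[OF this g gI] have *: "case k of 0 \<Rightarrow> \<forall>z\<in>carrier (?F 0). g z \<in> ?I (Suc j)
       | Suc l \<Rightarrow> \<exists>p\<in>mod_hom R (?F l) ?R.
           \<forall>z\<in>carrier (?F (Suc l)). g z \<ominus> p (d l z) \<in> ?I (Suc j)" by simp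
    show ?thesis
    proof (cases k)
      case 0
      then show ?thesis using * g by (intro bexI[of _ g]) auto
    next
      case k: (Suc l)
      obtain p where p: "p \<in> mod_hom R (?F l) ?R" "\<And>z. z \<in> carrier (?F k) \<Longrightarrow> g z \<ominus> p (d l z) \<in> ?I (Suc j)"
        using * unfolding k by auto
      have dl: "d l \<in> mod_hom R (?F k) (?F l)" using D(2)[of l] k by simp
      have pd: "p (d l z) \<in> carrier R" if "z \<in> carrier (?F k)" for z
        using mod_homD(1)[OF p(1) mod_homD(1)[OF dl that]] by simp
      have t: "restrict (\<lambda>z. g z \<ominus> p (d l z)) (carrier (?F k)) \<in> mod_hom R (?F k) ?R"
        by (rule mod_homI[OF FM])
           (use gc pd mod_homD(1)[OF dl] in \<open>simp_all add: mod_homD(2,3)[OF g] mod_homD(2,3)[OF p(1)] mod_homD(2,3)[OF dl]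
              a_minus_def R.r_distr R.r_minus R.minus_add R.a_ac\<close>)
      show ?thesis
      proof (intro bexI[OF _ t] conjI ballI)
        fix w assume w: "w \<in> carrier (?F (Suc k))"
        have "d l (d k w) = \<zero>\<^bsub>?F l\<^esub>" using free_resolution_dd[OF FR, of w l] w k by simp
        then have "p (d l (d k w)) = \<zero>" using mod_hom_zero[OF FM RM p(1)] by simp
        then show "restrict (\<lambda>z. g z \<ominus> p (d l z)) (carrier (?F k)) (d k w) = g (d k w)"
          using dc[OF w] gc by (simp add: a_minus_def)
      qed (use p(2) in simp)
    qed
  qed
  then obtain t where t: "t \<in> mod_hom R (?F k) ?R" "\<And>z. z \<in> carrier (?F k) \<Longrightarrow> t z \<in> ?I (Suc j)"
    "\<And>w. w \<in> carrier (?F (Suc k)) \<Longrightarrow> t (d k w) = g (d k w)" by blast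
  \<comment> \<open>On each unit vector the value of \<open>t\<close> is a multiple of x modulo the
    smaller ideal. Extending the cofactors linearly to \<open>s\<close> gives t = x s modulo that
    ideal everywhere.\<close>
  have "\<forall>l. \<exists>v. l < r k \<longrightarrow> v \<in> carrier R \<and> t (unit_vec R (r k) l) \<ominus> ?x \<otimes> v \<in> ?I j"
    using Idl_insert_decomposition[OF R tR xc, of _ j] t(2)[OF unit_vec_closed[OF R]] unfolding tS by blast
  then obtain v where v: "\<forall>l. l < r k \<longrightarrow> v l \<in> carrier R \<and> t (unit_vec R (r k) l) \<ominus> ?x \<otimes> v l \<in> ?I j"
    by metis
  then obtain s where s: "s \<in> mod_hom R (?F k) ?R" "\<forall>l<r k. s (unit_vec R (r k) l) = v l"
    using free_module_hom_exists[OF R RM, of "r k" v] by auto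
  have sc: "s z \<in> carrier R" and tc: "t z \<in> carrier R" if "z \<in> carrier (?F k)" for z
    using mod_homD(1)[OF s(1) that] mod_homD(1)[OF t(1) that] by simp_all
  have ts: "restrict (\<lambda>z. t z \<ominus> ?x \<otimes> s z) (carrier (?F k)) \<in> mod_hom R (?F k) ?R"
    by (rule mod_homI[OF FM])
       (use sc tc xc in \<open>simp_all add: mod_homD(2,3)[OF t(1)] mod_homD(2,3)[OF s(1)]
          a_minus_def R.r_distr R.r_minus R.minus_add R.a_ac R.m_ac\<close>)
  have "{z \<in> carrier (?F k). restrict (\<lambda>z. t z \<ominus> ?x \<otimes> s z) (carrier (?F k)) z \<in> ?I j} = carrier (?F k)"
    by (rule free_module_submodule_eqI[OF R submodule_vimage[OF FM RM ts ideal_submodule_regular[OF R I]]])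
       (use s(2) v unit_vec_closed[OF R] in auto)
  then have tsI: "t z \<ominus> ?x \<otimes> s z \<in> ?I j" if "z \<in> carrier (?F k)" for z
    using that by (metis (mono_tags, lifting) mem_Collect_eq restrict_apply')
  have "f w \<ominus> s (d k w) \<in> ?I j" if w: "w \<in> carrier (?F (Suc k))" for w
  proof -
    have [simp]: "f w \<in> carrier R" "s (d k w) \<in> carrier R" "g (d k w) \<in> carrier R" "?x \<in> carrier R"
      using fc[OF w] sc[OF dc[OF w]] gc[OF dc[OF w]] xc by auto
    \<comment> \<open>Both brackets lie in the smaller ideal, and the terms g d and t d cancel as
      \<open>t\<close> and \<open>g\<close> agree on boundaries. Regularity then cancels x, which
      makes \<open>s\<close> the required cochain.\<close>
    have "?x \<otimes> (f w \<ominus> s (d k w)) = (?x \<otimes> f w \<ominus> g (d k w)) \<oplus> (t (d k w) \<ominus> ?x \<otimes> s (d k w))"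
      using t(3)[OF w] by (simp add: a_minus_def R.r_distr R.r_minus R.a_assoc R.r_neg1)
    also have "\<dots> \<in> ?I j" using gd[OF w] tsI[OF dc[OF w]] by (rule I.a_closed)
    finally have "?x \<otimes> (f w \<ominus> s (d k w)) \<in> ?I j" .
    moreover have "f w \<ominus> s (d k w) \<in> carrier R" by simp
    ultimately show ?thesis using reg j unfolding regular_sequence_def by metis
  qed
  then show ?case using s(1) by auto
qed

text \<open>The case \<open>j = 0\<close> of the descent: the ideal of the empty prefix is zero, so
  congruences become equations. Hence Ext into \<open>R\<close> vanishes in degrees below the length
  of a regular sequence annihilating \<open>K\<close>.\<close>

lemma exact_at_regular_module:
  assumes R: "cring R" and FR: "free_resolution R K r d e" and K: "module R K"
    and reg: "regular_sequence R xs"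
    and ann: "\<And>x y. x \<in> set xs \<Longrightarrow> y \<in> carrier K \<Longrightarrow> x \<odot>\<^bsub>K\<^esub> y = \<zero>\<^bsub>K\<^esub>"
    and i: "i < length xs"
  shows "exact_at R r d (regular_module R) i"
  unfolding exact_at_def
proof (intro ballI impI)
  interpret cring R by fact
  have z: "Idl (set (take 0 xs)) = {\<zero>}"
    using genideal_minimal[OF zeroideal, of "{}"] additive_subgroup.zero_closed[OF ideal.axioms(1)[OF genideal_ideal[of "{}"]]]
    by auto
  fix f assume f: "f \<in> mod_hom R (free_module R (r i)) (regular_module R)"
    and "\<forall>z\<in>carrier (free_module R (r (Suc i))). f (d i z) = \<zero>\<^bsub>regular_module R\<^esub>"
  then have *: "case i of 0 \<Rightarrow> \<forall>z\<in>carrier (free_module R (r 0)). f z \<in> {\<zero>}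
     | Suc k \<Rightarrow> \<exists>g\<in>mod_hom R (free_module R (r k)) (regular_module R).
         \<forall>z\<in>carrier (free_module R (r (Suc k))). f z \<ominus> g (d k z) \<in> {\<zero>}"
    using regular_sequence_exact_mod[OF R FR K reg ann _ f, where j = 0] i unfolding z by simp
  show "case i of 0 \<Rightarrow> \<forall>z\<in>carrier (free_module R (r 0)). f z = \<zero>\<^bsub>regular_module R\<^esub>
     | Suc k \<Rightarrow> \<exists>g\<in>mod_hom R (free_module R (r k)) (regular_module R).
         \<forall>z\<in>carrier (free_module R (r (Suc k))). f z = g (d k z)"
  proof (cases i)
    case 0
    then show ?thesis using * by simp
  next
    case (Suc k)
    then obtain g where g: "g \<in> mod_hom R (free_module R (r k)) (regular_module R)"
      "\<And>z. z \<in> carrier (free_module R (r (Suc k))) \<Longrightarrow> f z \<ominus> g (d k z) = \<zero>" using * by auto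
    have "f z = g (d k z)" if z: "z \<in> carrier (free_module R (r (Suc k)))" for z
    proof -
      have "f z \<in> carrier R" "g (d k z) \<in> carrier R"
        using mod_homD(1)[OF f] z Suc mod_homD(1)[OF g(1) mod_homD(1)[OF free_resolutionD(2)[OF FR] z]] by auto
      then show ?thesis using g(2)[OF z] by simp
    qed
    then show ?thesis unfolding Suc nat.case using g(1) by blast
  qed
qed

lemma exact_at_free_module:
  assumes R: "cring R" and ex: "exact_at R r d (regular_module R) i"
    and d: "\<And>i. d i \<in> mod_hom R (free_module R (r (Suc i))) (free_module R (r i))"
  shows "exact_at R r d (free_module R n) i"
  unfolding exact_at_def
proof (intro ballI impI)
  let ?F = "\<lambda>i. free_module R (r i)" and ?N = "free_module R n" and ?R = "regular_module R"
  note FM = module_free_module[OF R]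
  interpret R: cring R by fact
  fix f assume f: "f \<in> mod_hom R (?F i) ?N" and z: "\<forall>z\<in>carrier (?F (Suc i)). f (d i z) = \<zero>\<^bsub>?N\<^esub>"
  have fc: "f z \<in> carrier ?N" if "z \<in> carrier (?F i)" for z using mod_homD(1)[OF f that] .
  then have fk: "f z k \<in> carrier R" if "z \<in> carrier (?F i)" "k < n" for z k
    using that by (auto simp: carrier_free_module)
  define c where "c k = restrict (\<lambda>z. f z k) (carrier (?F i))" for k
  have c: "c k \<in> mod_hom R (?F i) ?R" if "k < n" for k
    unfolding c_def
    by (rule mod_homI[OF FM])
       (use that fk in \<open>simp_all add: mod_homD(2,3)[OF f] add_free_module[where n = n] smult_free_module[where n = n]\<close>)
  have "\<forall>z\<in>carrier (?F (Suc i)). c k (d i z) = \<zero>\<^bsub>?R\<^esub>" if "k < n" for k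
    using z mod_homD(1)[OF d] that by (simp add: c_def zero_free_module)
  then have ck: "case i of 0 \<Rightarrow> \<forall>z\<in>carrier (?F 0). c k z = \<zero>\<^bsub>?R\<^esub>
     | Suc l \<Rightarrow> \<exists>g\<in>mod_hom R (?F l) ?R. \<forall>z\<in>carrier (?F (Suc l)). c k z = g (d l z)" if "k < n" for k
    using ex c that unfolding exact_at_def by blast
  show "case i of 0 \<Rightarrow> \<forall>z\<in>carrier (?F 0). f z = \<zero>\<^bsub>?N\<^esub>
     | Suc l \<Rightarrow> \<exists>g\<in>mod_hom R (?F l) ?N. \<forall>z\<in>carrier (?F (Suc l)). f z = g (d l z)"
  proof (cases i)
    case 0
    have "f z k = \<zero>" if "z \<in> carrier (?F 0)" "k < n" for z k
      using ck[OF that(2)] that(1) unfolding 0 by (simp add: c_def 0)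
    then show ?thesis
      using fc unfolding 0 by (auto simp: free_module_simps PiE_iff extensional_def intro!: ext)
  next
    case (Suc l)
    have "\<forall>k. \<exists>g. k < n \<longrightarrow> g \<in> mod_hom R (?F l) ?R \<and> (\<forall>z\<in>carrier (?F (Suc l)). c k z = g (d l z))"
      using ck unfolding Suc nat.case by blast
    then obtain g where g: "\<forall>k. k < n \<longrightarrow> g k \<in> mod_hom R (?F l) ?R \<and>
        (\<forall>z\<in>carrier (?F (Suc l)). c k z = g k (d l z))" by metis
    have gh: "g k \<in> mod_hom R (?F l) ?R" if "k < n" for k using g that by blast
    let ?G = "\<lambda>z. \<lambda>k\<in>{..<n}. g k z"
    have "restrict ?G (carrier (?F l)) \<in> mod_hom R (?F l) ?N"
      by (rule mod_homI[OF FM])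
         (use mod_homD(1)[OF gh] mod_homD(2,3)[OF gh] in \<open>auto simp: carrier_free_module[where n = n]
           add_free_module[where n = n] smult_free_module[where n = n] intro!: restrict_ext\<close>)
    moreover have "f z = ?G (d l z)" if zF: "z \<in> carrier (?F (Suc l))" for z
    proof (rule extensionalityI[of _ "{..<n}"])
      show "f z \<in> extensional {..<n}" using fc[of z] zF Suc by (auto simp: free_module_simps PiE_iff)
      show "f z k = ?G (d l z) k" if "k \<in> {..<n}" for k
        using g[rule_format, of k] that zF Suc by (simp add: c_def)
    qed simp
    ultimately show ?thesis
      unfolding Suc nat.case using mod_homD(1)[OF d, of _ l]
      by (intro bexI[of _ "restrict ?G (carrier (?F l))"]) auto
  qed
qed

end

context local_noetherian
begin

lemma module_residue_module: "module R (residue_module R)"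
proof -
  let ?k = "R Quot mm"
  interpret k: cring ?k by (rule max.quotient_is_cring[OF is_cring])
  interpret h: ring_hom_ring R ?k "(+>) mm" by (rule max.rcos_ring_hom_ring)
  show ?thesis
  proof (rule moduleI[OF is_cring])
    show "abelian_group (residue_module R)"
      by (rule abelian_groupI)
         (auto simp: residue_module_simps k.a_ac intro: bexI[of _ "\<ominus>\<^bsub>?k\<^esub> x" for x] k.l_neg)
  qed (auto simp: residue_module_simps k.l_distr k.r_distr k.m_assoc)
qed

lemma fin_gen_residue_module: "fin_gen R (residue_module R)"
proof -
  let ?k = "R Quot mm"
  have car: "carrier ?k = a_rcosets mm" by (simp add: FactRing_def)
  interpret k: cring ?k by (rule max.quotient_is_cring[OF is_cring])
  interpret h: ring_hom_ring R ?k "(+>) mm" by (rule max.rcos_ring_hom_ring)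
  interpret M: module R "residue_module R" by (rule module_residue_module)
  have "H = carrier (residue_module R)" if H: "submodule H R (residue_module R)" "{\<one>\<^bsub>?k\<^esub>} \<subseteq> H" for H
  proof -
    have "x \<in> H" if x: "x \<in> carrier (residue_module R)" for x
    proof -
      have "x \<in> a_rcosets mm" using x unfolding residue_module_simps(1) car .
      then obtain a where a: "a \<in> carrier R" "x = mm +> a" unfolding A_RCOSETS_def' by blast
      then have "x = a \<odot>\<^bsub>residue_module R\<^esub> \<one>\<^bsub>?k\<^esub>" by (simp add: residue_module_simps)
      then show ?thesis using M.submoduleE(4)[OF H(1) a(1), of "\<one>\<^bsub>?k\<^esub>"] H(2) by simp
    qed
    then show ?thesis using M.submoduleE(1)[OF H(1)] by blast
  qed
  then show ?thesis
    unfolding fin_gen_def by (intro exI[of _ "{\<one>\<^bsub>?k\<^esub>}"]) (auto simp: residue_module_simps)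
qed

lemma max_ideal_annihilates_residue_module:
  assumes "a \<in> mm" "y \<in> carrier (residue_module R)"
  shows "a \<odot>\<^bsub>residue_module R\<^esub> y = \<zero>\<^bsub>residue_module R\<^esub>"
proof -
  let ?k = "R Quot mm"
  interpret k: cring ?k by (rule max.quotient_is_cring[OF is_cring])
  have "mm +> a = \<zero>\<^bsub>?k\<^esub>" using a_rcos_zero[OF max.is_ideal assms(1)] by (simp add: FactRing_def)
  then show ?thesis using assms(2) by (simp add: residue_module_simps)
qed

text \<open>The resolution of the residue field chosen in the definition of \<^const>\<open>Ext\<close>.\<close>

definition residue_rank :: "nat \<Rightarrow> nat" where
  "residue_rank = fst (SOME (r, d, e). free_resolution R (residue_module R) r d e)"

definition residue_diff :: "nat \<Rightarrow> (nat \<Rightarrow> 'a) \<Rightarrow> (nat \<Rightarrow> 'a)" where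
  "residue_diff = fst (snd (SOME (r, d, e). free_resolution R (residue_module R) r d e))"

lemma residue_resolution: "\<exists>e. free_resolution R (residue_module R) residue_rank residue_diff e"
proof -
  let ?t = "SOME (r, d, e). free_resolution R (residue_module R) r d e"
  have "\<exists>r d e. free_resolution R (residue_module R) r d e"
    by (rule free_resolution_exists[OF is_cring noetherian_ring_axioms module_residue_module fin_gen_residue_module])
  then have "case ?t of (r, d, e) \<Rightarrow> free_resolution R (residue_module R) r d e"
    by (intro someI_ex[of "\<lambda>(r, d, e). free_resolution R (residue_module R) r d e"]) auto
  then show ?thesis unfolding residue_rank_def residue_diff_def by (auto split: prod.splits)
qed

text \<open>The Ext condition of \<open>MCM\<close>, polymorphic in the carrier type: it has to be
  available for pullbacks before they are moved to \<open>'a rmod\<close>.\<close>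

definition depth_condition :: "('a, 'm) module \<Rightarrow> bool" where
  "depth_condition M \<longleftrightarrow> (\<forall>i. enat i < krull_dim R \<longrightarrow> exact_at R residue_rank residue_diff M i)"

lemma MCM_iff: "M \<in> MCM R \<longleftrightarrow> module R M \<and> fin_gen R M \<and> depth_condition M"
proof -
  obtain r d e where t: "(SOME (r, d, e). free_resolution R (residue_module R) r d e) = (r, d, e)"
    by (rule prod_cases3)
  have "residue_rank = r" "residue_diff = d" unfolding residue_rank_def residue_diff_def t by simp_all
  then show ?thesis
    unfolding MCM_def depth_condition_def
    using trivial_Ext_iff[OF is_cring _ free_resolution_exists[OF is_cring noetherian_ring_axioms
        module_residue_module fin_gen_residue_module] t] by auto
qed

lemma depth_condition_mod_prod:
  "module R M \<Longrightarrow> module R N \<Longrightarrow> depth_condition M \<Longrightarrow> depth_condition N \<Longrightarrow> depth_condition (mod_prod M N)"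
  unfolding depth_condition_def using exact_at_mod_prod residue_resolution free_resolutionD(2) by metis

lemma depth_condition_iso:
  "module R M \<Longrightarrow> module R N \<Longrightarrow> mod_isomorphic R M N \<Longrightarrow> depth_condition M \<Longrightarrow> depth_condition N"
  unfolding depth_condition_def using exact_at_iso residue_resolution free_resolutionD(2) by metis

lemma depth_condition_kernel:
  assumes E: "module R E" and L: "module R L" and p: "p \<in> mod_hom R E L"
    and onto: "p ` carrier E = carrier L" and H: "H = {x \<in> carrier E. p x = \<zero>\<^bsub>L\<^esub>}"
    and d: "depth_condition E" "depth_condition L"
  shows "depth_condition (E\<lparr>carrier := H\<rparr>)"
  unfolding depth_condition_def
proof (intro allI impI)
  obtain e where FR: "free_resolution R (residue_module R) residue_rank residue_diff e"
    using residue_resolution by blast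
  fix i assume i: "enat i < krull_dim R"
  show "exact_at R residue_rank residue_diff (E\<lparr>carrier := H\<rparr>) i"
  proof (rule exact_at_kernel[OF E L p onto H])
    show "residue_diff k \<in> mod_hom R (free_module R (residue_rank (Suc k))) (free_module R (residue_rank k))" for k
      by (rule free_resolutionD(2)[OF FR])
    show "residue_diff k (residue_diff (Suc k) z) = \<zero>\<^bsub>free_module R (residue_rank k)\<^esub>"
      if "z \<in> carrier (free_module R (residue_rank (Suc (Suc k))))" for k z
      by (rule free_resolution_dd[OF FR that])
    show "exact_at R residue_rank residue_diff E i" using d(1) i unfolding depth_condition_def by blast
    \<comment> \<open>The connecting map lowers the degree, so degrees below the dimension are only
      ever compared with smaller ones.\<close>
    show "exact_at R residue_rank residue_diff L j" if "i = Suc j" for j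
    proof -
      have "enat j < enat i" using that by simp
      then have "enat j < krull_dim R" using i by (rule less_trans)
      then show ?thesis using d(2) unfolding depth_condition_def by blast
    qed
  qed
qed

text \<open>Depth and dimension agree, so for every degree below the dimension the supremum defining
  the depth supplies a longer regular sequence in the maximal ideal; its members kill the residue
  field. The sequence may vary with the degree.\<close>

lemma depth_condition_free_module:
  assumes cm: "cohen_macaulay R"
  shows "depth_condition (free_module R n)"
  unfolding depth_condition_def
proof (intro allI impI)
  obtain e where FR: "free_resolution R (residue_module R) residue_rank residue_diff e"
    using residue_resolution by blast
  fix i assume "enat i < krull_dim R"
  then have "enat i < ring_depth R" using cm unfolding cohen_macaulay_def by simp
  then obtain xs where xs: "regular_sequence R xs" "set xs \<subseteq> mm" "i < length xs"
    unfolding ring_depth_def less_Sup_iff by auto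
  have "exact_at R residue_rank residue_diff (regular_module R) i"
    using exact_at_regular_module[OF is_cring FR module_residue_module xs(1) _ xs(3)]
      max_ideal_annihilates_residue_module xs(2) by blast
  then show "exact_at R residue_rank residue_diff (free_module R n) i"
    by (rule exact_at_free_module[OF is_cring]) (rule free_resolutionD(2)[OF FR])
qed

end

section \<open>Finitely presented functors\<close>

text \<open>Stable composition is a union over representatives; this collapses it once independence
  of the representatives is known.\<close>

lemma UN_constant_eq: "a \<in> A \<Longrightarrow> (\<And>x. x \<in> A \<Longrightarrow> f x = c) \<Longrightarrow> (\<Union>x\<in>A. f x) = c"
  by blast

context comm_group
begin

lemma coset_repr: "subgroup H G \<Longrightarrow> a \<in> carrier G \<Longrightarrow> x \<in> H #> a \<Longrightarrow> H #> x = H #> a"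
  using repr_independence by metis

lemma coset_mult: "subgroup H G \<Longrightarrow> a \<in> carrier G \<Longrightarrow> b \<in> carrier G \<Longrightarrow>
    (H #> a) \<otimes>\<^bsub>G Mod H\<^esub> (H #> b) = H #> (a \<otimes> b)"
  using normal.rcos_sum[of H G a b] by (simp add: normal_iff_subgroup)

lemma coset_carrier: "a \<in> carrier G \<Longrightarrow> H #> a \<in> carrier (G Mod H)"
  by (auto simp: FactGroup_def RCOSETS_def)

lemma coset_exhaust: "x \<in> carrier (G Mod H) \<Longrightarrow> \<exists>a\<in>carrier G. x = H #> a"
  by (auto simp: FactGroup_def RCOSETS_def)

lemma coset_one_iff: "subgroup H G \<Longrightarrow> a \<in> carrier G \<Longrightarrow> H #> a = \<one>\<^bsub>G Mod H\<^esub> \<longleftrightarrow> a \<in> H"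
  using coset_join1[of H a] coset_join2[of a H] subgroup.subset[of H G] by auto

end

lemma mod_hom_add:
  assumes M: "module R M" and N: "module R N" and f: "f \<in> mod_hom R M N" and g: "g \<in> mod_hom R M N"
  shows "(\<lambda>x\<in>carrier M. f x \<oplus>\<^bsub>N\<^esub> g x) \<in> mod_hom R M N"
proof -
  interpret comm_group "hom_group R M N" by (rule hom_group_comm_group[OF M N])
  show ?thesis using m_closed[of f g] f g by (simp add: hom_group_simps)
qed

section \<open>Maps through free modules and quotients of Hom functors\<close>

context
  fixes R :: "'a ring" (structure)
begin

lemma factors_through_free_subset:
  assumes M: "module R M"
  shows "factors_through_free R M N \<subseteq> mod_hom R M N"
  unfolding factors_through_free_def using mod_hom_compose[OF M] by blast

lemma factors_through_freeI:
  assumes "g \<in> mod_hom R M (free_module R n)" "h \<in> mod_hom R (free_module R n) N"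
  shows "compose (carrier M) h g \<in> factors_through_free R M N"
  unfolding factors_through_free_def using assms by blast

lemma factors_through_free_compose:
  assumes Z: "module R Z" and M: "module R M" and f: "f \<in> mod_hom R Z M" and k: "k \<in> factors_through_free R M N"
  shows "compose (carrier Z) k f \<in> factors_through_free R Z N"
proof -
  obtain n g h where k: "k = compose (carrier M) h g" "g \<in> mod_hom R M (free_module R n)"
    "h \<in> mod_hom R (free_module R n) N"
    using k unfolding factors_through_free_def by blast
  have "compose (carrier Z) k f = compose (carrier Z) h (compose (carrier Z) g f)"
    unfolding k(1) using mod_homD(1)[OF f] by (auto simp: compose_def intro!: restrict_ext)
  then show ?thesis using factors_through_freeI[OF mod_hom_compose[OF Z f k(2)] k(3)] by simp
qed

context
  assumes cring: "cring R"
begin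

interpretation cring R by (fact cring)

lemma compose_factors_through_free:
  assumes M: "module R M" and p: "p \<in> mod_hom R N L" and k: "k \<in> factors_through_free R M N"
  shows "compose (carrier M) p k \<in> factors_through_free R M L"
proof -
  obtain n g h where k: "k = compose (carrier M) h g" "g \<in> mod_hom R M (free_module R n)"
    "h \<in> mod_hom R (free_module R n) N"
    using k unfolding factors_through_free_def by blast
  have "compose (carrier M) p k = compose (carrier M) (compose (carrier (free_module R n)) p h) g"
    unfolding k(1) using mod_homD(1)[OF k(2)] by (auto simp: compose_def intro!: restrict_ext)
  then show ?thesis
    using factors_through_freeI[OF k(2) mod_hom_compose[OF module_free_module[OF cring] k(3) p]] by simp
qed

lemma factors_through_free_add:
  assumes M: "module R M" and N: "module R N"
    and f: "f \<in> factors_through_free R M N" and f': "f' \<in> factors_through_free R M N"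
  shows "(\<lambda>x\<in>carrier M. f x \<oplus>\<^bsub>N\<^esub> f' x) \<in> factors_through_free R M N"
proof -
  interpret M: module R M by fact
  interpret N: module R N by fact
  obtain n g h where f: "f = compose (carrier M) h g" "g \<in> mod_hom R M (free_module R n)"
    "h \<in> mod_hom R (free_module R n) N"
    using f unfolding factors_through_free_def by blast
  obtain m g' h' where f': "f' = compose (carrier M) h' g'" "g' \<in> mod_hom R M (free_module R m)"
    "h' \<in> mod_hom R (free_module R m) N"
    using f' unfolding factors_through_free_def by blast
  note FM = module_free_module[OF cring]
  \<comment> \<open>A sum of maps through R^n and R^m goes through R^(n+m). The second block of
    coordinates is shifted by \<open>n\<close>, and \<open>?a\<close> and \<open>?b\<close> recover
    the two blocks.\<close>
  let ?G = "\<lambda>x. \<lambda>i\<in>{..<n + m}. if i < n then g x i else g' x (i - n)"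
  let ?a = "\<lambda>z. \<lambda>i\<in>{..<n}. z i" and ?b = "\<lambda>z. \<lambda>i\<in>{..<m}. z (n + i)"
  have gc: "g x i \<in> carrier R" if "x \<in> carrier M" "i < n" for x i
    using mod_homD(1)[OF f(2) that(1)] that(2) by (auto simp: carrier_free_module)
  have gc': "g' x i \<in> carrier R" if "x \<in> carrier M" "i < m" for x i
    using mod_homD(1)[OF f'(2) that(1)] that(2) by (auto simp: carrier_free_module)
  have G: "restrict ?G (carrier M) \<in> mod_hom R M (free_module R (n + m))"
    by (rule mod_homI[OF M])
       (auto simp: free_module_simps mod_homD(2,3)[OF f(2)] mod_homD(2,3)[OF f'(2)] gc gc' intro!: restrict_ext)
  have pc: "z i \<in> carrier R" if "z \<in> carrier (free_module R (n + m))" "i < n + m" for z i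
    using that by (auto simp: carrier_free_module)
  have a: "restrict ?a (carrier (free_module R (n + m))) \<in> mod_hom R (free_module R (n + m)) (free_module R n)"
    by (rule mod_homI[OF FM])
       (auto simp: add_free_module smult_free_module pc carrier_free_module[where n = n] intro!: restrict_ext)
  have b: "restrict ?b (carrier (free_module R (n + m))) \<in> mod_hom R (free_module R (n + m)) (free_module R m)"
    by (rule mod_homI[OF FM])
       (auto simp: add_free_module smult_free_module pc carrier_free_module[where n = m] intro!: restrict_ext)
  let ?ha = "compose (carrier (free_module R (n + m))) h (restrict ?a (carrier (free_module R (n + m))))"
  let ?hb = "compose (carrier (free_module R (n + m))) h' (restrict ?b (carrier (free_module R (n + m))))"
  let ?H = "\<lambda>z\<in>carrier (free_module R (n + m)). ?ha z \<oplus>\<^bsub>N\<^esub> ?hb z"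
  have H: "?H \<in> mod_hom R (free_module R (n + m)) N"
    by (rule mod_hom_add[OF FM N mod_hom_compose[OF FM a f(3)] mod_hom_compose[OF FM b f'(3)]])
  have "(\<lambda>x\<in>carrier M. f x \<oplus>\<^bsub>N\<^esub> f' x) = compose (carrier M) ?H (restrict ?G (carrier M))"
    unfolding compose_def[of "carrier M" ?H]
  proof (rule restrict_ext)
    fix x assume x: "x \<in> carrier M"
    have Gx: "?G x \<in> carrier (free_module R (n + m))" using mod_homD(1)[OF G x] x by simp
    have "?a (?G x) = g x"
      using mod_homD(1)[OF f(2) x] by (auto simp: carrier_free_module PiE_iff extensional_def intro!: ext)
    moreover have "?b (?G x) = g' x"
      using mod_homD(1)[OF f'(2) x] by (auto simp: carrier_free_module PiE_iff extensional_def intro!: ext)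
    ultimately show "f x \<oplus>\<^bsub>N\<^esub> f' x = ?H (restrict ?G (carrier M) x)"
      using x Gx by (simp only: f(1) f'(1) compose_eq restrict_apply' if_True)
  qed
  then show ?thesis using factors_through_freeI[OF G H] by simp
qed

lemma subgroup_factors_through_free:
  assumes M: "module R M" and N: "module R N"
  shows "subgroup (factors_through_free R M N) (hom_group R M N)"
proof -
  interpret H: comm_group "hom_group R M N" by (rule hom_group_comm_group[OF M N])
  interpret N: module R N by fact
  note FM = module_free_module[OF cring]
  show ?thesis
  proof (rule H.subgroupI)
    show "factors_through_free R M N \<subseteq> carrier (hom_group R M N)"
      using factors_through_free_subset[OF M] by (simp add: hom_group_simps)
    have "(\<lambda>x\<in>carrier M. \<zero>\<^bsub>free_module R 0\<^esub>) \<in> mod_hom R M (free_module R 0)"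
      using group.is_monoid[THEN monoid.one_closed, OF comm_group.axioms(2)[OF hom_group_comm_group[OF M FM]]]
      by (simp add: hom_group_simps)
    moreover have "(\<lambda>x\<in>carrier (free_module R 0). \<zero>\<^bsub>N\<^esub>) \<in> mod_hom R (free_module R 0) N"
      using group.is_monoid[THEN monoid.one_closed, OF comm_group.axioms(2)[OF hom_group_comm_group[OF FM N]]]
      by (simp add: hom_group_simps)
    ultimately show "factors_through_free R M N \<noteq> {}" using factors_through_freeI by blast
    show "f \<otimes>\<^bsub>hom_group R M N\<^esub> g \<in> factors_through_free R M N"
      if "f \<in> factors_through_free R M N" "g \<in> factors_through_free R M N" for f g
      using factors_through_free_add[OF M N that] by (simp add: hom_group_simps)
    show "inv\<^bsub>hom_group R M N\<^esub> f \<in> factors_through_free R M N" if f: "f \<in> factors_through_free R M N" for f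
    proof -
      have fh: "f \<in> mod_hom R M N" using f factors_through_free_subset[OF M] by blast
      \<comment> \<open>The negative of \<open>f\<close> is the composite of \<open>f\<close> with
        -id, so it inherits a factorization from
        \<open>compose_factors_through_free\<close>.\<close>
      interpret HN: comm_group "hom_group R N N" by (rule hom_group_comm_group[OF N N])
      have id: "(\<lambda>x\<in>carrier N. x) \<in> mod_hom R N N" by (rule mod_hom_id[OF N])
      have "inv\<^bsub>hom_group R N N\<^esub> (\<lambda>x\<in>carrier N. x) \<in> mod_hom R N N"
        using HN.inv_closed[of "\<lambda>x\<in>carrier N. x"] id by (simp add: hom_group_simps)
      then have "compose (carrier M) (inv\<^bsub>hom_group R N N\<^esub> (\<lambda>x\<in>carrier N. x)) f \<in> factors_through_free R M N"
        by (rule compose_factors_through_free[OF M _ f])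
      moreover have "compose (carrier M) (inv\<^bsub>hom_group R N N\<^esub> (\<lambda>x\<in>carrier N. x)) f = inv\<^bsub>hom_group R M N\<^esub> f"
        unfolding hom_group_inv[OF N N id] hom_group_inv[OF M N fh]
        using mod_homD(1)[OF fh] by (auto simp: compose_def intro!: restrict_ext)
      ultimately show ?thesis by simp
    qed
  qed
qed

end

end

lemma MCM_module: "M \<in> MCM R \<Longrightarrow> module R M"
  unfolding MCM_def by blast

text \<open>A subfunctor \<open>T\<close> of \<open>Hom(-, L)\<close> containing the maps through free modules; \<open>Hom(-, L) / T\<close> is
  then a functor on the stable category.\<close>

locale hom_subfunctor =
  fixes R :: "'a ring" (structure) and L :: "'a rmod" and T :: "'a rmod \<Rightarrow> ('a elt \<Rightarrow> 'a elt) set"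
  assumes cring: "cring R" and L: "L \<in> MCM R"
    and T_subgroup: "\<And>Z. Z \<in> MCM R \<Longrightarrow> subgroup (T Z) (hom_group R Z L)"
    and T_free: "\<And>Z. Z \<in> MCM R \<Longrightarrow> factors_through_free R Z L \<subseteq> T Z"
    and T_compose: "\<And>Z Y g f. Z \<in> MCM R \<Longrightarrow> Y \<in> MCM R \<Longrightarrow> g \<in> T Y \<Longrightarrow> f \<in> mod_hom R Z Y \<Longrightarrow>
       compose (carrier Z) g f \<in> T Z"
begin

abbreviation cl :: "'a rmod \<Rightarrow> ('a elt \<Rightarrow> 'a elt) \<Rightarrow> 'a shom" where
  "cl Z f \<equiv> T Z #>\<^bsub>hom_group R Z L\<^esub> f"

definition quot_functor :: "('a, 'a shom) contrafunctor" where
  "quot_functor = \<lparr>ob = (\<lambda>Z. hom_group R Z L Mod T Z),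
     ar = (\<lambda>Z Y u v. \<Union>g\<in>v. \<Union>f\<in>u. cl Z (compose (carrier Z) g f))\<rparr>"

lemma hom_comm_group: "Z \<in> MCM R \<Longrightarrow> comm_group (hom_group R Z L)"
  using hom_group_comm_group MCM_module L by blast

lemma cl_repr: "Z \<in> MCM R \<Longrightarrow> f \<in> mod_hom R Z L \<Longrightarrow> g \<in> cl Z f \<Longrightarrow> cl Z g = cl Z f"
  by (rule comm_group.coset_repr[OF hom_comm_group T_subgroup]) (simp_all add: hom_group_simps)

lemma cl_self: "Z \<in> MCM R \<Longrightarrow> f \<in> mod_hom R Z L \<Longrightarrow> f \<in> cl Z f"
  using group.rcos_self[OF comm_group.axioms(2)[OF hom_comm_group] _ T_subgroup]
  by (simp add: hom_group_simps)

lemma cl_eqI: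
  assumes Z: "Z \<in> MCM R" and f: "f \<in> mod_hom R Z L" and t: "t \<in> T Z"
    and g: "g = (\<lambda>x\<in>carrier Z. t x \<oplus>\<^bsub>L\<^esub> f x)"
  shows "cl Z g = cl Z f"
  by (rule cl_repr[OF Z f]) (use t g in \<open>auto simp: r_coset_def hom_group_simps\<close>)

lemma cl_exhaust: "Z \<in> MCM R \<Longrightarrow> v \<in> carrier (hom_group R Z L Mod T Z) \<Longrightarrow> \<exists>f\<in>mod_hom R Z L. v = cl Z f"
  using comm_group.coset_exhaust[OF hom_comm_group] by (simp add: hom_group_simps)

lemma T_hom: "Z \<in> MCM R \<Longrightarrow> T Z \<subseteq> mod_hom R Z L"
  using subgroup.subset[OF T_subgroup] by (simp add: hom_group_simps)

lemma mem_cl: "g \<in> cl Z f \<longleftrightarrow> (\<exists>t\<in>T Z. g = (\<lambda>x\<in>carrier Z. t x \<oplus>\<^bsub>L\<^esub> f x))"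
  by (auto simp: r_coset_def hom_group_simps)

end

lemma hom_subfunctor_free:
  assumes "cring R" "L \<in> MCM R"
  shows "hom_subfunctor R L (\<lambda>Z. factors_through_free R Z L)"
proof (rule hom_subfunctor.intro[OF assms])
  show "subgroup (factors_through_free R Z L) (hom_group R Z L)" if "Z \<in> MCM R" for Z
    by (rule subgroup_factors_through_free[OF assms(1) MCM_module[OF that] MCM_module[OF assms(2)]])
  show "compose (carrier Z) g f \<in> factors_through_free R Z L"
    if "Z \<in> MCM R" "Y \<in> MCM R" "g \<in> factors_through_free R Y L" "f \<in> mod_hom R Z Y" for Z Y g f
    by (rule factors_through_free_compose[OF MCM_module[OF that(1)] MCM_module[OF that(2)] that(4,3)])
qed simp

text \<open>The smallest admissible subfunctor gives the representable functor. Functoriality is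
  thus proved once, for representable functors and cokernels alike.\<close>

lemma representable_eq_quot_functor:
  assumes "cring R" "L \<in> MCM R"
  shows "representable R L = hom_subfunctor.quot_functor R L (\<lambda>Z. factors_through_free R Z L)"
  unfolding representable_def hom_subfunctor.quot_functor_def[OF hom_subfunctor_free[OF assms]]
    stable_hom_def stable_comp_def stable_class_def ..

context hom_subfunctor
begin

lemma stable_exhaust:
  assumes Z: "Z \<in> MCM R" and Y: "Y \<in> MCM R" and u: "u \<in> carrier (stable_hom R Z Y)"
  shows "\<exists>f\<in>mod_hom R Z Y. u = stable_class R Z Y f"
  using hom_subfunctor.cl_exhaust[OF hom_subfunctor_free[OF cring Y] Z] u
  unfolding stable_hom_def stable_class_def by simp

text \<open>For other representatives t + g and s + f the composite is t f' + g s + g f with f' = s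
  + f. The first term is in \<open>T\<close> because \<open>T\<close> is a subfunctor, the second
  because it goes through a free module.\<close>

lemma ar_quot_functor:
  assumes Z: "Z \<in> MCM R" and Y: "Y \<in> MCM R" and f: "f \<in> mod_hom R Z Y" and g: "g \<in> mod_hom R Y L"
  shows "ar quot_functor Z Y (stable_class R Z Y f) (cl Y g) = cl Z (compose (carrier Z) g f)"
proof -
  interpret S: hom_subfunctor R Y "\<lambda>Z. factors_through_free R Z Y" by (rule hom_subfunctor_free[OF cring Y])
  note ZM = MCM_module[OF Z] and YM = MCM_module[OF Y] and LM = MCM_module[OF L]
  interpret Z: module R Z by (rule ZM)
  interpret Y: module R Y by (rule YM)
  interpret L: module R L by (rule LM)
  have *: "cl Z (compose (carrier Z) g' f') = cl Z (compose (carrier Z) g f)"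
    if g': "g' \<in> cl Y g" and f': "f' \<in> stable_class R Z Y f" for g' f'
  proof -
    obtain t where t: "t \<in> T Y" "g' = (\<lambda>x\<in>carrier Y. t x \<oplus>\<^bsub>L\<^esub> g x)"
      using g' unfolding mem_cl by blast
    obtain s where s: "s \<in> factors_through_free R Z Y" "f' = (\<lambda>x\<in>carrier Z. s x \<oplus>\<^bsub>Y\<^esub> f x)"
      using f' unfolding stable_class_def S.mem_cl by blast
    have th: "t \<in> mod_hom R Y L" using T_hom[OF Y] t by blast
    have sh: "s \<in> mod_hom R Z Y" using S.T_hom[OF Z] s by blast
    have fh: "f' \<in> mod_hom R Z Y" unfolding s(2) by (rule mod_hom_add[OF ZM YM sh f])
    have gs: "compose (carrier Z) g s \<in> T Z"
      using compose_factors_through_free[OF cring ZM g s(1)] T_free[OF Z] by blast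
    have tf: "compose (carrier Z) t f' \<in> T Z" by (rule T_compose[OF Z Y t(1) fh])
    have "subgroup (T Z) (hom_group R Z L)" by (rule T_subgroup[OF Z])
    then have "compose (carrier Z) t f' \<otimes>\<^bsub>hom_group R Z L\<^esub> compose (carrier Z) g s \<in> T Z"
      using tf gs by (rule subgroup.m_closed)
    then have w: "(\<lambda>x\<in>carrier Z. compose (carrier Z) t f' x \<oplus>\<^bsub>L\<^esub> compose (carrier Z) g s x) \<in> T Z"
      by (simp add: hom_group_simps)
    show ?thesis
    proof (rule cl_eqI[OF Z mod_hom_compose[OF ZM f g] w])
      show "compose (carrier Z) g' f' = (\<lambda>x\<in>carrier Z.
          (\<lambda>x\<in>carrier Z. compose (carrier Z) t f' x \<oplus>\<^bsub>L\<^esub> compose (carrier Z) g s x) x \<oplus>\<^bsub>L\<^esub> compose (carrier Z) g f x)"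
        unfolding compose_def[of "carrier Z" g']
      proof (rule restrict_ext)
        fix x assume x: "x \<in> carrier Z"
        have c: "f x \<in> carrier Y" "s x \<in> carrier Y" "f' x \<in> carrier Y"
          using mod_homD(1)[OF f x] mod_homD(1)[OF sh x] mod_homD(1)[OF fh x] by auto
        have d: "t (f' x) \<in> carrier L" "g (s x) \<in> carrier L" "g (f x) \<in> carrier L"
          using c mod_homD(1)[OF th] mod_homD(1)[OF g] by auto
        have "g' (f' x) = t (f' x) \<oplus>\<^bsub>L\<^esub> g (f' x)" using c t(2) by simp
        also have "g (f' x) = g (s x) \<oplus>\<^bsub>L\<^esub> g (f x)" using s(2) x c mod_homD(2)[OF g] by simp
        finally show "g' (f' x) = (\<lambda>x\<in>carrier Z. compose (carrier Z) t f' x \<oplus>\<^bsub>L\<^esub> compose (carrier Z) g s x) x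
            \<oplus>\<^bsub>L\<^esub> compose (carrier Z) g f x"
          using x d by (simp add: compose_eq L.M.a_assoc)
      qed
    qed
  qed
  have fs: "f \<in> stable_class R Z Y f" using S.cl_self[OF Z f] unfolding stable_class_def .
  show ?thesis
    unfolding quot_functor_def contrafunctor.simps
    by (rule UN_constant_eq[OF cl_self[OF Y g]], rule UN_constant_eq[OF fs]) (rule *)
qed

lemma cl_mult:
  "Z \<in> MCM R \<Longrightarrow> f \<in> mod_hom R Z L \<Longrightarrow> g \<in> mod_hom R Z L \<Longrightarrow>
    cl Z f \<otimes>\<^bsub>hom_group R Z L Mod T Z\<^esub> cl Z g = cl Z (\<lambda>x\<in>carrier Z. f x \<oplus>\<^bsub>L\<^esub> g x)"
  using comm_group.coset_mult[OF hom_comm_group T_subgroup] by (simp add: hom_group_simps)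

lemma cl_carrier: "Z \<in> MCM R \<Longrightarrow> f \<in> mod_hom R Z L \<Longrightarrow> cl Z f \<in> carrier (hom_group R Z L Mod T Z)"
  using comm_group.coset_carrier[OF hom_comm_group] by (simp add: hom_group_simps)

lemma ob_quot_functor: "ob quot_functor Z = hom_group R Z L Mod T Z"
  by (simp add: quot_functor_def)

text \<open>Composition in the stable category is the action of the representable functor on arrows,
  so this is an instance of \<open>ar_quot_functor\<close>.\<close>

lemma stable_comp_class:
  assumes Z: "Z \<in> MCM R" and Y: "Y \<in> MCM R" and W: "W \<in> MCM R"
    and f: "f \<in> mod_hom R Z Y" and g: "g \<in> mod_hom R Y W"
  shows "stable_comp R Z Y W (stable_class R Y W g) (stable_class R Z Y f) =
    stable_class R Z W (compose (carrier Z) g f)"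
  using hom_subfunctor.ar_quot_functor[OF hom_subfunctor_free[OF cring W] Z Y f g]
    representable_eq_quot_functor[OF cring W]
  by (metis (no_types, lifting) contrafunctor.simps(2) representable_def stable_class_def)

lemma stable_mult_class:
  assumes Z: "Z \<in> MCM R" and Y: "Y \<in> MCM R" and f: "f \<in> mod_hom R Z Y" and g: "g \<in> mod_hom R Z Y"
  shows "stable_class R Z Y f \<otimes>\<^bsub>stable_hom R Z Y\<^esub> stable_class R Z Y g =
    stable_class R Z Y (\<lambda>x\<in>carrier Z. f x \<oplus>\<^bsub>Y\<^esub> g x)"
  using hom_subfunctor.cl_mult[OF hom_subfunctor_free[OF cring Y] Z f g]
  unfolding stable_hom_def stable_class_def .

lemma compose_id_right: "f \<in> mod_hom R Z L' \<Longrightarrow> compose (carrier Z) f (\<lambda>x\<in>carrier Z. x) = f"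
  using mod_homD(4)[of f R Z L'] by (auto simp: compose_def extensional_def intro!: ext)

lemma compose_id_left: "f \<in> mod_hom R Z L' \<Longrightarrow> compose (carrier Z) (\<lambda>x\<in>carrier L'. x) f = f"
  using mod_homD(1,4)[of f R Z L'] by (auto simp: compose_def extensional_def intro!: ext)

theorem additive_functor_quot_functor: "additive_functor R quot_functor"
  unfolding additive_functor_def
proof (intro conjI ballI)
  note ar = ar_quot_functor and ob = ob_quot_functor
  show "comm_group (ob quot_functor Z)" if "Z \<in> MCM R" for Z
    unfolding ob using comm_group.abelian_FactGroup[OF hom_comm_group[OF that] T_subgroup[OF that]] .
  show "ar quot_functor Z Y u \<in> hom (ob quot_functor Y) (ob quot_functor Z)"
    if Z: "Z \<in> MCM R" and Y: "Y \<in> MCM R" and u: "u \<in> carrier (stable_hom R Z Y)" for Z Y u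
  proof -
    obtain f where f: "f \<in> mod_hom R Z Y" "u = stable_class R Z Y f" using stable_exhaust[OF Z Y u] by blast
    show ?thesis
      unfolding ob
    proof (rule homI)
      fix v assume "v \<in> carrier (hom_group R Y L Mod T Y)"
      then obtain g where g: "g \<in> mod_hom R Y L" "v = cl Y g" using cl_exhaust[OF Y] by blast
      show "ar quot_functor Z Y u v \<in> carrier (hom_group R Z L Mod T Z)"
        unfolding f(2) g(2) ar[OF Z Y f(1) g(1)]
        by (rule cl_carrier[OF Z mod_hom_compose[OF MCM_module[OF Z] f(1) g(1)]])
      fix v' assume "v' \<in> carrier (hom_group R Y L Mod T Y)"
      then obtain g' where g': "g' \<in> mod_hom R Y L" "v' = cl Y g'" using cl_exhaust[OF Y] by blast
      have s: "(\<lambda>x\<in>carrier Y. g x \<oplus>\<^bsub>L\<^esub> g' x) \<in> mod_hom R Y L"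
        by (rule mod_hom_add[OF MCM_module[OF Y] MCM_module[OF L] g(1) g'(1)])
      have "compose (carrier Z) (\<lambda>x\<in>carrier Y. g x \<oplus>\<^bsub>L\<^esub> g' x) f =
          (\<lambda>x\<in>carrier Z. compose (carrier Z) g f x \<oplus>\<^bsub>L\<^esub> compose (carrier Z) g' f x)"
        using mod_homD(1)[OF f(1)] by (auto simp: compose_def intro!: restrict_ext)
      then show "ar quot_functor Z Y u (v \<otimes>\<^bsub>hom_group R Y L Mod T Y\<^esub> v') =
          ar quot_functor Z Y u v \<otimes>\<^bsub>hom_group R Z L Mod T Z\<^esub> ar quot_functor Z Y u v'"
        unfolding f(2) g(2) g'(2) cl_mult[OF Y g(1) g'(1)] ar[OF Z Y f(1) g(1)] ar[OF Z Y f(1) g'(1)]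
          ar[OF Z Y f(1) s]
          cl_mult[OF Z mod_hom_compose[OF MCM_module[OF Z] f(1) g(1)] mod_hom_compose[OF MCM_module[OF Z] f(1) g'(1)]]
        by simp
    qed
  qed
next
  fix Z v assume Z: "Z \<in> MCM R" and "v \<in> carrier (ob quot_functor Z)"
  then obtain g where g: "g \<in> mod_hom R Z L" "v = cl Z g"
    using cl_exhaust[OF Z] unfolding ob_quot_functor by blast
  show "ar quot_functor Z Z (stable_id R Z) v = v"
    unfolding stable_id_def g(2) ar_quot_functor[OF Z Z mod_hom_id[OF MCM_module[OF Z]] g(1)]
      compose_id_right[OF g(1)] ..
next
  fix Z Y W u v x
  assume Z: "Z \<in> MCM R" and Y: "Y \<in> MCM R" and W: "W \<in> MCM R" and "u \<in> carrier (stable_hom R Z Y)"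
    "v \<in> carrier (stable_hom R Y W)" "x \<in> carrier (ob quot_functor W)"
  then obtain f h g where f: "f \<in> mod_hom R Z Y" "u = stable_class R Z Y f"
    and h: "h \<in> mod_hom R Y W" "v = stable_class R Y W h" and g: "g \<in> mod_hom R W L" "x = cl W g"
    using stable_exhaust cl_exhaust[OF W] unfolding ob_quot_functor by metis
  have "compose (carrier Z) g (compose (carrier Z) h f) = compose (carrier Z) (compose (carrier Y) g h) f"
    using mod_homD(1)[OF f(1)] by (auto simp: compose_def intro!: restrict_ext)
  then show "ar quot_functor Z W (stable_comp R Z Y W v u) x = ar quot_functor Z Y u (ar quot_functor Y W v x)"
    unfolding f(2) h(2) g(2) stable_comp_class[OF Z Y W f(1) h(1)] ar_quot_functor[OF Y W h(1) g(1)]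
      ar_quot_functor[OF Z W mod_hom_compose[OF MCM_module[OF Z] f(1) h(1)] g(1)]
      ar_quot_functor[OF Z Y f(1) mod_hom_compose[OF MCM_module[OF Y] h(1) g(1)]]
    by simp
next
  fix Z Y u v x
  assume Z: "Z \<in> MCM R" and Y: "Y \<in> MCM R" and "u \<in> carrier (stable_hom R Z Y)"
    "v \<in> carrier (stable_hom R Z Y)" "x \<in> carrier (ob quot_functor Y)"
  then obtain f h g where f: "f \<in> mod_hom R Z Y" "u = stable_class R Z Y f"
    and h: "h \<in> mod_hom R Z Y" "v = stable_class R Z Y h" and g: "g \<in> mod_hom R Y L" "x = cl Y g"
    using stable_exhaust cl_exhaust[OF Y] unfolding ob_quot_functor by metis
  have s: "(\<lambda>x\<in>carrier Z. f x \<oplus>\<^bsub>Y\<^esub> h x) \<in> mod_hom R Z Y"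
    by (rule mod_hom_add[OF MCM_module[OF Z] MCM_module[OF Y] f(1) h(1)])
  have "compose (carrier Z) g (\<lambda>x\<in>carrier Z. f x \<oplus>\<^bsub>Y\<^esub> h x) =
      (\<lambda>x\<in>carrier Z. compose (carrier Z) g f x \<oplus>\<^bsub>L\<^esub> compose (carrier Z) g h x)"
    using mod_homD(1)[OF f(1)] mod_homD(1)[OF h(1)]
    by (auto simp: compose_def mod_homD(2)[OF g(1)] intro!: restrict_ext)
  then show "ar quot_functor Z Y (u \<otimes>\<^bsub>stable_hom R Z Y\<^esub> v) x =
      ar quot_functor Z Y u x \<otimes>\<^bsub>ob quot_functor Z\<^esub> ar quot_functor Z Y v x"
    unfolding ob_quot_functor f(2) h(2) g(2) stable_mult_class[OF Z Y f(1) h(1)] ar_quot_functor[OF Z Y f(1) g(1)]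
      ar_quot_functor[OF Z Y h(1) g(1)] ar_quot_functor[OF Z Y s g(1)]
      cl_mult[OF Z mod_hom_compose[OF MCM_module[OF Z] f(1) g(1)] mod_hom_compose[OF MCM_module[OF Z] h(1) g(1)]]
    by simp
qed

text \<open>Composition with \<open>p\<close> as a map between quotients of Hom functors. It is well
  defined when \<open>p\<close> carries the source subfunctor into \<open>T\<close>, which is the
  condition \<open>pS\<close> in the lemmas about it.\<close>

definition push :: "('a elt \<Rightarrow> 'a elt) \<Rightarrow> 'a rmod \<Rightarrow> 'a shom \<Rightarrow> 'a shom" where
  "push p Z v = (\<Union>g\<in>v. cl Z (compose (carrier Z) p g))"

lemma push_cl:
  assumes S: "hom_subfunctor R N S" and p: "p \<in> mod_hom R N L"
    and pS: "\<forall>Z\<in>MCM R. \<forall>s\<in>S Z. compose (carrier Z) p s \<in> T Z"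
    and Z: "Z \<in> MCM R" and g: "g \<in> mod_hom R Z N"
  shows "push p Z (S Z #>\<^bsub>hom_group R Z N\<^esub> g) = cl Z (compose (carrier Z) p g)"
proof -
  interpret S: hom_subfunctor R N S by (rule S)
  show ?thesis
    unfolding push_def
  proof (rule UN_constant_eq[OF S.cl_self[OF Z g]])
    fix g' assume "g' \<in> S.cl Z g"
    then obtain s where s: "s \<in> S Z" "g' = (\<lambda>x\<in>carrier Z. s x \<oplus>\<^bsub>N\<^esub> g x)" unfolding S.mem_cl by blast
    have sh: "s \<in> mod_hom R Z N" using S.T_hom[OF Z] s(1) by blast
    show "cl Z (compose (carrier Z) p g') = cl Z (compose (carrier Z) p g)"
    proof (rule cl_eqI[OF Z mod_hom_compose[OF MCM_module[OF Z] g p] pS[rule_format, OF Z s(1)]])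
      show "compose (carrier Z) p g' =
          (\<lambda>x\<in>carrier Z. compose (carrier Z) p s x \<oplus>\<^bsub>L\<^esub> compose (carrier Z) p g x)"
        using mod_homD(1)[OF sh] mod_homD(1)[OF g] unfolding s(2)
        by (auto simp: compose_def mod_homD(2)[OF p] intro!: restrict_ext)
    qed
  qed
qed

lemma nat_trans_push:
  assumes S: "hom_subfunctor R N S" and p: "p \<in> mod_hom R N L"
    and pS: "\<forall>Z\<in>MCM R. \<forall>s\<in>S Z. compose (carrier Z) p s \<in> T Z"
  shows "nat_trans R (hom_subfunctor.quot_functor R N S) quot_functor (push p)"
  unfolding nat_trans_def
proof (intro conjI ballI)
  interpret S: hom_subfunctor R N S by (rule S)
  note push = push_cl[OF S p pS]
  show "push p Z \<in> hom (ob S.quot_functor Z) (ob quot_functor Z)" if Z: "Z \<in> MCM R" for Z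
    unfolding ob_quot_functor S.ob_quot_functor
  proof (rule homI)
    note ZM = MCM_module[OF Z]
    fix v assume "v \<in> carrier (hom_group R Z N Mod S Z)"
    then obtain g where g: "g \<in> mod_hom R Z N" "v = S.cl Z g" using S.cl_exhaust[OF Z] by blast
    show "push p Z v \<in> carrier (hom_group R Z L Mod T Z)"
      unfolding g(2) push[OF Z g(1)] by (rule cl_carrier[OF Z mod_hom_compose[OF ZM g(1) p]])
    fix v' assume "v' \<in> carrier (hom_group R Z N Mod S Z)"
    then obtain g' where g': "g' \<in> mod_hom R Z N" "v' = S.cl Z g'" using S.cl_exhaust[OF Z] by blast
    have s: "(\<lambda>x\<in>carrier Z. g x \<oplus>\<^bsub>N\<^esub> g' x) \<in> mod_hom R Z N"
      by (rule mod_hom_add[OF ZM MCM_module[OF S.L] g(1) g'(1)])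
    have "compose (carrier Z) p (\<lambda>x\<in>carrier Z. g x \<oplus>\<^bsub>N\<^esub> g' x) =
        (\<lambda>x\<in>carrier Z. compose (carrier Z) p g x \<oplus>\<^bsub>L\<^esub> compose (carrier Z) p g' x)"
      using mod_homD(1)[OF g(1)] mod_homD(1)[OF g'(1)]
      by (auto simp: compose_def mod_homD(2)[OF p] intro!: restrict_ext)
    then show "push p Z (v \<otimes>\<^bsub>hom_group R Z N Mod S Z\<^esub> v') =
        push p Z v \<otimes>\<^bsub>hom_group R Z L Mod T Z\<^esub> push p Z v'"
      unfolding g(2) g'(2) S.cl_mult[OF Z g(1) g'(1)] push[OF Z g(1)] push[OF Z g'(1)] push[OF Z s]
        cl_mult[OF Z mod_hom_compose[OF ZM g(1) p] mod_hom_compose[OF ZM g'(1) p]] by simp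
  qed
  fix Z Y u x
  assume Z: "Z \<in> MCM R" and Y: "Y \<in> MCM R" and u: "u \<in> carrier (stable_hom R Z Y)"
    and x: "x \<in> carrier (ob S.quot_functor Y)"
  obtain f where f: "f \<in> mod_hom R Z Y" "u = stable_class R Z Y f" using stable_exhaust[OF Z Y u] by blast
  obtain g where g: "g \<in> mod_hom R Y N" "x = S.cl Y g"
    using S.cl_exhaust[OF Y] x unfolding S.ob_quot_functor by blast
  have "compose (carrier Z) p (compose (carrier Z) g f) = compose (carrier Z) (compose (carrier Y) p g) f"
    using mod_homD(1)[OF f(1)] by (auto simp: compose_def intro!: restrict_ext)
  then show "push p Z (ar S.quot_functor Z Y u x) = ar quot_functor Z Y u (push p Y x)"
    unfolding f(2) g(2) S.ar_quot_functor[OF Z Y f(1) g(1)] push[OF Y g(1)]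
      push[OF Z mod_hom_compose[OF MCM_module[OF Z] f(1) g(1)]]
      ar_quot_functor[OF Z Y f(1) mod_hom_compose[OF MCM_module[OF Y] g(1) p]] by simp
qed

end

section \<open>Cokernel functors and the Yoneda reduction\<close>

lemma trivial_group_bij_iff:
  assumes G: "group G" and H: "group H" and h: "h \<in> hom G H" and bij: "bij_betw h (carrier G) (carrier H)"
  shows "trivial_group H \<longleftrightarrow> trivial_group G"
proof
  have one: "h \<one>\<^bsub>G\<^esub> = \<one>\<^bsub>H\<^esub>" by (rule hom_one[OF h G H])
  assume "trivial_group H"
  then have "h x = h \<one>\<^bsub>G\<^esub>" if "x \<in> carrier G" for x
    using bij_betwE[OF bij] that unfolding one trivial_group_def by simp
  then have "x = \<one>\<^bsub>G\<^esub>" if "x \<in> carrier G" for x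
    using inj_onD[OF bij_betw_imp_inj_on[OF bij]] that monoid.one_closed[OF group.is_monoid[OF G]] by blast
  then show "trivial_group G"
    using G monoid.one_closed[OF group.is_monoid[OF G]] unfolding trivial_group_def by blast
next
  have one: "h \<one>\<^bsub>G\<^esub> = \<one>\<^bsub>H\<^esub>" by (rule hom_one[OF h G H])
  assume "trivial_group G"
  then show "trivial_group H"
    using bij_betw_imp_surj_on[OF bij, symmetric] H one unfolding trivial_group_def by simp
qed

lemma additive_functor_comm_group:
  "additive_functor R F \<Longrightarrow> Z \<in> MCM R \<Longrightarrow> comm_group (ob F Z)"
  unfolding additive_functor_def by (drule conjunct1) (erule bspec)

text \<open>The kernel of the composite of Hom(-, L) with the cokernel of Hom(-, N) -> Hom(-, L),
  computed in honest module maps. The summand \<open>k\<close> accounts for passing to the stable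
  category.\<close>

definition factor_maps ::
    "'a ring \<Rightarrow> 'a rmod \<Rightarrow> 'a rmod \<Rightarrow> ('a elt \<Rightarrow> 'a elt) \<Rightarrow> 'a rmod \<Rightarrow> ('a elt \<Rightarrow> 'a elt) set" where
  "factor_maps R N L p Z = {f \<in> mod_hom R Z L. \<exists>w\<in>mod_hom R Z N. \<exists>k\<in>factors_through_free R Z L.
     \<forall>x\<in>carrier Z. f x = k x \<oplus>\<^bsub>L\<^esub> p (w x)}"

lemma factor_mapsI:
  assumes cring: "cring R" and Z: "module R Z" and L: "module R L" and p: "p \<in> mod_hom R N L"
    and w: "w \<in> mod_hom R Z N" and k: "k \<in> factors_through_free R Z L"
    and f: "f = (\<lambda>x\<in>carrier Z. k x \<oplus>\<^bsub>L\<^esub> compose (carrier Z) p w x)"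
  shows "f \<in> factor_maps R N L p Z"
proof -
  have "f \<in> mod_hom R Z L"
    unfolding f using factors_through_free_subset[OF Z] k
    by (intro mod_hom_add[OF Z L _ mod_hom_compose[OF Z w p]]) blast
  then show ?thesis
    unfolding factor_maps_def using w k by (auto simp: f compose_eq)
qed

lemma factor_mapsE:
  assumes "f \<in> factor_maps R N L p Z"
  obtains w k where "w \<in> mod_hom R Z N" "k \<in> factors_through_free R Z L" "f \<in> mod_hom R Z L"
    "f = (\<lambda>x\<in>carrier Z. k x \<oplus>\<^bsub>L\<^esub> compose (carrier Z) p w x)"
proof -
  obtain w k where w: "f \<in> mod_hom R Z L" "w \<in> mod_hom R Z N" "k \<in> factors_through_free R Z L"
    "\<forall>x\<in>carrier Z. f x = k x \<oplus>\<^bsub>L\<^esub> p (w x)"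
    using assms unfolding factor_maps_def by blast
  have "f = (\<lambda>x\<in>carrier Z. k x \<oplus>\<^bsub>L\<^esub> compose (carrier Z) p w x)"
    by (rule extensionalityI[OF mod_homD(4)[OF w(1)] restrict_extensional]) (use w(4) in \<open>simp add: compose_eq\<close>)
  then show ?thesis using that w by blast
qed

lemma hom_subfunctor_factor_maps:
  assumes cring: "cring R" and N: "N \<in> MCM R" and L: "L \<in> MCM R" and p: "p \<in> mod_hom R N L"
  shows "hom_subfunctor R L (factor_maps R N L p)"
proof (rule hom_subfunctor.intro[OF cring L])
  note LM = MCM_module[OF L] and NM = MCM_module[OF N]
  interpret L: module R L by (rule LM)
  fix Z assume Z: "Z \<in> MCM R"
  note ZM = MCM_module[OF Z]
  interpret H: comm_group "hom_group R Z L" by (rule hom_group_comm_group[OF ZM LM])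
  interpret HN: comm_group "hom_group R Z N" by (rule hom_group_comm_group[OF ZM NM])
  note FT = subgroup_factors_through_free[OF cring ZM LM]
  let ?c = "compose (carrier Z) p"
  have "group_hom (hom_group R Z N) (hom_group R Z L) ?c"
  proof (rule group_hom.intro)
    show "group_hom_axioms (hom_group R Z N) (hom_group R Z L) ?c"
      unfolding group_hom_axioms_def hom_def hom_group_simps
      using mod_hom_compose[OF ZM _ p]
      by (auto simp: compose_def mod_homD(1) mod_homD(2)[OF p] intro!: restrict_ext)
  qed unfold_locales
  then have im: "subgroup (?c ` mod_hom R Z N) (hom_group R Z L)"
    using group_hom.img_is_subgroup by (fastforce simp: hom_group_simps)
  have eq: "factor_maps R N L p Z = factors_through_free R Z L <#>\<^bsub>hom_group R Z L\<^esub> ?c ` mod_hom R Z N"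
  proof
    show "factor_maps R N L p Z \<subseteq> factors_through_free R Z L <#>\<^bsub>hom_group R Z L\<^esub> ?c ` mod_hom R Z N"
    proof
      fix f assume "f \<in> factor_maps R N L p Z"
      then obtain w k where "w \<in> mod_hom R Z N" "k \<in> factors_through_free R Z L"
        "f = (\<lambda>x\<in>carrier Z. k x \<oplus>\<^bsub>L\<^esub> compose (carrier Z) p w x)" by (rule factor_mapsE)
      then show "f \<in> factors_through_free R Z L <#>\<^bsub>hom_group R Z L\<^esub> ?c ` mod_hom R Z N"
        unfolding set_mult_def hom_group_simps by blast
    qed
    show "factors_through_free R Z L <#>\<^bsub>hom_group R Z L\<^esub> ?c ` mod_hom R Z N \<subseteq> factor_maps R N L p Z"
      unfolding set_mult_def hom_group_simps using factor_mapsI[OF cring ZM LM p] by blast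
  qed
  show "subgroup (factor_maps R N L p Z) (hom_group R Z L)"
    unfolding eq by (rule H.mult_subgroups[OF FT im])
  show "factors_through_free R Z L \<subseteq> factor_maps R N L p Z"
  proof
    fix k assume k: "k \<in> factors_through_free R Z L"
    have kh: "k \<in> mod_hom R Z L" using k factors_through_free_subset[OF ZM] by blast
    have z: "(\<lambda>x\<in>carrier Z. \<zero>\<^bsub>N\<^esub>) \<in> mod_hom R Z N" using HN.one_closed by (simp add: hom_group_simps)
    have "k = (\<lambda>x\<in>carrier Z. k x \<oplus>\<^bsub>L\<^esub> compose (carrier Z) p (\<lambda>x\<in>carrier Z. \<zero>\<^bsub>N\<^esub>) x)"
      by (rule extensionalityI[OF mod_homD(4)[OF kh] restrict_extensional])
         (use mod_homD(1)[OF kh] mod_hom_zero[OF NM LM p] in \<open>simp add: compose_eq\<close>)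
    then show "k \<in> factor_maps R N L p Z" by (rule factor_mapsI[OF cring ZM LM p z k])
  qed
next
  note LM = MCM_module[OF L] and NM = MCM_module[OF N]
  fix Z Y g f
  assume Z: "Z \<in> MCM R" and Y: "Y \<in> MCM R" and g: "g \<in> factor_maps R N L p Y" and f: "f \<in> mod_hom R Z Y"
  note ZM = MCM_module[OF Z] and YM = MCM_module[OF Y]
  obtain w k where w: "w \<in> mod_hom R Y N" "k \<in> factors_through_free R Y L"
    "g = (\<lambda>x\<in>carrier Y. k x \<oplus>\<^bsub>L\<^esub> compose (carrier Y) p w x)" using g by (rule factor_mapsE)
  have "compose (carrier Z) g f =
      (\<lambda>x\<in>carrier Z. compose (carrier Z) k f x \<oplus>\<^bsub>L\<^esub> compose (carrier Z) p (compose (carrier Z) w f) x)"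
    unfolding w(3) using mod_homD(1)[OF f] by (auto simp: compose_def intro!: restrict_ext)
  then show "compose (carrier Z) g f \<in> factor_maps R N L p Z"
    by (rule factor_mapsI[OF cring ZM LM p mod_hom_compose[OF ZM f w(1)]
          factors_through_free_compose[OF ZM YM f w(2)]])
qed

text \<open>Translation between honest maps and stable classes: \<open>k\<close> is exactly the
  ambiguity of a representative.\<close>

lemma coset_factor_maps:
  assumes cring: "cring R" and N: "N \<in> MCM R" and L: "L \<in> MCM R" and p: "p \<in> mod_hom R N L"
    and Z: "Z \<in> MCM R" and f: "f \<in> mod_hom R Z L"
  shows "f \<in> factor_maps R N L p Z \<longleftrightarrow>
    (\<exists>w\<in>mod_hom R Z N. stable_class R Z L f = stable_class R Z L (compose (carrier Z) p w))"
proof -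
  interpret S: hom_subfunctor R L "\<lambda>Z. factors_through_free R Z L" by (rule hom_subfunctor_free[OF cring L])
  note ZM = MCM_module[OF Z]
  show ?thesis
  proof
    assume "f \<in> factor_maps R N L p Z"
    then obtain w k where w: "w \<in> mod_hom R Z N" "k \<in> factors_through_free R Z L"
      "f = (\<lambda>x\<in>carrier Z. k x \<oplus>\<^bsub>L\<^esub> compose (carrier Z) p w x)" by (rule factor_mapsE)
    then show "\<exists>w\<in>mod_hom R Z N. stable_class R Z L f = stable_class R Z L (compose (carrier Z) p w)"
      unfolding stable_class_def using S.cl_eqI[OF Z mod_hom_compose[OF ZM w(1) p] w(2,3)] by blast
  next
    assume "\<exists>w\<in>mod_hom R Z N. stable_class R Z L f = stable_class R Z L (compose (carrier Z) p w)"
    then obtain w where w: "w \<in> mod_hom R Z N"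
      "stable_class R Z L f = stable_class R Z L (compose (carrier Z) p w)" by blast
    then have "f \<in> S.cl Z (compose (carrier Z) p w)"
      using S.cl_self[OF Z f] unfolding stable_class_def by simp
    then obtain k where "k \<in> factors_through_free R Z L"
      "f = (\<lambda>x\<in>carrier Z. k x \<oplus>\<^bsub>L\<^esub> compose (carrier Z) p w x)" unfolding S.mem_cl by blast
    then show "f \<in> factor_maps R N L p Z"
      by (rule factor_mapsI[OF cring ZM MCM_module[OF L] p w(1)])
  qed
qed

text \<open>The functor is Hom(-, L) modulo \<open>factor_maps\<close>. Its presentation consists of
  composition with \<open>p\<close> and of the projection, which is \<open>push\<close> along the
  identity of \<open>L\<close>.\<close>

theorem cokernel_functor_exists:
  assumes cring: "cring R" and N: "N \<in> MCM R" and L: "L \<in> MCM R" and p: "p \<in> mod_hom R N L"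
  shows "\<exists>F\<in>mod_MCM R. \<forall>Z\<in>MCM R. trivial_group (ob F Z) \<longleftrightarrow> mod_hom R Z L \<subseteq> factor_maps R N L p Z"
proof -
  interpret S: hom_subfunctor R L "\<lambda>Z. factors_through_free R Z L" by (rule hom_subfunctor_free[OF cring L])
  interpret SN: hom_subfunctor R N "\<lambda>Z. factors_through_free R Z N" by (rule hom_subfunctor_free[OF cring N])
  interpret C: hom_subfunctor R L "factor_maps R N L p" by (rule hom_subfunctor_factor_maps[OF assms])
  note LM = MCM_module[OF L]
  let ?id = "\<lambda>x\<in>carrier L. x"
  have idL: "?id \<in> mod_hom R L L" by (rule mod_hom_id[OF LM])
  have pS: "\<forall>Z\<in>MCM R. \<forall>s\<in>factors_through_free R Z N. compose (carrier Z) p s \<in> factors_through_free R Z L"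
    using compose_factors_through_free[OF cring MCM_module p] by blast
  have idS: "\<forall>Z\<in>MCM R. \<forall>s\<in>factors_through_free R Z L. compose (carrier Z) ?id s \<in> factor_maps R N L p Z"
  proof (intro ballI)
    fix Z s assume Z: "Z \<in> MCM R" and s: "s \<in> factors_through_free R Z L"
    have "compose (carrier Z) ?id s = s" by (rule S.compose_id_left[OF subsetD[OF S.T_hom[OF Z] s]])
    then show "compose (carrier Z) ?id s \<in> factor_maps R N L p Z" using C.T_free[OF Z] s by auto
  qed
  have s: "nat_trans R (representable R N) (representable R L) (S.push p)"
    unfolding representable_eq_quot_functor[OF cring N] representable_eq_quot_functor[OF cring L]
    by (rule S.nat_trans_push[OF SN.hom_subfunctor_axioms p pS])
  have t: "nat_trans R (representable R L) C.quot_functor (C.push ?id)"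
    unfolding representable_eq_quot_functor[OF cring L]
    by (rule C.nat_trans_push[OF S.hom_subfunctor_axioms idL idS])
  have tv: "C.push ?id Z (stable_class R Z L f) = C.cl Z f" if Z: "Z \<in> MCM R" and f: "f \<in> mod_hom R Z L" for Z f
    using C.push_cl[OF S.hom_subfunctor_axioms idL idS Z f] unfolding stable_class_def C.compose_id_left[OF f] .
  have sv: "S.push p Z (stable_class R Z N w) = stable_class R Z L (compose (carrier Z) p w)"
    if Z: "Z \<in> MCM R" and w: "w \<in> mod_hom R Z N" for Z w
    using S.push_cl[OF SN.hom_subfunctor_axioms p pS Z w] unfolding stable_class_def .
  have cls: "stable_class R Z L f \<in> carrier (stable_hom R Z L)" if "Z \<in> MCM R" "f \<in> mod_hom R Z L" for Z f
    using S.cl_carrier[OF that] unfolding stable_class_def stable_hom_def .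
  have clsN: "stable_class R Z N f \<in> carrier (stable_hom R Z N)" if "Z \<in> MCM R" "f \<in> mod_hom R Z N" for Z f
    using SN.cl_carrier[OF that] unfolding stable_class_def stable_hom_def .
  have one: "C.cl Z f = \<one>\<^bsub>ob C.quot_functor Z\<^esub> \<longleftrightarrow> f \<in> factor_maps R N L p Z"
    if "Z \<in> MCM R" "f \<in> mod_hom R Z L" for Z f
    unfolding C.ob_quot_functor
    using comm_group.coset_one_iff[OF C.hom_comm_group C.T_subgroup] that by (simp add: hom_group_simps)
  have ex: "kernel (stable_hom R Z L) (ob C.quot_functor Z) (C.push ?id Z) = S.push p Z ` carrier (stable_hom R Z N) \<and>
      C.push ?id Z ` carrier (stable_hom R Z L) = carrier (ob C.quot_functor Z)" if Z: "Z \<in> MCM R" for Z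
  proof (intro conjI subset_antisym subsetI)
    fix v assume v: "v \<in> kernel (stable_hom R Z L) (ob C.quot_functor Z) (C.push ?id Z)"
    then obtain f where f: "f \<in> mod_hom R Z L" "v = stable_class R Z L f"
      using S.stable_exhaust[OF Z L] unfolding kernel_def by blast
    have "C.push ?id Z v = \<one>\<^bsub>ob C.quot_functor Z\<^esub>" using v by (simp add: kernel_def)
    then have "f \<in> factor_maps R N L p Z" unfolding f(2) tv[OF Z f(1)] by (simp only: one[OF Z f(1)])
    then obtain w where w: "w \<in> mod_hom R Z N" "v = stable_class R Z L (compose (carrier Z) p w)"
      unfolding coset_factor_maps[OF assms Z f(1)] f(2) by blast
    show "v \<in> S.push p Z ` carrier (stable_hom R Z N)"
      using sv[OF Z w(1)] clsN[OF Z w(1)] w(2) by (metis imageI)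
  next
    fix v assume "v \<in> S.push p Z ` carrier (stable_hom R Z N)"
    then obtain w where w: "w \<in> mod_hom R Z N" "v = S.push p Z (stable_class R Z N w)"
      using S.stable_exhaust[OF Z N] by blast
    let ?f = "compose (carrier Z) p w"
    have f: "?f \<in> mod_hom R Z L" by (rule mod_hom_compose[OF MCM_module[OF Z] w(1) p])
    have "?f \<in> factor_maps R N L p Z" unfolding coset_factor_maps[OF assms Z f] using w(1) by blast
    then show "v \<in> kernel (stable_hom R Z L) (ob C.quot_functor Z) (C.push ?id Z)"
      unfolding kernel_def w(2) sv[OF Z w(1)] using tv[OF Z f] one[OF Z f] cls[OF Z f] by simp
  next
    fix v assume "v \<in> C.push ?id Z ` carrier (stable_hom R Z L)"
    then obtain f where f: "f \<in> mod_hom R Z L" "v = C.push ?id Z (stable_class R Z L f)"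
      using S.stable_exhaust[OF Z L] by blast
    then show "v \<in> carrier (ob C.quot_functor Z)"
      unfolding f(2) tv[OF Z f(1)] C.ob_quot_functor using C.cl_carrier[OF Z f(1)] by simp
  next
    fix v assume "v \<in> carrier (ob C.quot_functor Z)"
    then obtain f where f: "f \<in> mod_hom R Z L" "v = C.cl Z f"
      using C.cl_exhaust[OF Z] unfolding C.ob_quot_functor by blast
    then show "v \<in> C.push ?id Z ` carrier (stable_hom R Z L)"
      using tv[OF Z f(1)] cls[OF Z f(1)] by (metis imageI)
  qed
  have "finitely_presented R C.quot_functor"
    unfolding finitely_presented_def using C.additive_functor_quot_functor N L s t ex by blast
  \<comment> \<open>Values of the quotient functor consist of cosets of maps, whereas
    \<open>mod_MCM\<close> fixes a type of sets of such cosets. The naturally isomorphic copy has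
    that type, and triviality of the values is transported back.\<close>
  then obtain F' t' where F': "F' \<in> mod_MCM R" "nat_trans R C.quot_functor F' t'"
    "\<And>Z. Z \<in> MCM R \<Longrightarrow> bij_betw (t' Z) (carrier (ob C.quot_functor Z)) (carrier (ob F' Z))"
    using finitely_presented_representable by metis
  have "trivial_group (ob F' Z) \<longleftrightarrow> mod_hom R Z L \<subseteq> factor_maps R N L p Z" if Z: "Z \<in> MCM R" for Z
  proof -
    interpret Q: comm_group "ob C.quot_functor Z"
      by (rule additive_functor_comm_group[OF C.additive_functor_quot_functor Z])
    interpret F: comm_group "ob F' Z"
      using F'(1) unfolding mod_MCM_def mem_Collect_eq finitely_presented_def
      by (intro additive_functor_comm_group[OF _ Z]) (rule conjunct1)
    have hom: "t' Z \<in> hom (ob C.quot_functor Z) (ob F' Z)" using F'(2) Z unfolding nat_trans_def by blast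
    have "trivial_group (ob F' Z) \<longleftrightarrow> trivial_group (ob C.quot_functor Z)"
      by (rule trivial_group_bij_iff[OF Q.group_axioms F.group_axioms hom F'(3)[OF Z]])
    also have "\<dots> \<longleftrightarrow> mod_hom R Z L \<subseteq> factor_maps R N L p Z"
      using FactGroup_trivial_iff[OF C.hom_comm_group[OF Z] C.T_subgroup[OF Z]]
      unfolding C.ob_quot_functor by (simp add: hom_group_simps)
    finally show ?thesis .
  qed
  then show ?thesis using F'(1) by blast
qed

text \<open>By Yoneda's lemma the first map of a presentation is induced by the image of the identity.\<close>

theorem mod_MCM_cokernel:
  assumes cring: "cring R" and F: "F \<in> mod_MCM R"
  shows "\<exists>N\<in>MCM R. \<exists>L\<in>MCM R. \<exists>p\<in>mod_hom R N L.
    \<forall>Z\<in>MCM R. trivial_group (ob F Z) \<longleftrightarrow> mod_hom R Z L \<subseteq> factor_maps R N L p Z"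
proof -
  obtain L N s t where L: "L \<in> MCM R" and N: "N \<in> MCM R"
    and s: "nat_trans R (representable R N) (representable R L) s"
    and t: "nat_trans R (representable R L) F t"
    and ex: "\<forall>Z\<in>MCM R.
        kernel (stable_hom R Z L) (ob F Z) (t Z) = s Z ` carrier (stable_hom R Z N) \<and>
        t Z ` carrier (stable_hom R Z L) = carrier (ob F Z)"
    and add: "additive_functor R F"
    using F unfolding mod_MCM_def mem_Collect_eq finitely_presented_def by (elim conjE bexE exE) (rule that)
  interpret S: hom_subfunctor R L "\<lambda>Z. factors_through_free R Z L" by (rule hom_subfunctor_free[OF cring L])
  interpret SN: hom_subfunctor R N "\<lambda>Z. factors_through_free R Z N" by (rule hom_subfunctor_free[OF cring N])
  note NM = MCM_module[OF N]
  let ?id = "\<lambda>x\<in>carrier N. x"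
  have id: "?id \<in> mod_hom R N N" by (rule mod_hom_id[OF NM])
  have sid: "stable_id R N \<in> carrier (stable_hom R N N)"
    using SN.cl_carrier[OF N id] unfolding stable_id_def stable_class_def stable_hom_def .
  have "s N \<in> hom (stable_hom R N N) (stable_hom R N L)"
    using s N unfolding nat_trans_def representable_def by simp
  then have "s N (stable_id R N) \<in> carrier (stable_hom R N L)" using sid unfolding hom_def by blast
  then obtain p where p: "p \<in> mod_hom R N L" "s N (stable_id R N) = stable_class R N L p"
    using S.stable_exhaust[OF N L] by blast
  have sv: "s Z (stable_class R Z N w) = stable_class R Z L (compose (carrier Z) p w)"
    if Z: "Z \<in> MCM R" and w: "w \<in> mod_hom R Z N" for Z w
  proof -
    have v: "stable_class R Z N w \<in> carrier (stable_hom R Z N)"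
      using SN.cl_carrier[OF Z w] unfolding stable_class_def stable_hom_def .
    \<comment> \<open>Naturality of \<open>s\<close> along \<open>w\<close>, evaluated at the
      identity class of \<open>N\<close>: it shows that \<open>s\<close> is composition with the
      representative \<open>p\<close> of the image of that class.\<close>
    have "s Z (stable_comp R Z N N (stable_id R N) (stable_class R Z N w)) =
        stable_comp R Z N L (s N (stable_id R N)) (stable_class R Z N w)"
      using s Z N v sid unfolding nat_trans_def representable_def by simp
    moreover have "stable_comp R Z N N (stable_id R N) (stable_class R Z N w) = stable_class R Z N w"
      unfolding stable_id_def S.stable_comp_class[OF Z N N w id] S.compose_id_left[OF w] ..
    ultimately show ?thesis unfolding p(2) S.stable_comp_class[OF Z N L w p(1)] by simp
  qed
  have "trivial_group (ob F Z) \<longleftrightarrow> mod_hom R Z L \<subseteq> factor_maps R N L p Z" if Z: "Z \<in> MCM R" for Z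
  proof -
    interpret F: comm_group "ob F Z" by (rule additive_functor_comm_group[OF add Z])
    have ker: "kernel (stable_hom R Z L) (ob F Z) (t Z) = s Z ` carrier (stable_hom R Z N)"
      and onto: "t Z ` carrier (stable_hom R Z L) = carrier (ob F Z)" using ex Z by blast+
    have tr: "trivial_group (ob F Z) \<longleftrightarrow> carrier (stable_hom R Z L) \<subseteq> s Z ` carrier (stable_hom R Z N)"
    proof
      assume "trivial_group (ob F Z)"
      then show "carrier (stable_hom R Z L) \<subseteq> s Z ` carrier (stable_hom R Z N)"
        using onto unfolding ker[symmetric] kernel_def trivial_group_def by blast
    next
      assume "carrier (stable_hom R Z L) \<subseteq> s Z ` carrier (stable_hom R Z N)"
      then have "carrier (ob F Z) \<subseteq> {\<one>\<^bsub>ob F Z\<^esub>}"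
        using onto unfolding ker[symmetric] kernel_def by blast
      then show "trivial_group (ob F Z)"
        unfolding trivial_group_def using F.one_closed F.group_axioms by blast
    qed
    show ?thesis
      unfolding tr
    proof
      assume *: "carrier (stable_hom R Z L) \<subseteq> s Z ` carrier (stable_hom R Z N)"
      show "mod_hom R Z L \<subseteq> factor_maps R N L p Z"
      proof
        fix f assume f: "f \<in> mod_hom R Z L"
        have "stable_class R Z L f \<in> carrier (stable_hom R Z L)"
          using S.cl_carrier[OF Z f] unfolding stable_class_def stable_hom_def .
        then obtain v where v: "v \<in> carrier (stable_hom R Z N)" "stable_class R Z L f = s Z v" using * by blast
        then obtain w where w: "w \<in> mod_hom R Z N" "v = stable_class R Z N w" using S.stable_exhaust[OF Z N] by blast
        then show "f \<in> factor_maps R N L p Z"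
          unfolding coset_factor_maps[OF cring N L p(1) Z f] using v(2) sv[OF Z w(1)] by auto
      qed
    next
      assume *: "mod_hom R Z L \<subseteq> factor_maps R N L p Z"
      show "carrier (stable_hom R Z L) \<subseteq> s Z ` carrier (stable_hom R Z N)"
      proof
        fix v assume "v \<in> carrier (stable_hom R Z L)"
        then obtain f where f: "f \<in> mod_hom R Z L" "v = stable_class R Z L f" using S.stable_exhaust[OF Z L] by blast
        then obtain w where w: "w \<in> mod_hom R Z N" "v = stable_class R Z L (compose (carrier Z) p w)"
          using * unfolding f(2) coset_factor_maps[OF cring N L p(1) Z f(1), symmetric]
          using coset_factor_maps[OF cring N L p(1) Z f(1)] by blast
        have "stable_class R Z N w \<in> carrier (stable_hom R Z N)"
          using SN.cl_carrier[OF Z w(1)] unfolding stable_class_def stable_hom_def .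
        then show "v \<in> s Z ` carrier (stable_hom R Z N)" using sv[OF Z w(1)] w(2) by (metis imageI)
      qed
    qed
  qed
  then show ?thesis using N L p(1) by blast
qed

section \<open>The closure operator\<close>

lemma mod_isomorphic_refl: "module R M \<Longrightarrow> mod_isomorphic R M M"
  unfolding mod_isomorphic_def
  by (intro bexI[OF _ mod_hom_id]) (auto simp: bij_betw_def inj_on_def)

lemma factor_maps_iso:
  assumes cring: "cring R" and N: "N \<in> MCM R" and L: "L \<in> MCM R" and p: "p \<in> mod_hom R N L"
    and M: "M \<in> MCM R" and M': "M' \<in> MCM R" and iso: "mod_isomorphic R M M'"
    and sub: "mod_hom R M L \<subseteq> factor_maps R N L p M"
  shows "mod_hom R M' L \<subseteq> factor_maps R N L p M'"
proof
  interpret C: hom_subfunctor R L "factor_maps R N L p" by (rule hom_subfunctor_factor_maps[OF cring N L p])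
  obtain i where i: "i \<in> mod_hom R M M'" "bij_betw i (carrier M) (carrier M')"
    using iso unfolding mod_isomorphic_def by blast
  obtain j where j: "j \<in> mod_hom R M' M" "\<forall>y\<in>carrier M'. i (j y) = y"
    using mod_hom_inverse[OF MCM_module[OF M'] MCM_module[OF M] i] by blast
  fix f assume f: "f \<in> mod_hom R M' L"
  have "compose (carrier M) f i \<in> factor_maps R N L p M"
    using sub mod_hom_compose[OF MCM_module[OF M] i(1) f] by blast
  then have "compose (carrier M') (compose (carrier M) f i) j \<in> factor_maps R N L p M'"
    by (rule C.T_compose[OF M' M _ j(1)])
  moreover have "compose (carrier M') (compose (carrier M) f i) j = f"
    by (rule extensionalityI[OF _ mod_homD(4)[OF f]])
       (use j(2) mod_homD(1)[OF j(1)] in \<open>auto simp: compose_def\<close>)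
  ultimately show "f \<in> factor_maps R N L p M'" by simp
qed

context local_module
begin

text \<open>Rescaling \<open>x\<close> gives an element y with a(y) = 1, so \<open>a\<close> splits
  and \<open>M\<close> is the direct sum of its kernel and R y. Indecomposability kills the kernel,
  as R y is nonzero.\<close>

lemma iso_regular_if_surjective:
  assumes ind: "indecomposable R M" and a: "a \<in> mod_hom R M (regular_module R)"
    and x: "x \<in> carrier M" "a x \<in> Units R"
  shows "mod_isomorphic R M (regular_module R)"
proof -
  note RM = module_regular_module[OF R.is_cring]
  interpret RM: module R "regular_module R" by (rule RM)
  let ?y = "inv (a x) \<odot>\<^bsub>M\<^esub> x"
  have y: "?y \<in> carrier M" "a ?y = \<one>"
    using x mod_homD(3)[OF a, of "inv (a x)" x] by (simp_all add: Units_l_inv)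
  have ac: "a z \<in> carrier R" if "z \<in> carrier M" for z using mod_homD(1)[OF a that] by simp
  have ar: "a (r \<odot>\<^bsub>M\<^esub> ?y) = r" if "r \<in> carrier R" for r using mod_homD(3)[OF a that y(1)] y(2) that by simp
  let ?A = "{z \<in> carrier M. a z = \<zero>\<^bsub>regular_module R\<^esub>}" and ?B = "(\<lambda>r. r \<odot>\<^bsub>M\<^esub> ?y) ` carrier R"
  have A: "submodule ?A R M" by (rule submodule_kernel[OF module_axioms RM a])
  have B: "submodule ?B R M" by (rule submodule_cyclic[OF y(1)])
  have "?A \<inter> ?B = {\<zero>\<^bsub>M\<^esub>}"
  proof
    show "?A \<inter> ?B \<subseteq> {\<zero>\<^bsub>M\<^esub>}"
    proof
      fix z assume "z \<in> ?A \<inter> ?B"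
      then obtain r where r: "r \<in> carrier R" "z = r \<odot>\<^bsub>M\<^esub> ?y" "a z = \<zero>" by auto
      then have "r = \<zero>" using ar by simp
      then show "z \<in> {\<zero>\<^bsub>M\<^esub>}" using r y by simp
    qed
  qed (use submodule_zero_mem[OF A] submodule_zero_mem[OF B] in simp)
  moreover have "?A <+>\<^bsub>M\<^esub> ?B = carrier M"
  proof
    show "?A <+>\<^bsub>M\<^esub> ?B \<subseteq> carrier M" using submodule_mem[OF submodule_sum[OF A B]] by blast
    show "carrier M \<subseteq> ?A <+>\<^bsub>M\<^esub> ?B"
    proof
      fix z assume z: "z \<in> carrier M"
      let ?w = "a z \<odot>\<^bsub>M\<^esub> ?y"
      have w: "?w \<in> carrier M" using ac[OF z] y(1) by simp
      have "a (z \<ominus>\<^bsub>M\<^esub> ?w) = a z \<ominus>\<^bsub>regular_module R\<^esub> a ?w" by (rule mod_hom_diff[OF module_axioms RM a z w])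
      also have "\<dots> = \<zero>\<^bsub>regular_module R\<^esub>" using ar[OF ac[OF z]] ac[OF z] RM.M.r_neg[of "a z"] by (simp add: a_minus_def)
      finally have "z \<ominus>\<^bsub>M\<^esub> ?w \<in> ?A" using z w by simp
      moreover have "z = (z \<ominus>\<^bsub>M\<^esub> ?w) \<oplus>\<^bsub>M\<^esub> ?w" using z w by (simp add: a_minus_def M.a_assoc M.l_neg)
      ultimately show "z \<in> ?A <+>\<^bsub>M\<^esub> ?B" unfolding mem_sum_iff using ac[OF z] by blast
    qed
  qed
  ultimately have "?A = {\<zero>\<^bsub>M\<^esub>} \<or> ?B = {\<zero>\<^bsub>M\<^esub>}" using ind A B unfolding indecomposable_def by blast
  moreover have "?B \<noteq> {\<zero>\<^bsub>M\<^esub>}"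
  proof
    assume "?B = {\<zero>\<^bsub>M\<^esub>}"
    then have "\<one> \<odot>\<^bsub>M\<^esub> ?y = \<zero>\<^bsub>M\<^esub>" by (metis (no_types, lifting) R.one_closed image_eqI singletonD)
    then have "\<one> = \<zero>" using ar[of \<one>] mod_hom_zero[OF module_axioms RM a] by simp
    then show False using R.Units_one_closed Units_iff[of \<one>] additive_subgroup.zero_closed[OF ideal.axioms(1)[OF max.is_ideal]] by simp
  qed
  ultimately have ker: "?A = {\<zero>\<^bsub>M\<^esub>}" by blast
  have "inj_on a (carrier M)"
  proof (rule inj_onI)
    fix v w assume vw: "v \<in> carrier M" "w \<in> carrier M" "a v = a w"
    have "a (v \<ominus>\<^bsub>M\<^esub> w) = a v \<ominus>\<^bsub>regular_module R\<^esub> a w" by (rule mod_hom_diff[OF module_axioms RM a vw(1,2)])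
    also have "\<dots> = \<zero>\<^bsub>regular_module R\<^esub>" using vw ac RM.M.r_neg[of "a w"] by (simp add: a_minus_def)
    finally have "v \<ominus>\<^bsub>M\<^esub> w \<in> ?A" using vw by simp
    then have "v \<ominus>\<^bsub>M\<^esub> w = \<zero>\<^bsub>M\<^esub>" unfolding ker by simp
    moreover have "v = (v \<ominus>\<^bsub>M\<^esub> w) \<oplus>\<^bsub>M\<^esub> w" using vw by (simp add: a_minus_def M.a_assoc M.l_neg)
    ultimately show "v = w" using vw by simp
  qed
  moreover have "a ` carrier M = carrier R"
  proof
    show "carrier R \<subseteq> a ` carrier M" using ar y(1) by (metis imageI smult_closed subsetI)
  qed (use ac in blast)
  ultimately show ?thesis unfolding mod_isomorphic_def bij_betw_def using a by (intro bexI[of _ a]) simp_all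
qed

text \<open>If no coordinate of \<open>M \<rightarrow> R^n\<close> is onto, then all lie in the maximal ideal and \<open>M = m M\<close>.\<close>

lemma iso_regular_if_id_factors_through_free:
  assumes ind: "indecomposable R M" and id: "(\<lambda>x\<in>carrier M. x) \<in> factors_through_free R M M"
  shows "mod_isomorphic R M (regular_module R)"
proof -
  note FM = module_free_module[OF R.is_cring]
  obtain g h n where gh: "(\<lambda>x\<in>carrier M. x) = compose (carrier M) h g" "g \<in> mod_hom R M (free_module R n)"
    "h \<in> mod_hom R (free_module R n) M"
    using id unfolding factors_through_free_def by blast
  have hg: "h (g x) = x" if "x \<in> carrier M" for x
    using fun_cong[OF gh(1), of x] that by (simp add: compose_eq)
  have gF: "g x \<in> carrier (free_module R n)" if "x \<in> carrier M" for x using mod_homD(1)[OF gh(2) that] .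
  have gc: "g x i \<in> carrier R" if "x \<in> carrier M" "i < n" for x i
    using gF[OF that(1)] that(2) by (auto simp: carrier_free_module)
  show ?thesis
  proof (cases "\<exists>x\<in>carrier M. \<exists>i<n. g x i \<in> Units R")
    case True
    then obtain x i where xi: "x \<in> carrier M" "i < n" "g x i \<in> Units R" by blast
    have "restrict (\<lambda>x. g x i) (carrier M) \<in> mod_hom R M (regular_module R)"
      by (rule mod_homI[OF module_axioms])
         (use xi(2) gc in \<open>simp_all add: mod_homD(2,3)[OF gh(2)] add_free_module smult_free_module\<close>)
    then show ?thesis using iso_regular_if_surjective[OF ind] xi by simp
  next
    case False
    have msub: "submodule (msub (carrier M)) R M" using submodule_msub by blast
    \<comment> \<open>x = h(g x) is a combination of the images of the unit vectors, with
      coefficients in the maximal ideal.\<close>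
    have "x \<in> msub (carrier M)" if x: "x \<in> carrier M" for x
    proof -
      have "g x \<in> {z \<in> carrier (free_module R n). h z \<in> msub (carrier M)}"
      proof (rule free_module_mem_submodule[OF R.is_cring submodule_vimage[OF FM module_axioms gh(3) msub] gF[OF x]])
        fix i assume i: "i < n"
        have e: "unit_vec R n i \<in> carrier (free_module R n)" by (rule unit_vec_closed[OF R.is_cring])
        interpret F: module R "free_module R n" by (rule FM)
        have "g x i \<in> mm" using False x i gc[OF x i] Units_iff by blast
        then have "g x i \<odot>\<^bsub>M\<^esub> h (unit_vec R n i) \<in> msub (carrier M)"
          by (rule smult_mem_msub) (rule mod_homD(1)[OF gh(3) e])
        then show "g x i \<odot>\<^bsub>free_module R n\<^esub> unit_vec R n i \<in> {z \<in> carrier (free_module R n). h z \<in> msub (carrier M)}"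
          using mod_homD(3)[OF gh(3) gc[OF x i] e] gc[OF x i] e by simp
      qed
      then show ?thesis using hg[OF x] by simp
    qed
    then have "carrier M \<subseteq> {\<zero>\<^bsub>M\<^esub>} <+>\<^bsub>M\<^esub> msub (carrier M)" using sum_upper2[OF submodule_zero msub] by blast
    then have "carrier M \<subseteq> {\<zero>\<^bsub>M\<^esub>}" by (rule nakayama[OF submodule_zero carrier_is_submodule])
    then have "carrier M = {\<zero>\<^bsub>M\<^esub>}" by auto
    then show ?thesis using ind unfolding indecomposable_def by simp
  qed
qed

end

text \<open>This is locality of the endomorphism ring: as \<open>g\<close> is 1 - f, one of the two
  is onto by Fitting's lemma, and a surjective endomorphism of a Noetherian module is
  bijective.\<close>

lemma (in complete_local_module) indecomposable_endo_sum:
  assumes ind: "indecomposable R M" and f: "f \<in> mod_hom R M M" and g: "g \<in> mod_hom R M M"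
    and id: "\<And>x. x \<in> carrier M \<Longrightarrow> f x \<oplus>\<^bsub>M\<^esub> g x = x"
  shows "bij_betw f (carrier M) (carrier M) \<or> bij_betw g (carrier M) (carrier M)"
proof -
  have "x \<ominus>\<^bsub>M\<^esub> f x = g x" if x: "x \<in> carrier M" for x
  proof -
    have c: "f x \<in> carrier M" "g x \<in> carrier M" using mod_homD(1)[OF f x] mod_homD(1)[OF g x] by auto
    have "(f x \<oplus>\<^bsub>M\<^esub> g x) \<ominus>\<^bsub>M\<^esub> f x = g x"
      using c by (simp add: a_minus_def M.a_ac M.r_neg1 M.r_neg M.r_neg2 M.a_cancel)
    then show ?thesis by (simp only: id[OF x])
  qed
  then have "(\<lambda>x. x \<ominus>\<^bsub>M\<^esub> f x) ` carrier M = g ` carrier M" by (intro image_cong) auto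
  then show ?thesis
    using indecomposable_endo_surj[OF ind f] surj_endo_bij[OF f] surj_endo_bij[OF g] by auto
qed

locale complete_cm_ring = local_noetherian R for R :: "'a ring" (structure) +
  assumes complete: "adic_complete R (max_ideal R)" and cm: "cohen_macaulay R"
begin

lemma MCM_complete_local_module: "M \<in> MCM R \<Longrightarrow> complete_local_module R M"
  using complete local_noetherian_axioms noetherian_moduleI[OF _ noetherian_ring_axioms, of M]
  unfolding MCM_iff complete_local_module_def complete_local_module_axioms_def local_module_def by blast

text \<open>The functor \<open>X \<mapsto> {g : X \<rightarrow> M. u g vanishes in the cokernel of p}\<close> is the image of \<open>Hom(-, P)\<close>
  for the pullback \<open>P\<close> of \<open>u\<close> and \<open>N \<oplus> R^n \<rightarrow> L\<close>; the free summand makes the latter map onto.\<close>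

lemma pullback_exists:
  fixes M N L :: "'a rmod"
  assumes M: "M \<in> MCM R" and N: "N \<in> MCM R" and L: "L \<in> MCM R"
    and u: "u \<in> mod_hom R M L" and p: "p \<in> mod_hom R N L"
  shows "\<exists>(P :: ('a, 'a elt \<times> 'a elt \<times> (nat \<Rightarrow> 'a)) module) a.
    module R P \<and> fin_gen R P \<and> depth_condition P \<and> a \<in> mod_hom R P M \<and>
    (\<forall>Z\<in>MCM R. \<forall>g\<in>mod_hom R Z M. compose (carrier Z) u g \<in> factor_maps R N L p Z \<longrightarrow>
      (\<exists>w\<in>mod_hom R Z P. \<forall>x\<in>carrier Z. g x = a (w x))) \<and>
    (\<forall>Z\<in>MCM R. \<forall>w\<in>mod_hom R Z P. (\<lambda>x\<in>carrier Z. u (a (w x))) \<in> factor_maps R N L p Z)"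
proof -
  note MM = MCM_module[OF M] and NM = MCM_module[OF N] and LM = MCM_module[OF L]
  note FM = module_free_module[OF is_cring]
  interpret L: module R L by (rule LM)
  obtain n q where q: "q \<in> mod_hom R (free_module R n) L" "q ` carrier (free_module R n) = carrier L"
    using free_cover[OF is_cring LM] L unfolding MCM_iff by blast
  let ?F = "free_module R n"
  let ?NF = "mod_prod N ?F" let ?E = "mod_prod M ?NF"
  have NFM: "module R ?NF" by (rule module_mod_prod[OF NM FM])
  have EM: "module R ?E" by (rule module_mod_prod[OF MM NFM])
  \<comment> \<open>The kernel of this difference map is the pullback. Surjectivity, needed for the
    kernel lemma, comes from \<open>q\<close> alone, which covers \<open>L\<close>.\<close>
  let ?d = "\<lambda>x. u (fst x) \<ominus>\<^bsub>L\<^esub> (p (fst (snd x)) \<oplus>\<^bsub>L\<^esub> q (snd (snd x)))"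
  have uc: "u x \<in> carrier L" if "x \<in> carrier M" for x using mod_homD(1)[OF u that] .
  have pc: "p x \<in> carrier L" if "x \<in> carrier N" for x using mod_homD(1)[OF p that] .
  have qc: "q x \<in> carrier L" if "x \<in> carrier ?F" for x using mod_homD(1)[OF q(1) that] .
  have d: "restrict ?d (carrier ?E) \<in> mod_hom R ?E L"
    by (rule mod_homI[OF EM])
       (auto simp: uc pc qc mod_homD(2,3)[OF u] mod_homD(2,3)[OF p] mod_homD(2,3)[OF q(1)]
          a_minus_def L.smult_r_distr L.smult_r_minus L.M.minus_add L.M.a_ac)
  have onto: "restrict ?d (carrier ?E) ` carrier ?E = carrier L"
  proof
    show "carrier L \<subseteq> restrict ?d (carrier ?E) ` carrier ?E"
    proof
      fix l assume l: "l \<in> carrier L"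
      then have "\<ominus>\<^bsub>L\<^esub> l \<in> q ` carrier ?F" using q(2) by simp
      then obtain z where z: "z \<in> carrier ?F" "q z = \<ominus>\<^bsub>L\<^esub> l" by (metis imageE)
      interpret M: module R M by (rule MM)
      interpret N: module R N by (rule NM)
      have "?d (\<zero>\<^bsub>M\<^esub>, \<zero>\<^bsub>N\<^esub>, z) = l"
        using z l mod_hom_zero[OF MM LM u] mod_hom_zero[OF NM LM p] by (simp add: a_minus_def)
      then show "l \<in> restrict ?d (carrier ?E) ` carrier ?E"
        using z by (intro image_eqI[of _ _ "(\<zero>\<^bsub>M\<^esub>, \<zero>\<^bsub>N\<^esub>, z)"]) auto
    qed
  qed (use mod_homD(1)[OF d] in blast)
  define H where "H = {x \<in> carrier ?E. restrict ?d (carrier ?E) x = \<zero>\<^bsub>L\<^esub>}"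
  let ?P = "?E\<lparr>carrier := H\<rparr>"
  have H: "submodule H R ?E" unfolding H_def by (rule submodule_kernel[OF EM LM d])
  have PM: "module R ?P" by (rule submodule.submodule_is_module[OF H EM])
  have fgE: "fin_gen R ?E"
    using M N fin_gen_mod_prod[OF MM _ NFM] fin_gen_mod_prod[OF NM _ FM] fin_gen_free_module[OF is_cring]
    unfolding MCM_iff by blast
  have fg: "fin_gen R ?P" by (rule fin_gen_submodule[OF EM noetherian_ring_axioms fgE H])
  have dc: "depth_condition ?P"
  proof (rule depth_condition_kernel[OF EM LM d onto H_def])
    show "depth_condition ?E"
      using M N depth_condition_mod_prod[OF MM NFM] depth_condition_mod_prod[OF NM FM]
        depth_condition_free_module[OF cm] unfolding MCM_iff by blast
    show "depth_condition L" using L unfolding MCM_iff by blast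
  qed
  have memH: "x \<in> H \<longleftrightarrow> x \<in> carrier ?E \<and> u (fst x) = p (fst (snd x)) \<oplus>\<^bsub>L\<^esub> q (snd (snd x))" for x
  proof -
    have "?d x = \<zero>\<^bsub>L\<^esub> \<longleftrightarrow> u (fst x) = p (fst (snd x)) \<oplus>\<^bsub>L\<^esub> q (snd (snd x))" if x: "x \<in> carrier ?E"
    proof -
      have c: "u (fst x) \<in> carrier L" "p (fst (snd x)) \<oplus>\<^bsub>L\<^esub> q (snd (snd x)) \<in> carrier L"
        using x uc pc qc by auto
      have "u (fst x) = ?d x \<oplus>\<^bsub>L\<^esub> (p (fst (snd x)) \<oplus>\<^bsub>L\<^esub> q (snd (snd x)))"
        using L.M.a_assoc[OF c(1) L.M.a_inv_closed[OF c(2)] c(2)] L.M.l_neg[OF c(2)] c by (simp add: a_minus_def)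
      then show ?thesis using c L.M.r_neg[OF c(2)] by (auto simp: a_minus_def)
    qed
    then show ?thesis unfolding H_def by auto
  qed
  have HE: "H \<subseteq> carrier ?E" unfolding H_def by blast
  let ?a = "restrict fst H"
  have a: "?a \<in> mod_hom R ?P M"
  proof -
    have "restrict fst (carrier ?P) \<in> mod_hom R ?P M"
      by (rule mod_homI[OF PM]) (use HE in auto)
    then show ?thesis by simp
  qed
  have lift: "\<exists>w\<in>mod_hom R Z ?P. \<forall>x\<in>carrier Z. g x = ?a (w x)"
    if Z: "Z \<in> MCM R" and g: "g \<in> mod_hom R Z M" and ug: "compose (carrier Z) u g \<in> factor_maps R N L p Z" for Z g
  proof -
    note ZM = MCM_module[OF Z]
    obtain w k where w: "w \<in> mod_hom R Z N" "k \<in> factors_through_free R Z L"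
      "compose (carrier Z) u g = (\<lambda>x\<in>carrier Z. k x \<oplus>\<^bsub>L\<^esub> compose (carrier Z) p w x)"
      using ug by (rule factor_mapsE)
    obtain m s h where k: "k = compose (carrier Z) h s" "s \<in> mod_hom R Z (free_module R m)"
      "h \<in> mod_hom R (free_module R m) L" using w(2) unfolding factors_through_free_def by blast
    \<comment> \<open>A map through any R^m goes through the fixed cover \<open>q\<close>, since R^m
      is projective. One free summand therefore accounts for all maps through free modules.\<close>
    obtain h' where h': "h' \<in> mod_hom R (free_module R m) ?F" "\<forall>z\<in>carrier (free_module R m). q (h' z) = h z"
      using free_module_lift[OF is_cring FM LM k(3) q(1)] q(2) mod_homD(1)[OF k(3)] by auto
    have h's: "compose (carrier Z) h' s \<in> mod_hom R Z ?F" by (rule mod_hom_compose[OF ZM k(2) h'(1)])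
    let ?w = "\<lambda>x\<in>carrier Z. (g x, (\<lambda>x\<in>carrier Z. (w x, compose (carrier Z) h' s x)) x)"
    have W: "?w \<in> mod_hom R Z ?E" by (rule mod_prod_pairing[OF ZM g mod_prod_pairing[OF ZM w(1) h's]])
    have wH: "?w x \<in> H" if x: "x \<in> carrier Z" for x
    proof -
      have "u (g x) = k x \<oplus>\<^bsub>L\<^esub> p (w x)" using fun_cong[OF w(3), of x] x by (simp add: compose_eq)
      moreover have "k x = q (h' (s x))" using x h'(2) mod_homD(1)[OF k(2) x] by (simp add: k(1) compose_eq)
      moreover have "k x \<in> carrier L" using mod_homD(1)[OF mod_hom_compose[OF ZM k(2,3)] x] k(1) by simp
      moreover have "p (w x) \<in> carrier L" using pc[OF mod_homD(1)[OF w(1) x]] .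
      ultimately show ?thesis
        unfolding memH using mod_homD(1)[OF W x] x by (simp add: compose_eq L.M.a_comm)
    qed
    have "?w \<in> mod_hom R Z ?P" by (rule mod_hom_subI[OF W wH])
    then show ?thesis using wH by (intro bexI[of _ ?w]) auto
  qed
  have from_P: "(\<lambda>x\<in>carrier Z. u (?a (w x))) \<in> factor_maps R N L p Z"
    if Z: "Z \<in> MCM R" and w: "w \<in> mod_hom R Z ?P" for Z w
  proof -
    note ZM = MCM_module[OF Z]
    have wE: "w \<in> mod_hom R Z ?E" by (rule mod_hom_subD[OF w HE])
    have wc: "w x \<in> H" if "x \<in> carrier Z" for x using mod_homD(1)[OF w that] by simp
    have wc': "fst (w x) \<in> carrier M" "fst (snd (w x)) \<in> carrier N" "snd (snd (w x)) \<in> carrier ?F"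
      if "x \<in> carrier Z" for x using mod_homD(1)[OF wE that] by auto
    have w1: "restrict (\<lambda>x. fst (snd (w x))) (carrier Z) \<in> mod_hom R Z N"
      by (rule mod_homI[OF ZM]) (simp_all add: wc' mod_homD(2,3)[OF wE])
    have w2: "restrict (\<lambda>x. snd (snd (w x))) (carrier Z) \<in> mod_hom R Z ?F"
      by (rule mod_homI[OF ZM]) (simp_all add: wc' mod_homD(2,3)[OF wE])
    show ?thesis
    proof (rule factor_mapsI[OF is_cring ZM LM p w1 factors_through_freeI[OF w2 q(1)]])
      show "(\<lambda>x\<in>carrier Z. u (?a (w x))) = (\<lambda>x\<in>carrier Z.
          compose (carrier Z) q (restrict (\<lambda>x. snd (snd (w x))) (carrier Z)) x \<oplus>\<^bsub>L\<^esub>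
          compose (carrier Z) p (restrict (\<lambda>x. fst (snd (w x))) (carrier Z)) x)"
      proof (rule restrict_ext)
        fix x assume x: "x \<in> carrier Z"
        have "u (?a (w x)) = p (fst (snd (w x))) \<oplus>\<^bsub>L\<^esub> q (snd (snd (w x)))"
          using wc[OF x] memH[of "w x"] by simp
        then show "u (?a (w x)) = compose (carrier Z) q (restrict (\<lambda>x. snd (snd (w x))) (carrier Z)) x \<oplus>\<^bsub>L\<^esub>
          compose (carrier Z) p (restrict (\<lambda>x. fst (snd (w x))) (carrier Z)) x"
          using x pc[OF wc'(2)[OF x]] qc[OF wc'(3)[OF x]] by (simp add: compose_eq L.M.a_comm)
      qed
    qed
  qed
  show ?thesis
    by (rule exI[of _ ?P], rule exI[of _ ?a])
       (intro conjI PM fg dc a ballI impI lift from_P; assumption)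
qed

end

context complete_cm_ring
begin

text \<open>If neither image contains the identity of \<open>M\<close>, then neither does their sum, because the
  endomorphism ring of \<open>M\<close> is local.\<close>

lemma common_quotient_exists:
  fixes M N L N' L' :: "'a rmod"
  assumes M: "M \<in> MCM R" "indecomposable R M"
    and N: "N \<in> MCM R" and L: "L \<in> MCM R" and p: "p \<in> mod_hom R N L"
    and N': "N' \<in> MCM R" and L': "L' \<in> MCM R" and p': "p' \<in> mod_hom R N' L'"
    and nv: "\<not> mod_hom R M L \<subseteq> factor_maps R N L p M"
    and nv': "\<not> mod_hom R M L' \<subseteq> factor_maps R N' L' p' M"
  shows "\<exists>W\<in>MCM R. \<exists>q\<in>mod_hom R W M. \<not> mod_hom R M M \<subseteq> factor_maps R W M q M \<and>
    (\<forall>Z\<in>MCM R. mod_hom R Z L \<subseteq> factor_maps R N L p Z \<or> mod_hom R Z L' \<subseteq> factor_maps R N' L' p' Z \<longrightarrow>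
      mod_hom R Z M \<subseteq> factor_maps R W M q Z)"
proof -
  note MM = MCM_module[OF M(1)]
  interpret complete_local_module R M by (rule MCM_complete_local_module[OF M(1)])
  obtain u u' where u: "u \<in> mod_hom R M L" "u \<notin> factor_maps R N L p M"
    and u': "u' \<in> mod_hom R M L'" "u' \<notin> factor_maps R N' L' p' M" using nv nv' by blast
  obtain P :: "('a, 'a elt \<times> 'a elt \<times> (nat \<Rightarrow> 'a)) module" and a
    where P: "module R P" "fin_gen R P" "depth_condition P" and a: "a \<in> mod_hom R P M"
    and lift: "\<forall>Z\<in>MCM R. \<forall>g\<in>mod_hom R Z M. compose (carrier Z) u g \<in> factor_maps R N L p Z \<longrightarrow>
      (\<exists>w\<in>mod_hom R Z P. \<forall>x\<in>carrier Z. g x = a (w x))"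
    and from_P: "\<forall>Z\<in>MCM R. \<forall>w\<in>mod_hom R Z P. (\<lambda>x\<in>carrier Z. u (a (w x))) \<in> factor_maps R N L p Z"
    using pullback_exists[OF M(1) N L u(1) p] by (elim exE conjE) (rule that)
  obtain P' :: "('a, 'a elt \<times> 'a elt \<times> (nat \<Rightarrow> 'a)) module" and a'
    where P': "module R P'" "fin_gen R P'" "depth_condition P'" and a': "a' \<in> mod_hom R P' M"
    and lift': "\<forall>Z\<in>MCM R. \<forall>g\<in>mod_hom R Z M. compose (carrier Z) u' g \<in> factor_maps R N' L' p' Z \<longrightarrow>
      (\<exists>w\<in>mod_hom R Z P'. \<forall>x\<in>carrier Z. g x = a' (w x))"
    and from_P': "\<forall>Z\<in>MCM R. \<forall>w\<in>mod_hom R Z P'. (\<lambda>x\<in>carrier Z. u' (a' (w x))) \<in> factor_maps R N' L' p' Z"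
    using pullback_exists[OF M(1) N' L' u'(1) p'] by (elim exE conjE) (rule that)
  let ?S = "mod_prod P P'"
  have S: "module R ?S" by (rule module_mod_prod[OF P(1) P'(1)])
  have fS: "fin_gen R ?S" by (rule fin_gen_mod_prod[OF P(1,2) P'(1,2)])
  \<comment> \<open>The sum of the pullbacks lives over a product type; \<open>W\<close> is an
    isomorphic copy of the admissible type, and \<open>j\<close> reads off its two
    components.\<close>
  obtain W :: "'a rmod" where W: "module R W" "fin_gen R W" "mod_isomorphic R ?S W"
    using fin_gen_module_representable[OF S fS] by blast
  have WM: "W \<in> MCM R"
    unfolding MCM_iff using W depth_condition_iso[OF S W(1,3) depth_condition_mod_prod[OF P(1) P'(1) P(3) P'(3)]] by blast
  obtain i where i: "i \<in> mod_hom R ?S W" "bij_betw i (carrier ?S) (carrier W)"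
    using W(3) unfolding mod_isomorphic_def by blast
  obtain j where j: "j \<in> mod_hom R W ?S" "\<forall>x\<in>carrier ?S. j (i x) = x"
    using mod_hom_inverse[OF W(1) S i] by blast
  interpret P: module R P by (rule P(1))
  interpret P': module R P' by (rule P'(1))
  have jc: "fst (j w) \<in> carrier P" "snd (j w) \<in> carrier P'" if "w \<in> carrier W" for w
    using mod_homD(1)[OF j(1) that] by auto
  have ac: "a x \<in> carrier M" if "x \<in> carrier P" for x using mod_homD(1)[OF a that] .
  have ac': "a' x \<in> carrier M" if "x \<in> carrier P'" for x using mod_homD(1)[OF a' that] .
  let ?q = "\<lambda>w. a (fst (j w)) \<oplus>\<^bsub>M\<^esub> a' (snd (j w))"
  let ?Q = "restrict ?q (carrier W)"
  have Q: "?Q \<in> mod_hom R W M"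
    by (rule mod_homI[OF W(1)])
       (simp_all add: jc ac ac' mod_homD(2,3)[OF a] mod_homD(2,3)[OF a'] mod_homD(2,3)[OF j(1)]
          M.a_ac smult_r_distr)
  have "mod_hom R Z M \<subseteq> factor_maps R W M ?Q Z"
    if Z: "Z \<in> MCM R" and van: "mod_hom R Z L \<subseteq> factor_maps R N L p Z \<or> mod_hom R Z L' \<subseteq> factor_maps R N' L' p' Z" for Z
  proof
    fix g assume g: "g \<in> mod_hom R Z M"
    note ZM = MCM_module[OF Z]
    have zP: "(\<lambda>x\<in>carrier Z. \<zero>\<^bsub>P\<^esub>) \<in> mod_hom R Z P" and zP': "(\<lambda>x\<in>carrier Z. \<zero>\<^bsub>P'\<^esub>) \<in> mod_hom R Z P'"
      by (rule mod_homI[OF ZM]; simp)+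
    \<comment> \<open>If one cokernel vanishes at \<open>Z\<close>, every map from \<open>Z\<close>
      to \<open>M\<close> goes through the corresponding pullback; the component in the other
      pullback is zero.\<close>
    have "\<exists>v\<in>mod_hom R Z P. \<exists>v'\<in>mod_hom R Z P'. \<forall>x\<in>carrier Z. g x = a (v x) \<oplus>\<^bsub>M\<^esub> a' (v' x)"
      using van
    proof
      assume "mod_hom R Z L \<subseteq> factor_maps R N L p Z"
      then have "compose (carrier Z) u g \<in> factor_maps R N L p Z" using mod_hom_compose[OF ZM g u(1)] by blast
      then obtain w where w: "w \<in> mod_hom R Z P" "\<forall>x\<in>carrier Z. g x = a (w x)" using lift Z g by blast
      show ?thesis
        using w ac mod_homD(1)[OF w(1)] mod_hom_zero[OF P'(1) MM a']
        by (intro bexI[OF _ w(1)] bexI[OF _ zP']) simp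
    next
      assume "mod_hom R Z L' \<subseteq> factor_maps R N' L' p' Z"
      then have "compose (carrier Z) u' g \<in> factor_maps R N' L' p' Z" using mod_hom_compose[OF ZM g u'(1)] by blast
      then obtain w where w: "w \<in> mod_hom R Z P'" "\<forall>x\<in>carrier Z. g x = a' (w x)" using lift' Z g by blast
      show ?thesis
        using w ac' mod_homD(1)[OF w(1)] mod_hom_zero[OF P(1) MM a]
        by (intro bexI[OF _ zP] bexI[OF _ w(1)]) simp
    qed
    then obtain v v' where v: "v \<in> mod_hom R Z P" "v' \<in> mod_hom R Z P'"
      "\<forall>x\<in>carrier Z. g x = a (v x) \<oplus>\<^bsub>M\<^esub> a' (v' x)" by blast
    let ?v = "\<lambda>x\<in>carrier Z. (v x, v' x)"
    have vS: "?v \<in> mod_hom R Z ?S" by (rule mod_prod_pairing[OF ZM v(1,2)])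
    have iv: "compose (carrier Z) i ?v \<in> mod_hom R Z W" by (rule mod_hom_compose[OF ZM vS i(1)])
    have z: "(\<lambda>x\<in>carrier Z. \<zero>\<^bsub>M\<^esub>) \<in> factors_through_free R Z M"
      using subgroup.one_closed[OF subgroup_factors_through_free[OF is_cring ZM MM]] by (simp add: hom_group_simps)
    show "g \<in> factor_maps R W M ?Q Z"
    proof (rule factor_mapsI[OF is_cring ZM MM Q iv z])
      show "g = (\<lambda>x\<in>carrier Z. (\<lambda>x\<in>carrier Z. \<zero>\<^bsub>M\<^esub>) x \<oplus>\<^bsub>M\<^esub> compose (carrier Z) ?Q (compose (carrier Z) i ?v) x)"
      proof (rule extensionalityI[OF mod_homD(4)[OF g] restrict_extensional])
        fix x assume x: "x \<in> carrier Z"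
        have c: "v x \<in> carrier P" "v' x \<in> carrier P'" using mod_homD(1)[OF v(1) x] mod_homD(1)[OF v(2) x] by auto
        have "i (v x, v' x) \<in> carrier W" "j (i (v x, v' x)) = (v x, v' x)"
          using mod_homD(1)[OF i(1)] j(2) c by auto
        then show "g x = (\<lambda>x\<in>carrier Z. (\<lambda>x\<in>carrier Z. \<zero>\<^bsub>M\<^esub>) x \<oplus>\<^bsub>M\<^esub> compose (carrier Z) ?Q (compose (carrier Z) i ?v) x) x"
          using x v(3) ac[OF c(1)] ac'[OF c(2)] by (simp add: compose_eq)
      qed
    qed
  qed
  moreover have "\<not> mod_hom R M M \<subseteq> factor_maps R W M ?Q M"
  proof
    assume "mod_hom R M M \<subseteq> factor_maps R W M ?Q M"
    then have "(\<lambda>x\<in>carrier M. x) \<in> factor_maps R W M ?Q M" using mod_hom_id[OF MM] by blast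
    then obtain w k where w: "w \<in> mod_hom R M W" "k \<in> factors_through_free R M M"
      "(\<lambda>x\<in>carrier M. x) = (\<lambda>x\<in>carrier M. k x \<oplus>\<^bsub>M\<^esub> compose (carrier M) ?Q w x)" by (rule factor_mapsE)
    have kh: "k \<in> mod_hom R M M" using w(2) factors_through_free_subset[OF MM] by blast
    have wc: "w x \<in> carrier W" if "x \<in> carrier M" for x using mod_homD(1)[OF w(1) that] .
    have kc: "k x \<in> carrier M" if "x \<in> carrier M" for x using mod_homD(1)[OF kh that] .
    define v where "v = restrict (\<lambda>x. fst (j (w x))) (carrier M)"
    define v' where "v' = restrict (\<lambda>x. snd (j (w x))) (carrier M)"
    have v: "v \<in> mod_hom R M P"
      unfolding v_def
      by (rule mod_homI[OF MM]) (simp_all add: wc jc mod_homD(2,3)[OF w(1)] mod_homD(2,3)[OF j(1)])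
    have v': "v' \<in> mod_hom R M P'"
      unfolding v'_def
      by (rule mod_homI[OF MM]) (simp_all add: wc jc mod_homD(2,3)[OF w(1)] mod_homD(2,3)[OF j(1)])
    define f1 where "f1 = compose (carrier M) a v"
    define f3 where "f3 = compose (carrier M) a' v'"
    \<comment> \<open>The part \<open>k\<close> through a free module is absorbed into the second
      summand, so that the identity is a sum of two endomorphisms.\<close>
    define f2 where "f2 = (\<lambda>x\<in>carrier M. k x \<oplus>\<^bsub>M\<^esub> f3 x)"
    have f1: "f1 \<in> mod_hom R M M" unfolding f1_def by (rule mod_hom_compose[OF MM v a])
    have f3: "f3 \<in> mod_hom R M M" unfolding f3_def by (rule mod_hom_compose[OF MM v' a'])
    have f2: "f2 \<in> mod_hom R M M" unfolding f2_def by (rule mod_hom_add[OF MM MM kh f3])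
    have fc: "f1 x \<in> carrier M" "f3 x \<in> carrier M" if "x \<in> carrier M" for x
      using mod_homD(1)[OF f1 that] mod_homD(1)[OF f3 that] by auto
    have "f1 x \<oplus>\<^bsub>M\<^esub> f2 x = x" if x: "x \<in> carrier M" for x
    proof -
      have "x = k x \<oplus>\<^bsub>M\<^esub> (f1 x \<oplus>\<^bsub>M\<^esub> f3 x)"
        using fun_cong[OF w(3), of x] x wc[OF x] by (simp add: compose_eq f1_def f3_def v_def v'_def)
      also have "\<dots> = f1 x \<oplus>\<^bsub>M\<^esub> f2 x" using x kc[OF x] fc[OF x] by (simp add: f2_def M.a_ac)
      finally show ?thesis by simp
    qed
    then have "bij_betw f1 (carrier M) (carrier M) \<or> bij_betw f2 (carrier M) (carrier M)"
      by (rule indecomposable_endo_sum[OF M(2) f1 f2])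
    then show False
    proof
      assume "bij_betw f1 (carrier M) (carrier M)"
      then obtain t where t: "t \<in> mod_hom R M M" "\<forall>y\<in>carrier M. f1 (t y) = y"
        using mod_hom_inverse[OF MM MM f1] by blast
      \<comment> \<open>With an inverse \<open>t\<close> of \<open>f1\<close> the map
        \<open>u\<close> equals u a v t. It factors through the pullback and so dies in the
        cokernel, against its choice.\<close>
      have "(\<lambda>x\<in>carrier M. u (a (compose (carrier M) v t x))) \<in> factor_maps R N L p M"
        using from_P M(1) mod_hom_compose[OF MM t(1) v] by blast
      moreover have "(\<lambda>x\<in>carrier M. u (a (compose (carrier M) v t x))) = u"
        by (rule extensionalityI[OF restrict_extensional mod_homD(4)[OF u(1)]])
           (use t(2) mod_homD(1)[OF t(1)] in \<open>simp add: compose_eq f1_def\<close>)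
      ultimately show False using u(2) by simp
    next
      assume "bij_betw f2 (carrier M) (carrier M)"
      then obtain t where t: "t \<in> mod_hom R M M" "\<forall>y\<in>carrier M. f2 (t y) = y"
        using mod_hom_inverse[OF MM MM f2] by blast
      interpret C: hom_subfunctor R L' "factor_maps R N' L' p'"
        by (rule hom_subfunctor_factor_maps[OF is_cring N' L' p'])
      \<comment> \<open>Here u' = u' f2 t splits into the part \<open>?b\<close> through the second
        pullback and the part \<open>?c\<close> through a free module; both lie in the subgroup of
        maps that die in the cokernel.\<close>
      let ?b = "\<lambda>x\<in>carrier M. u' (a' (compose (carrier M) v' t x))"
      let ?c = "compose (carrier M) u' (compose (carrier M) k t)"
      have b: "?b \<in> factor_maps R N' L' p' M"
        using from_P' M(1) mod_hom_compose[OF MM t(1) v'] by blast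
      have c: "?c \<in> factor_maps R N' L' p' M"
        using C.T_free[OF M(1)] compose_factors_through_free[OF is_cring MM u'(1)
            factors_through_free_compose[OF MM MM t(1) w(2)]] by blast
      have "?c \<otimes>\<^bsub>hom_group R M L'\<^esub> ?b \<in> factor_maps R N' L' p' M"
        by (rule subgroup.m_closed[OF C.T_subgroup[OF M(1)] c b])
      moreover have "?c \<otimes>\<^bsub>hom_group R M L'\<^esub> ?b = u'"
        unfolding hom_group_simps
      proof (rule extensionalityI[OF restrict_extensional mod_homD(4)[OF u'(1)]])
        fix x assume x: "x \<in> carrier M"
        have tx: "t x \<in> carrier M" using mod_homD(1)[OF t(1) x] .
        have "k (t x) \<oplus>\<^bsub>M\<^esub> f3 (t x) = x" using t(2)[rule_format, OF x] tx by (simp add: f2_def)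
        then have "u' x = u' (k (t x) \<oplus>\<^bsub>M\<^esub> f3 (t x))" by simp
        also have "\<dots> = u' (k (t x)) \<oplus>\<^bsub>L'\<^esub> u' (f3 (t x))"
          by (rule mod_homD(2)[OF u'(1) kc[OF tx] fc(2)[OF tx]])
        finally show "(\<lambda>x\<in>carrier M. ?c x \<oplus>\<^bsub>L'\<^esub> ?b x) x = u' x"
          using x tx by (simp add: compose_eq f3_def)
      qed
      ultimately show False using u'(2) by simp
    qed
  qed
  ultimately show ?thesis using WM Q by blast
qed

section \<open>The closure axioms for gamma and Sigma\<close>

lemma closure_empty: "gamma_points R (Sigma_functors R {}) = {}"
proof (rule ccontr)
  assume "gamma_points R (Sigma_functors R {}) \<noteq> {}"
  then obtain Z where Z: "Z \<in> Sp R" "\<forall>F\<in>mod_MCM R. vanishes_at F Z"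
    unfolding gamma_points_def Sigma_functors_def by blast
  then obtain M where M: "Z = iso_class R M" "M \<in> MCM R" "indecomposable R M"
    "\<not> mod_isomorphic R M (regular_module R)" unfolding Sp_def by blast
  note MM = MCM_module[OF M(2)]
  interpret complete_local_module R M by (rule MCM_complete_local_module[OF M(2)])
  \<comment> \<open>The cokernel of the zero map is the functor represented by \<open>M\<close>; it
    vanishes at \<open>M\<close> only if the identity goes through a free module.\<close>
  let ?z = "\<lambda>x\<in>carrier M. \<zero>\<^bsub>M\<^esub>"
  have z: "?z \<in> mod_hom R M M" by (rule mod_homI[OF MM]) simp_all
  obtain F where F: "F \<in> mod_MCM R"
    "trivial_group (ob F M) \<longleftrightarrow> mod_hom R M M \<subseteq> factor_maps R M M ?z M"
    using cokernel_functor_exists[OF is_cring M(2) M(2) z] M(2) by blast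
  have "M \<in> Z" unfolding M(1) iso_class_def using M(2) mod_isomorphic_refl[OF MM] by blast
  then have "mod_hom R M M \<subseteq> factor_maps R M M ?z M" using F Z(2) unfolding vanishes_at_def by blast
  then have "(\<lambda>x\<in>carrier M. x) \<in> factor_maps R M M ?z M" using mod_hom_id[OF MM] by blast
  then obtain w k where w: "w \<in> mod_hom R M M" "k \<in> factors_through_free R M M"
    "(\<lambda>x\<in>carrier M. x) = (\<lambda>x\<in>carrier M. k x \<oplus>\<^bsub>M\<^esub> compose (carrier M) ?z w x)" by (rule factor_mapsE)
  have kh: "k \<in> mod_hom R M M" using w(2) factors_through_free_subset[OF MM] by blast
  have "(\<lambda>x\<in>carrier M. x) = k"
    unfolding w(3)
    by (rule extensionalityI[OF restrict_extensional mod_homD(4)[OF kh]])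
       (use mod_homD(1)[OF kh] mod_homD(1)[OF w(1)] in \<open>simp add: compose_eq\<close>)
  then have "(\<lambda>x\<in>carrier M. x) \<in> factors_through_free R M M" using w(2) by simp
  then show False using iso_regular_if_id_factors_through_free[OF M(3)] M(4) by blast
qed

text \<open>A point outside both closures is detected by one functor for each set. Their common
  quotient is a single functor that vanishes on the union but not at the point.\<close>

lemma closure_Un_subset:
  "gamma_points R (Sigma_functors R (A \<union> B)) \<subseteq>
    gamma_points R (Sigma_functors R A) \<union> gamma_points R (Sigma_functors R B)"
  if AB: "A \<subseteq> Sp R" "B \<subseteq> Sp R"
proof (rule subsetI, rule ccontr)
  fix Z assume Z: "Z \<in> gamma_points R (Sigma_functors R (A \<union> B))"
    and n: "Z \<notin> gamma_points R (Sigma_functors R A) \<union> gamma_points R (Sigma_functors R B)"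
  have ZS: "Z \<in> Sp R" using Z unfolding gamma_points_def by blast
  then obtain M where M: "Z = iso_class R M" "M \<in> MCM R" "indecomposable R M" unfolding Sp_def by blast
  note MM = MCM_module[OF M(2)]
  have MZ: "M \<in> Z" unfolding M(1) iso_class_def using M(2) mod_isomorphic_refl[OF MM] by blast
  \<comment> \<open>The detecting functor for \<open>D\<close> (later \<open>A\<close> or
    \<open>B\<close>) in terms of a map of modules. It may be nonzero at some other member of the
    class \<open>Z\<close>; \<open>factor_maps_iso\<close> moves this to the representative
    \<open>M\<close>.\<close>
  have elem: "\<exists>N\<in>MCM R. \<exists>L\<in>MCM R. \<exists>p\<in>mod_hom R N L. \<not> mod_hom R M L \<subseteq> factor_maps R N L p M \<and>
      (\<forall>Y\<in>D. \<forall>X'\<in>Y. X' \<in> MCM R \<longrightarrow> mod_hom R X' L \<subseteq> factor_maps R N L p X')"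
    if D: "Z \<notin> gamma_points R (Sigma_functors R D)" for D
  proof -
    obtain F where F: "F \<in> mod_MCM R" "\<forall>Y\<in>D. vanishes_at F Y" "\<not> vanishes_at F Z"
      using D ZS unfolding gamma_points_def Sigma_functors_def by blast
    obtain N L p where N: "N \<in> MCM R" and L: "L \<in> MCM R" and p: "p \<in> mod_hom R N L"
      and tr: "\<forall>Y\<in>MCM R. trivial_group (ob F Y) \<longleftrightarrow> mod_hom R Y L \<subseteq> factor_maps R N L p Y"
      using mod_MCM_cokernel[OF is_cring F(1)] by (elim bexE) (rule that)
    obtain M' where M': "M' \<in> MCM R" "mod_isomorphic R M M'" "\<not> trivial_group (ob F M')"
      using F(3) unfolding vanishes_at_def M(1) iso_class_def by blast
    have "\<not> mod_hom R M' L \<subseteq> factor_maps R N L p M'" using tr M'(1,3) by blast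
    then have "\<not> mod_hom R M L \<subseteq> factor_maps R N L p M"
      using factor_maps_iso[OF is_cring N L p M(2) M'(1,2)] by blast
    moreover have "\<forall>Y\<in>D. \<forall>X'\<in>Y. X' \<in> MCM R \<longrightarrow> mod_hom R X' L \<subseteq> factor_maps R N L p X'"
      using F(2) tr unfolding vanishes_at_def by blast
    ultimately show ?thesis using N L p by blast
  qed
  obtain N L p where N: "N \<in> MCM R" and L: "L \<in> MCM R" and p: "p \<in> mod_hom R N L"
    and nv: "\<not> mod_hom R M L \<subseteq> factor_maps R N L p M"
    and A: "\<forall>Y\<in>A. \<forall>X'\<in>Y. X' \<in> MCM R \<longrightarrow> mod_hom R X' L \<subseteq> factor_maps R N L p X'"
    using elem[of A] n by blast
  obtain N' L' p' where N': "N' \<in> MCM R" and L': "L' \<in> MCM R" and p': "p' \<in> mod_hom R N' L'"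
    and nv': "\<not> mod_hom R M L' \<subseteq> factor_maps R N' L' p' M"
    and B: "\<forall>Y\<in>B. \<forall>X'\<in>Y. X' \<in> MCM R \<longrightarrow> mod_hom R X' L' \<subseteq> factor_maps R N' L' p' X'"
    using elem[of B] n by blast
  obtain W q where W: "W \<in> MCM R" and q: "q \<in> mod_hom R W M"
    and nW: "\<not> mod_hom R M M \<subseteq> factor_maps R W M q M"
    and vW: "\<forall>Y\<in>MCM R. mod_hom R Y L \<subseteq> factor_maps R N L p Y \<or> mod_hom R Y L' \<subseteq> factor_maps R N' L' p' Y \<longrightarrow>
      mod_hom R Y M \<subseteq> factor_maps R W M q Y"
    using common_quotient_exists[OF M(2,3) N L p N' L' p' nv nv'] by (elim bexE conjE) (rule that)
  \<comment> \<open>The functor for the common quotient, as the cokernel of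
    \<open>q\<close>.\<close>
  obtain F where F: "F \<in> mod_MCM R"
    and tr: "\<forall>Y\<in>MCM R. trivial_group (ob F Y) \<longleftrightarrow> mod_hom R Y M \<subseteq> factor_maps R W M q Y"
    using cokernel_functor_exists[OF is_cring W M(2) q] by blast
  have "vanishes_at F Y" if Y: "Y \<in> A \<union> B" for Y
    unfolding vanishes_at_def
  proof
    fix X' assume X': "X' \<in> Y"
    have "Y \<in> Sp R" using Y AB by blast
    then have XM: "X' \<in> MCM R" using X' unfolding Sp_def iso_class_def by blast
    have "mod_hom R X' L \<subseteq> factor_maps R N L p X' \<or> mod_hom R X' L' \<subseteq> factor_maps R N' L' p' X'"
      using A B X' XM Y by blast
    then show "trivial_group (ob F X')" using vW[rule_format, OF XM] tr[rule_format, OF XM] by blast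
  qed
  then have "F \<in> Sigma_functors R (A \<union> B)" unfolding Sigma_functors_def using F by blast
  then have "vanishes_at F Z" using Z unfolding gamma_points_def by blast
  then have "trivial_group (ob F M)" unfolding vanishes_at_def using MZ by blast
  then show False using tr nW M(2) by blast
qed

theorem kuratowski_gamma_Sigma:
  "kuratowski_closure_operator (Sp R) (\<lambda>A. gamma_points R (Sigma_functors R A))"
proof -
  have anti: "Sigma_functors R B \<subseteq> Sigma_functors R A" if "A \<subseteq> B" for A B
    using that unfolding Sigma_functors_def by blast
  have anti': "gamma_points R G \<subseteq> gamma_points R F" if "F \<subseteq> G" for F G
    using that unfolding gamma_points_def by blast
  have ext: "A \<subseteq> gamma_points R (Sigma_functors R A)" if "A \<subseteq> Sp R" for A
    using that unfolding gamma_points_def Sigma_functors_def by blast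
  \<comment> \<open>The other unit of the Galois connection: a functor vanishing on \<open>A\<close>
    vanishes on the closure by definition. With the order-reversed form of \<open>ext\<close> this
    gives idempotence.\<close>
  have "Sigma_functors R A \<subseteq> Sigma_functors R (gamma_points R (Sigma_functors R A))" for A
    unfolding gamma_points_def Sigma_functors_def by blast
  then have idem: "gamma_points R (Sigma_functors R (gamma_points R (Sigma_functors R A)))
      = gamma_points R (Sigma_functors R A)" if "A \<subseteq> Sp R" for A
    using anti[OF ext[OF that]] by (intro arg_cong[of _ _ "gamma_points R"] subset_antisym)
  have "gamma_points R (Sigma_functors R (A \<union> B)) =
      gamma_points R (Sigma_functors R A) \<union> gamma_points R (Sigma_functors R B)"
    if "A \<subseteq> Sp R" "B \<subseteq> Sp R" for A B
    using closure_Un_subset[OF that] anti'[OF anti[of A "A \<union> B"]] anti'[OF anti[of B "A \<union> B"]] by auto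
  moreover have "gamma_points R F \<subseteq> Sp R" for F unfolding gamma_points_def by blast
  ultimately show ?thesis
    unfolding kuratowski_closure_operator_def using closure_empty ext idem by blast
qed

end

section \<open>The topology of a closure operator\<close>

lemma kuratowski_topology:
  assumes c: "kuratowski_closure_operator S c"
  shows "\<exists>T. topspace T = S \<and> (\<forall>A. closedin T A \<longleftrightarrow> A \<subseteq> S \<and> c A = A)"
proof -
  note c = c[unfolded kuratowski_closure_operator_def]
  have sub: "c A \<subseteq> S" if "A \<subseteq> S" for A using c that by simp
  have ext: "A \<subseteq> c A" if "A \<subseteq> S" for A using c that by simp
  have emp: "c {} = {}" using c by simp
  have un: "c (A \<union> B) = c A \<union> c B" if "A \<subseteq> S" "B \<subseteq> S" for A B using c that by simp
  have mono: "c A \<subseteq> c B" if "A \<subseteq> B" "B \<subseteq> S" for A B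
  proof -
    have "A \<union> B = B" using that by blast
    then show ?thesis using un[of A B] that by auto
  qed
  \<comment> \<open>Open sets are the complements of fixed sets. Finite additivity of
    \<open>c\<close> handles intersections of two, and monotonicity, itself a consequence of
    additivity, handles arbitrary unions.\<close>
  define U where "U A \<longleftrightarrow> A \<subseteq> S \<and> c (S - A) = S - A" for A
  have "istopology U"
    unfolding istopology_def
  proof (intro conjI allI impI)
    show "U (A \<inter> B)" if "U A" "U B" for A B
    proof -
      have "S - A \<inter> B = (S - A) \<union> (S - B)" by blast
      then show ?thesis using that un[of "S - A" "S - B"] unfolding U_def by auto
    qed
    show "U (\<Union>K)" if K: "\<forall>A\<in>K. U A" for K
    proof -
      have KS: "\<Union>K \<subseteq> S" using K unfolding U_def by blast
      have "c (S - \<Union>K) \<subseteq> S - A" if "A \<in> K" for A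
      proof -
        have "c (S - \<Union>K) \<subseteq> c (S - A)" by (rule mono) (use that in auto)
        then show ?thesis using K that unfolding U_def by auto
      qed
      moreover have "c (S - \<Union>K) \<subseteq> S" by (rule sub) blast
      ultimately have "c (S - \<Union>K) \<subseteq> S - \<Union>K" by blast
      moreover have "S - \<Union>K \<subseteq> c (S - \<Union>K)" by (rule ext) blast
      ultimately show ?thesis using KS unfolding U_def by blast
    qed
  qed
  then have op: "openin (topology U) = U" by (rule topology_inverse')
  have US: "U S" unfolding U_def using emp by simp
  then have top: "topspace (topology U) = S"
    unfolding topspace_def op using U_def by blast
  have "closedin (topology U) A \<longleftrightarrow> A \<subseteq> S \<and> c A = A" for A
    unfolding closedin_def top op U_def by (auto simp: double_diff)
  then show ?thesis using top by blast
qed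

theorem theorem1p1:
  fixes R :: "'a ring"
  assumes "local_ring R"
    and "noetherian_ring R"
    and "adic_complete R (max_ideal R)"
    and "cohen_macaulay R"
    and "algebraically_closed (R Quot max_ideal R)"
  shows "kuratowski_closure_operator (Sp R) (\<lambda>A. gamma_points R (Sigma_functors R A)) \<and>
    (\<exists>T. topspace T = Sp R \<and>
         (\<forall>A. closedin T A \<longleftrightarrow> A \<subseteq> Sp R \<and> gamma_points R (Sigma_functors R A) = A))"
proof -
  interpret local_noetherian R
    using assms(1,2) by (simp add: local_noetherian_def local_noetherian_axioms_def)
  interpret complete_cm_ring R
    using assms(3,4) by unfold_locales
  show ?thesis
    using kuratowski_gamma_Sigma kuratowski_topology[OF kuratowski_gamma_Sigma] by simp
qed

end
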